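(* There are finitely generated subgroups $H_0$ and $H_1$ of Thompson's group $F$, both elementary amenable of EA-class $\omega+2$, such that $H_0$ does not embed into $H_1$ and $H_1$ does not embed into $H_0$.
   Context: Thompson's group $F$ is the group of piecewise linear orientation-preserving homeomorphisms of $[0,1]$ with finitely many breakpoints, all at dyadic rationals, and slopes integral powers of $2$. Elementary amenable groups: the smallest class $EG$ containing finite and abelian groups, closed under extensions and directed unions; $EG_0$ = finite and abelian groups, $EG_{\alpha+1}$ = groups obtained from members of $EG_\alpha$ by one extension or one directed union, $EG_\alpha=\bigcup_{\beta<\alpha}EG_\beta$ for limit $\alpha$; the EA-class of $G$ is the least $\alpha$ with $G\in EG_\alpha$. "Embeds" means there is an injective group homomorphism. *)

theory Defs
  imports "HOL-Analysis.Analysis" "HOL-Algebra.Algebra"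
begin

definition dyadic :: "real \<Rightarrow> bool" where
  "dyadic x \<longleftrightarrow> (\<exists>(m::int) (k::nat). x = real_of_int m / 2 ^ k)"

text \<open>Elements of F are represented as functions real to real that are the identity
  outside [0,1] (so that composition and equality of functions are the group
  operation and equality of homeomorphisms of [0,1]).\<close>

definition thompsonF_elem :: "(real \<Rightarrow> real) \<Rightarrow> bool" where
  "thompsonF_elem f \<longleftrightarrow>
     (\<exists>g. homeomorphism {0..1} {0..1} f g) \<and>
     strict_mono_on {0..1} f \<and>
     (\<forall>x. x \<notin> {0..1} \<longrightarrow> f x = x) \<and>
     (\<exists>(n::nat) (t::nat \<Rightarrow> real).
        t 0 = 0 \<and> t n = 1 \<and>
        (\<forall>i<n. t i < t (Suc i)) \<and>
        (\<forall>i\<le>n. dyadic (t i)) \<and>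
        (\<forall>i<n. \<exists>(k::int) (b::real). \<forall>x\<in>{t i..t (Suc i)}. f x = 2 powr (real_of_int k) * x + b))"

definition thompsonF :: "(real \<Rightarrow> real) monoid" where
  "thompsonF = \<lparr>carrier = {f. thompsonF_elem f}, mult = (\<lambda>f g. f \<circ> g), one = id\<rparr>"

definition fin_gen_subgroup :: "('a, 'b) monoid_scheme \<Rightarrow> 'a set \<Rightarrow> bool" where
  "fin_gen_subgroup G H \<longleftrightarrow> subgroup H G \<and> (\<exists>S. finite S \<and> S \<subseteq> H \<and> generate G S = H)"

definition embeds :: "('a, 'c) monoid_scheme \<Rightarrow> ('b, 'd) monoid_scheme \<Rightarrow> bool" where
  "embeds G H \<longleftrightarrow> (\<exists>h. h \<in> hom G H \<and> inj_on h (carrier G))"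

text \<open>Classes of groups are predicates on groups whose carrier lies in a fixed type 'a.
  Quotients are taken up to isomorphism with a group on the same type.\<close>

definition EG_base :: "'a monoid \<Rightarrow> bool" where
  "EG_base G \<longleftrightarrow> group G \<and> (finite (carrier G) \<or> comm_group G)"

definition EG_step :: "('a monoid \<Rightarrow> bool) \<Rightarrow> 'a monoid \<Rightarrow> bool" where
  "EG_step C G \<longleftrightarrow> group G \<and>
     ((\<exists>N. N \<lhd> G \<and> C (G\<lparr>carrier := N\<rparr>) \<and> (\<exists>Q::'a monoid. C Q \<and> Q \<cong> G Mod N))
      \<or>
      (\<exists>\<S>. \<S> \<noteq> {} \<and> (\<forall>H\<in>\<S>. subgroup H G \<and> C (G\<lparr>carrier := H\<rparr>)) \<and>
            (\<forall>A\<in>\<S>. \<forall>B\<in>\<S>. \<exists>D\<in>\<S>. A \<union> B \<subseteq> D) \<and>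
            \<Union>\<S> = carrier G))"

primrec EG_fin :: "nat \<Rightarrow> 'a monoid \<Rightarrow> bool" where
  "EG_fin 0 = EG_base"
| "EG_fin (Suc n) = EG_step (EG_fin n)"

primrec EG_omega_plus :: "nat \<Rightarrow> 'a monoid \<Rightarrow> bool" where
  "EG_omega_plus 0 = (\<lambda>G. \<exists>n. EG_fin n G)"
| "EG_omega_plus (Suc k) = EG_step (EG_omega_plus k)"

definition EA_class_omega_plus_2 :: "'a monoid \<Rightarrow> bool" where
  "EA_class_omega_plus_2 G \<longleftrightarrow>
     EG_omega_plus 2 G \<and> (\<forall>n. \<not> EG_fin n G) \<and> \<not> EG_omega_plus 0 G \<and> \<not> EG_omega_plus 1 G"

end

theory Submission
  imports Defs
begin

text \<open>\<open>H0\<close> and \<open>H1\<close> are built from the Brin--Navas group \<open>B = \<langle>f, g\<rangle>\<close>, in which \<open>f\<close> expands a nested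
  sequence of intervals \<open>level i\<close> and all nonzero powers of \<open>bump i = f\<^sup>i g f\<^sup>-\<^sup>i\<close> move \<open>level i\<close> off
  itself within \<open>level (i + 1)\<close>. Finitely many consecutive bumps generate an iterated wreath product
  of infinite cyclic groups, so the normal closure \<open>N\<close> of \<open>g\<close> is locally solvable, with cyclic quotient
  generated by \<open>f\<close>; this gives class at most \<open>\<omega> + 2\<close>. Conversely, a normal subgroup of a long wreath
  product or the corresponding quotient involves a wreath product of half the length, which excludes
  all finite classes, and a finitely generated group of class at most \<open>\<omega> + 1\<close> has finite class.

  \<open>H1\<close> is \<open>B \<times> B\<close> and \<open>H0 = \<langle>f, g, h\<rangle>\<close>, where \<open>h\<close> commutes with \<open>f\<close> and has support inside all
  levels. \<open>H1\<close> does not embed into \<open>H0\<close>: the latter is locally solvable by cyclic, but the kernel of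
  any homomorphism from \<open>H1\<close> to the integers contains a finitely generated subgroup that is not
  solvable. \<open>H0\<close> does not embed into \<open>H1\<close>: no element of \<open>B - N\<close> commutes with a nontrivial element
  of \<open>N\<close>, so a homomorphism from \<open>H0\<close> to \<open>B\<close> kills \<open>[h, g]\<close> or all iterated commutators of a certain
  depth in \<open>\<langle>f, [f, g]\<rangle>\<close>; the commutator of \<open>[h, g]\<close> with such an iterated commutator dies in both
  factors of \<open>H1\<close>. Permutation groups are written additively.\<close>

section \<open>Subgroups of additively written groups\<close>

text \<open>Both groups contain a copy of \<open>B\<close> and have the same class, so the class
  cannot tell them apart; only the interplay of degree (the exponent of \<open>f\<close>) with the
  kernel of the degree can. The generator \<open>h\<close> creates a centralizer that is absent from
  \<open>B\<close>, while the second factor creates an independent second degree. The obstacle is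
  that \<open>N\<close> is not solvable: only its finitely generated subgroups are, and no bound on
  their derived lengths holds for all of them. Each obstruction therefore fixes a finite set of
  generators before the depth is known, and must supply nontrivial iterated commutators over that
  set at every depth. No presentations are used. Relations and their failure are read off from how
  elements move the nested levels, so realizing the groups inside F only takes a few piecewise
  linear maps with prescribed values at dyadic points.\<close>

text \<open>As rewrite rules these form the complete system for words in free groups: sums are
  nested to the right and adjacent inverses cancel. Hence \<open>simp only: grp\<close> settles the
  conjugation and commutator identities.\<close>

lemmas grp = diff_conv_add_uminus minus_add add.assoc minus_minus left_minus right_minus
  minus_add_cancel add_minus_cancel add.left_neutral add.right_neutral minus_zero

definition sg :: "'a::group_add set \<Rightarrow> bool" where
  "sg H \<longleftrightarrow> 0 \<in> H \<and> (\<forall>x\<in>H. \<forall>y\<in>H. x + y \<in> H) \<and> (\<forall>x\<in>H. - x \<in> H)"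

text \<open>Words grow by one letter on the left, so an induction meets a single generator or its
  inverse; closure under sums and inverses is derived afterwards.\<close>

inductive_set gen :: "'a::group_add set \<Rightarrow> 'a set" for S where
  gen_zero: "0 \<in> gen S"
| gen_add: "s \<in> S \<Longrightarrow> x \<in> gen S \<Longrightarrow> s + x \<in> gen S"
| gen_minus: "s \<in> S \<Longrightarrow> x \<in> gen S \<Longrightarrow> - s + x \<in> gen S"

definition com :: "'a::group_add \<Rightarrow> 'a \<Rightarrow> 'a" where
  "com x y = x + y - x - y"

definition coms :: "'a::group_add set \<Rightarrow> 'a set" where
  "coms W = (\<Union>x\<in>W. com x ` W)"

text \<open>These are the values of the n-th derived word, not the subgroup generated by them. For a
  subgroup \<open>H\<close>, \<open>icoms n H \<subseteq> {0}\<close> says that \<open>H\<close> is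
  solvable of derived length at most n. Values are easier to push through homomorphisms and to
  evaluate at points.\<close>

primrec icoms :: "nat \<Rightarrow> 'a::group_add set \<Rightarrow> 'a set" where
  "icoms 0 W = W"
| "icoms (Suc n) W = icoms n (coms W)"

definition zmul :: "int \<Rightarrow> 'a::group_add \<Rightarrow> 'a" where
  "zmul k x = (if 0 \<le> k then ((+) x ^^ nat k) 0 else ((+) (- x) ^^ nat (- k)) 0)"

lemma sgD:
  assumes "sg H"
  shows "0 \<in> H" "x \<in> H \<Longrightarrow> y \<in> H \<Longrightarrow> x + y \<in> H" "x \<in> H \<Longrightarrow> - x \<in> H"
    "x \<in> H \<Longrightarrow> y \<in> H \<Longrightarrow> x - y \<in> H" "x \<in> H \<Longrightarrow> y \<in> H \<Longrightarrow> com x y \<in> H"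
proof -
  show 0: "0 \<in> H" and p: "x \<in> H \<Longrightarrow> y \<in> H \<Longrightarrow> x + y \<in> H" and m: "x \<in> H \<Longrightarrow> - x \<in> H" for x y
    using assms by (auto simp: sg_def)
  show d: "x \<in> H \<Longrightarrow> y \<in> H \<Longrightarrow> x - y \<in> H" for x y
    using p[of x "- y"] m[of y] by simp
  show "x \<in> H \<Longrightarrow> y \<in> H \<Longrightarrow> com x y \<in> H"
    unfolding com_def by (intro d p)
qed

lemma gen_base: "s \<in> S \<Longrightarrow> s \<in> gen S"
  using gen_add[of s S 0] gen_zero[of S] by simp

lemma gen_add_closed: "x \<in> gen S \<Longrightarrow> y \<in> gen S \<Longrightarrow> x + y \<in> gen S"
  by (induction x rule: gen.induct) (auto simp: add.assoc intro: gen.intros)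

lemma sg_gen: "sg (gen S)"
proof -
  have "- x \<in> gen S" if "x \<in> gen S" for x
    using that
  proof induction
    case gen_zero
    then show ?case by (simp add: gen.gen_zero)
  next
    case (gen_add s x)
    have "- s + 0 \<in> gen S" using gen_add by (intro gen.intros)
    then show ?case using gen_add gen_add_closed[of "- x" S "- s"] by (simp add: minus_add)
  next
    case (gen_minus s x)
    then show ?case using gen_add_closed[of "- x" S s] gen_base[of s S]
      by (simp only: minus_add minus_minus)
  qed
  then show ?thesis by (auto simp: sg_def gen_zero gen_add_closed)
qed

lemmas genD = sgD[OF sg_gen]

lemma gen_least: "sg H \<Longrightarrow> S \<subseteq> H \<Longrightarrow> gen S \<subseteq> H"
proof
  fix x assume "sg H" "S \<subseteq> H" "x \<in> gen S"
  from this(3,1,2) show "x \<in> H"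
    by induction (auto intro: sgD)
qed

lemma gen_mono: "S \<subseteq> T \<Longrightarrow> gen S \<subseteq> gen T"
  by (intro gen_least sg_gen) (auto intro: gen_base)

lemma gen_insert_zero: "gen (insert 0 S) = gen S"
  by (intro equalityI gen_least sg_gen gen_mono) (auto intro: gen_base gen_zero)

lemma gen_empty: "gen {} = {0}"
  by (intro equalityI gen_least) (auto simp: sg_def gen_zero)

lemma gen_finite_support: "x \<in> gen S \<Longrightarrow> \<exists>A. finite A \<and> A \<subseteq> S \<and> x \<in> gen A"
proof (induction rule: gen.induct)
  case gen_zero
  then show ?case by (auto intro!: exI[of _ "{}"] gen.gen_zero)
next
  case (gen_add s x)
  then obtain A where "finite A" "A \<subseteq> S" "x \<in> gen A" by auto
  then show ?case using gen_add(1) gen_mono[of A "insert s A"]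
    by (intro exI[of _ "insert s A"]) (auto intro!: gen.gen_add)
next
  case (gen_minus s x)
  then obtain A where "finite A" "A \<subseteq> S" "x \<in> gen A" by auto
  then show ?case using gen_minus(1) gen_mono[of A "insert s A"]
    by (intro exI[of _ "insert s A"]) (auto intro!: gen.gen_minus)
qed

lemma zmul_0 [simp]: "zmul 0 x = 0" and zmul_1 [simp]: "zmul 1 x = x"
  by (simp_all add: zmul_def)

lemma zmul_succ: "zmul (k + 1) x = x + zmul k x"
proof (cases "0 \<le> k")
  case True
  then have "nat (k + 1) = Suc (nat k)" by simp
  then show ?thesis using True by (simp add: zmul_def)
next
  case False
  then have k: "nat (- k) = Suc (nat (- (k + 1)))" by simp
  have "x + zmul k x = ((+) (- x) ^^ nat (- (k + 1))) 0"
    using False by (simp add: zmul_def k add.assoc[symmetric] del: add_uminus_conv_diff)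
  then show ?thesis using False by (auto simp: zmul_def)
qed

lemma zmul_pred: "zmul (k - 1) x = - x + zmul k x"
  using zmul_succ[of "k - 1" x] by (simp add: add.assoc[symmetric] del: add_uminus_conv_diff)

lemma zmul_add: "zmul (k + l) x = zmul k x + zmul l x"
proof (induction k rule: int_induct[where k = 0])
  case (step1 i)
  then show ?case using zmul_succ[of "i + l" x] zmul_succ[of i x] by (simp add: ac_simps add.assoc)
next
  case (step2 i)
  then show ?case using zmul_pred[of "i + l" x] zmul_pred[of i x]
    by (simp add: algebra_simps add.assoc del: add_uminus_conv_diff)
qed simp

lemma zmul_uminus: "zmul (- k) x = - zmul k x"
  using zmul_add[of "- k" k x] by (simp add: eq_neg_iff_add_eq_0)

lemma zmul_minus1 [simp]: "zmul (- 1) x = - x"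
  using zmul_uminus[of 1 x] by simp

lemma zmul_in: "sg H \<Longrightarrow> x \<in> H \<Longrightarrow> zmul k x \<in> H"
proof (induction k rule: int_induct[where k = 0])
  case (step1 i) then show ?case by (simp add: zmul_succ sgD)
next
  case (step2 i) then show ?case by (simp add: zmul_pred sgD del: add_uminus_conv_diff)
qed (auto simp: sgD)

lemma com_eq_0: "com x y = 0 \<longleftrightarrow> x + y = y + x"
  by (simp add: com_def diff_eq_eq)

lemma com_conj: "g + com x y - g = com (g + x - g) (g + y - g)"
  unfolding com_def by (simp only: grp)

lemma uminus_com: "- com x y = com y x"
  unfolding com_def by (simp only: grp)

lemma coms_mono: "W \<subseteq> Y \<Longrightarrow> coms W \<subseteq> coms Y"
  by (auto simp: coms_def)

lemma comsI: "x \<in> W \<Longrightarrow> y \<in> W \<Longrightarrow> com x y \<in> coms W"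
  by (auto simp: coms_def)

lemma icoms_mono: "W \<subseteq> Y \<Longrightarrow> icoms n W \<subseteq> icoms n Y"
  by (induction n arbitrary: W Y) (auto dest: coms_mono)

lemma icoms_Suc: "icoms (Suc n) W = coms (icoms n W)"
  by (induction n arbitrary: W) auto

lemma icoms_add: "icoms (m + n) W = icoms m (icoms n W)"
  by (induction n arbitrary: W) auto

lemma coms_sg: "sg H \<Longrightarrow> W \<subseteq> H \<Longrightarrow> coms W \<subseteq> H"
  by (auto simp: coms_def intro: sgD)

lemma icoms_sg: "sg H \<Longrightarrow> icoms n H \<subseteq> H"
  by (induction n) (auto simp: icoms_Suc simp del: icoms.simps(2) dest: coms_sg)

lemma icoms_antimono: "sg H \<Longrightarrow> m \<le> n \<Longrightarrow> icoms n H \<subseteq> icoms m H"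
  using icoms_add[of m "n - m" H] icoms_mono[OF icoms_sg, of H m "n - m"] by simp

text \<open>Invariance of \<open>W\<close> under conjugation makes \<open>gen (coms W)\<close>
  normal in \<open>G\<close>. Modulo it, the elements commuting with a fixed one form a subgroup;
  using this once in each argument passes from \<open>W\<close> to \<open>gen W\<close>.\<close>

lemma coms_gen:
  assumes "sg G" "W \<subseteq> G" and conj: "\<And>g x. g \<in> G \<Longrightarrow> x \<in> W \<Longrightarrow> g + x - g \<in> W"
  shows "coms (gen W) \<subseteq> gen (coms W)"
proof -
  have GW: "gen W \<subseteq> G" using assms by (intro gen_least)
  have normal: "g + l - g \<in> gen (coms W)" if "l \<in> gen (coms W)" "g \<in> G" for g l
    using that(1)
  proof induction
    case gen_zero
    then show ?case by (simp add: gen.gen_zero)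
  next
    case (gen_add s x)
    have "g + s - g \<in> coms W" using gen_add(1) conj that(2) by (force simp: coms_def com_conj)
    moreover have "g + (s + x) - g = (g + s - g) + (g + x - g)" by (simp only: grp)
    ultimately show ?case using gen_add(3) by (simp only: gen.gen_add)
  next
    case (gen_minus s x)
    have "g + s - g \<in> coms W" using gen_minus(1) conj that(2) by (force simp: coms_def com_conj)
    moreover have "g + (- s + x) - g = - (g + s - g) + (g + x - g)" by (simp only: grp)
    ultimately show ?case using gen_minus(3) by (simp only: gen.gen_minus)
  qed
  have centralizer: "sg {y \<in> G. com x y \<in> gen (coms W)}" if "x \<in> G" for x
  proof -
    have "com x (y + z) = com x y + (y + com x z - y)" "com x (- y) = - y + (- com x y) - (- y)" for y z
      by (simp_all only: com_def grp)
    moreover have "com x 0 = 0" by (simp add: com_def)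
    moreover have "y + com x z - y \<in> gen (coms W)" "- y + (- com x z) - (- y) \<in> gen (coms W)"
      if "y \<in> G" "com x z \<in> gen (coms W)" for y z
      using normal[of "com x z" y] normal[of "- com x z" "- y"] that sgD(3)[OF \<open>sg G\<close>] genD(3)
      by auto
    ultimately show ?thesis
      unfolding sg_def using sgD(1-3)[OF \<open>sg G\<close>]
      by (simp add: gen_zero del: add_uminus_conv_diff diff_minus_eq_add) (blast intro: genD(2))
  qed
  have swap: "com x y \<in> gen (coms W) \<longleftrightarrow> com y x \<in> gen (coms W)" for x y
    using genD(3)[of "com x y" "coms W"] genD(3)[of "com y x" "coms W"] by (auto simp: uminus_com)
  have "gen W \<subseteq> {y \<in> G. com x y \<in> gen (coms W)}" if "x \<in> W" for x
    using that assms by (intro gen_least centralizer) (auto intro: gen_base comsI)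
  then have 1: "com y x \<in> gen (coms W)" if "x \<in> W" "y \<in> gen W" for x y
    using that swap by auto
  have "gen W \<subseteq> {y \<in> G. com x y \<in> gen (coms W)}" if "x \<in> gen W" for x
    using that assms 1 GW by (intro gen_least centralizer) auto
  then show ?thesis by (auto simp: coms_def)
qed

text \<open>With \<open>coms H\<close> for \<open>W\<close>, a law for commutator values becomes a
  law for the derived subgroup \<open>gen (coms H)\<close>.\<close>

lemma icoms_gen:
  assumes "sg G" "W \<subseteq> G" "\<And>g x. g \<in> G \<Longrightarrow> x \<in> W \<Longrightarrow> g + x - g \<in> W"
  shows "icoms n (gen W) \<subseteq> gen (icoms n W)"
  using assms
proof (induction n arbitrary: W)
  case (Suc n)
  have "icoms (Suc n) (gen W) \<subseteq> icoms n (gen (coms W))"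
    using coms_gen[OF Suc.prems] by (auto dest: icoms_mono)
  also have "\<dots> \<subseteq> gen (icoms n (coms W))"
  proof (rule Suc.IH)
    show "g + x - g \<in> coms W" if "g \<in> G" "x \<in> coms W" for g x
      using that Suc.prems(3) by (force simp: coms_def com_conj)
  qed (use Suc.prems coms_sg[OF Suc.prems(1,2)] in auto)
  finally show ?case by simp
qed simp

section \<open>Homomorphisms defined on a subgroup\<close>

definition add_hom_on :: "'a::group_add set \<Rightarrow> ('a \<Rightarrow> 'b::group_add) \<Rightarrow> bool" where
  "add_hom_on H \<theta> \<longleftrightarrow> (\<forall>x\<in>H. \<forall>y\<in>H. \<theta> (x + y) = \<theta> x + \<theta> y)"

lemma add_hom_onD:
  assumes "add_hom_on H \<theta>" "sg H"
  shows "x \<in> H \<Longrightarrow> y \<in> H \<Longrightarrow> \<theta> (x + y) = \<theta> x + \<theta> y" "\<theta> 0 = 0"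
    "x \<in> H \<Longrightarrow> \<theta> (- x) = - \<theta> x" "x \<in> H \<Longrightarrow> y \<in> H \<Longrightarrow> \<theta> (x - y) = \<theta> x - \<theta> y"
    "x \<in> H \<Longrightarrow> y \<in> H \<Longrightarrow> \<theta> (com x y) = com (\<theta> x) (\<theta> y)"
    "x \<in> H \<Longrightarrow> \<theta> (zmul k x) = zmul k (\<theta> x)"
proof -
  show p: "\<theta> (x + y) = \<theta> x + \<theta> y" if "x \<in> H" "y \<in> H" for x y
    using assms that by (auto simp: add_hom_on_def)
  show z: "\<theta> 0 = 0" using p[of 0 0] assms sgD(1) by (metis add.right_neutral add_left_cancel)
  show m: "\<theta> (- x) = - \<theta> x" if "x \<in> H" for x
    using p[of "- x" x] that assms z by (simp add: sgD eq_neg_iff_add_eq_0)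
  show d: "\<theta> (x - y) = \<theta> x - \<theta> y" if "x \<in> H" "y \<in> H" for x y
    using p[of x "- y"] m[of y] that assms by (simp add: sgD)
  show "\<theta> (com x y) = com (\<theta> x) (\<theta> y)" if "x \<in> H" "y \<in> H"
    using that assms by (simp add: com_def d p sgD)
  show "\<theta> (zmul k x) = zmul k (\<theta> x)" if "x \<in> H"
  proof (induction k rule: int_induct[where k = 0])
    case (step1 i) then show ?case using that assms by (simp add: zmul_succ zmul_in p)
  next
    case (step2 i) then show ?case
      using that assms by (simp add: zmul_pred zmul_in p m sgD del: add_uminus_conv_diff)
  qed (simp add: z)
qed

lemma hom_gen:
  assumes "add_hom_on H \<theta>" "sg H" "S \<subseteq> H"
  shows "\<theta> ` gen S = gen (\<theta> ` S)"
proof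
  have S: "gen S \<subseteq> H" using assms by (intro gen_least)
  have "\<theta> x \<in> gen (\<theta> ` S)" if "x \<in> gen S" for x
    using that by induction
      (use assms S in \<open>auto simp: add_hom_onD[OF assms(1,2)] sgD subset_iff intro: gen.intros
        simp del: add_uminus_conv_diff\<close>)
  then show "\<theta> ` gen S \<subseteq> gen (\<theta> ` S)" by auto
  have "\<exists>x\<in>gen S. y = \<theta> x" if "y \<in> gen (\<theta> ` S)" for y
    using that
  proof induction
    case gen_zero
    show ?case using add_hom_onD(2)[OF assms(1,2)] by (auto intro: gen.gen_zero)
  next
    case (gen_add s y)
    then obtain t x where "t \<in> S" "s = \<theta> t" "x \<in> gen S" "y = \<theta> x" by auto
    then show ?case using S assms
      by (intro bexI[of _ "t + x"])
        (auto intro: gen.intros simp: subset_iff add_hom_onD(1)[OF assms(1,2)])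
  next
    case (gen_minus s y)
    then obtain t x where tx: "t \<in> S" "s = \<theta> t" "x \<in> gen S" "y = \<theta> x" by auto
    then have "\<theta> (- t + x) = - s + y"
      using S assms(2,3) by (subst add_hom_onD[OF assms(1,2)])
        (auto simp: sgD add_hom_onD[OF assms(1,2)] simp del: add_uminus_conv_diff)
    then show ?case using tx by (intro bexI[of _ "- t + x"]) (auto intro: gen.intros)
  qed
  then show "gen (\<theta> ` S) \<subseteq> \<theta> ` gen S" by auto
qed

lemma hom_coms:
  assumes "add_hom_on H \<theta>" "sg H" "W \<subseteq> H"
  shows "\<theta> ` coms W = coms (\<theta> ` W)"
proof -
  have "\<theta> (com x y) = com (\<theta> x) (\<theta> y)" if "x \<in> W" "y \<in> W" for x y
    using that assms(3) by (intro add_hom_onD(5)[OF assms(1,2)]) auto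
  then show ?thesis unfolding coms_def by (force simp: image_iff)
qed

lemma hom_icoms:
  assumes "add_hom_on H \<theta>" "sg H" "W \<subseteq> H"
  shows "\<theta> ` icoms n W = icoms n (\<theta> ` W)"
  using assms(3)
proof (induction n arbitrary: W)
  case (Suc n)
  then show ?case
    using coms_sg[OF assms(2) Suc.prems] by (simp add: hom_coms[OF assms(1,2)])
qed simp

section \<open>Permutations and wreath products\<close>

text \<open>Bijections become a type of their own in order to be an instance of
  \<open>group_add\<close>, with composition as addition.\<close>

typedef 'a perm = "{f :: 'a \<Rightarrow> 'a. bij f}" morphisms app Perm
  by (rule exI[of _ id]) simp

lemma bij_app [simp]: "bij (app p)"
  using app[of p] by simp

lemma app_Perm: "bij f \<Longrightarrow> app (Perm f) = f"
  by (simp add: Perm_inverse)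

instantiation perm :: (type) group_add
begin

definition "0 = Perm id"
definition "p + q = Perm (app p \<circ> app q)"
definition "- p = Perm (inv_into UNIV (app p))"
definition "p - q = Perm (app p \<circ> inv_into UNIV (app q))"

instance
proof
  fix a b c :: "'a perm"
  show "a + b + c = a + (b + c)"
    by (simp add: plus_perm_def app_Perm bij_comp comp_assoc)
  show "0 + a = a" "a + 0 = a"
    by (simp_all add: plus_perm_def zero_perm_def app_Perm app_inverse)
  show "- a + a = 0"
    using bij_is_inj[OF bij_app, of a]
    by (simp add: plus_perm_def zero_perm_def uminus_perm_def app_Perm bij_imp_bij_inv)
  show "a + - b = a - b"
    by (simp add: plus_perm_def uminus_perm_def minus_perm_def app_Perm bij_imp_bij_inv)
qed

end

lemma app_0: "app 0 = id"
  by (simp add: zero_perm_def app_Perm)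

lemma app_add: "app (p + q) = app p \<circ> app q"
  by (simp add: plus_perm_def app_Perm bij_comp)

lemma app_0' [simp]: "app 0 x = x"
  by (simp add: app_0)

lemma app_add' [simp]: "app (p + q) x = app p (app q x)"
  by (simp add: app_add)

lemma app_minus_app [simp]: "app (- p) (app p x) = x" "app p (app (- p) x) = x"
  using app_add'[of "- p" p x] app_add'[of p "- p" x] by (simp_all del: app_add')

lemma app_diff [simp]: "app (p - q) x = app p (app (- q) x)"
  using app_add'[of p "- q" x] by simp

lemma app_eq_iff [simp]: "app p x = app p y \<longleftrightarrow> x = y"
  using bij_is_inj[OF bij_app, of p] by (auto dest: injD)

lemma app_minus_eq_iff: "app (- p) x = y \<longleftrightarrow> x = app p y"
  by auto

lemma perm_eqI: "(\<And>x. app p x = app q x) \<Longrightarrow> p = q"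
  by (simp add: app_inject[symmetric] fun_eq_iff)

lemma app_image_add: "app (p + q) ` A = app p ` app q ` A"
  by (auto simp: image_image)

lemma app_image_minus: "app (- p) ` A = B \<longleftrightarrow> A = app p ` B"
  by (force simp: image_iff)

lemma app_image_Int: "app p ` A \<inter> app p ` B = app p ` (A \<inter> B)"
  by (auto simp: image_iff)

lemma mem_app_image: "x \<in> app p ` A \<longleftrightarrow> app (- p) x \<in> A"
  by (force simp: image_iff)

definition sup_in :: "'a perm \<Rightarrow> 'a set \<Rightarrow> bool" where
  "sup_in p A \<longleftrightarrow> (\<forall>x. x \<notin> A \<longrightarrow> app p x = x)"

lemma sup_in_app: "sup_in p A \<Longrightarrow> app p x \<in> A \<longleftrightarrow> x \<in> A"
  unfolding sup_in_def by (metis app_minus_app(1))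

lemma sup_in_minus [simp]: "sup_in (- p) A \<longleftrightarrow> sup_in p A"
  unfolding sup_in_def by (metis app_minus_app)

lemma sup_in_zero [simp]: "sup_in 0 A"
  by (simp add: sup_in_def)

lemma sup_in_add: "sup_in p A \<Longrightarrow> sup_in q A \<Longrightarrow> sup_in (p + q) A"
  by (auto simp: sup_in_def)

lemma sup_in_diff: "sup_in p A \<Longrightarrow> sup_in q A \<Longrightarrow> sup_in (p - q) A"
  using sup_in_add[of p A "- q"] by simp

lemma sup_in_mono: "sup_in p A \<Longrightarrow> A \<subseteq> B \<Longrightarrow> sup_in p B"
  by (auto simp: sup_in_def)

lemma sup_in_conj: "sup_in p A \<Longrightarrow> sup_in (q + p - q) (app q ` A)"
  unfolding sup_in_def by (auto simp: mem_app_image)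

lemma sg_sup_in: "sg {p. sup_in p A}"
  by (auto simp: sg_def intro: sup_in_add)

lemma sup_in_gen: "p \<in> gen S \<Longrightarrow> (\<And>s. s \<in> S \<Longrightarrow> sup_in s A) \<Longrightarrow> sup_in p A"
  using gen_least[OF sg_sup_in, of S A] by auto

lemma sup_in_image: "sup_in p A \<Longrightarrow> app p ` A = A"
  by (metis app_minus_app(2) imageI image_subset_iff subsetI subset_antisym sup_in_app sup_in_minus)

lemma sup_in_image_superset: "sup_in p A \<Longrightarrow> A \<subseteq> B \<Longrightarrow> app p ` B = B"
  using sup_in_image sup_in_mono by blast

lemma sup_in_image_disjoint: "sup_in p A \<Longrightarrow> A \<inter> B = {} \<Longrightarrow> app p ` B = B"
  by (force simp: sup_in_def image_iff)

lemma disjoint_sup_commute: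
  assumes "sup_in p A" "sup_in q B" "A \<inter> B = {}"
  shows "p + q = q + p"
proof (rule perm_eqI)
  fix x
  show "app (p + q) x = app (q + p) x"
    using assms sup_in_app[OF assms(1), of x] sup_in_app[OF assms(2), of x]
    unfolding sup_in_def by (cases "x \<in> A"; cases "x \<in> B") auto
qed

section \<open>Wandering sets and wreath products\<close>

text \<open>Equivalently, the translates of \<open>A\<close> under the powers of \<open>t\<close>
  are pairwise disjoint; permutations supported in \<open>A\<close> then generate, together with
  \<open>t\<close>, a restricted wreath product.\<close>

definition wandering :: "'a perm \<Rightarrow> 'a set \<Rightarrow> bool" where
  "wandering t A \<longleftrightarrow> (\<forall>r x. r \<noteq> 0 \<longrightarrow> x \<in> A \<longrightarrow> app (zmul r t) x \<notin> A)"

lemma wandering_eq: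
  assumes "wandering t A" "x \<in> A" "y \<in> A" "app (zmul r t) x = app (zmul s t) y"
  shows "r = s \<and> x = y"
proof -
  have "zmul (- s + r) t = - zmul s t + zmul r t"
    by (simp only: zmul_add zmul_uminus)
  then have *: "app (zmul (- s + r) t) x = y"
    using assms(4) by (simp only: app_add' app_minus_app)
  then have "- s + r = 0"
    using assms(1-3) unfolding wandering_def by metis
  then show ?thesis using * by auto
qed

lemma zmul_conj: "zmul r (c + x - c) = c + zmul r x - c"
proof -
  have "add_hom_on UNIV (\<lambda>x. c + x - c)" unfolding add_hom_on_def by (intro ballI) (simp only: grp)
  then show ?thesis using add_hom_onD(6)[of UNIV "\<lambda>x. c + x - c" x r] by (simp add: sg_def)
qed

lemma wandering_conj: "wandering t A \<Longrightarrow> wandering (c + t - c) (app c ` A)"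
  unfolding wandering_def zmul_conj by (auto simp: mem_app_image)

text \<open>Elements of \<open>\<langle>S\<rangle> \<wr> \<langle>t\<rangle>\<close> as a shift by \<open>e\<close> combined with one element of \<open>\<langle>S\<rangle>\<close> on every
  translate of \<open>A\<close>.\<close>

lemma wreath_form:
  assumes "wandering t A" "\<And>s. s \<in> S \<Longrightarrow> sup_in s A" "y \<in> gen (insert t S)"
  obtains e where
    "\<And>r. \<exists>k\<in>gen S. \<forall>x\<in>A. app y (app (zmul r t) x) = app (zmul (r + e) t) (app k x)"
    "\<And>x. (\<And>r. x \<notin> app (zmul r t) ` A) \<Longrightarrow> app y x = app (zmul e t) x"
proof -
  define P where "P y e \<longleftrightarrow>
    (\<forall>r. \<exists>k\<in>gen S. \<forall>x\<in>A. app y (app (zmul r t) x) = app (zmul (r + e) t) (app k x)) \<and>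
    (\<forall>x. (\<forall>r. x \<notin> app (zmul r t) ` A) \<longrightarrow> app y x = app (zmul e t) x)" for y e
  have shift: "P (zmul d t + y) (d + e)" if "P y e" for d e y
    unfolding P_def
  proof (intro conjI allI impI)
    fix r
    obtain k where k: "k \<in> gen S"
      "\<And>x. x \<in> A \<Longrightarrow> app y (app (zmul r t) x) = app (zmul (r + e) t) (app k x)"
      using \<open>P y e\<close> unfolding P_def by blast
    have "zmul (r + (d + e)) t = zmul d t + zmul (r + e) t"
      by (simp add: zmul_add[symmetric] algebra_simps)
    then show "\<exists>k\<in>gen S. \<forall>x\<in>A. app (zmul d t + y) (app (zmul r t) x) = app (zmul (r + (d + e)) t) (app k x)"
      using k by (intro bexI[of _ k]) auto
  next
    fix x assume "\<forall>r. x \<notin> app (zmul r t) ` A"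
    then show "app (zmul d t + y) x = app (zmul (d + e) t) x"
      using that by (simp add: P_def zmul_add)
  qed
  have base: "P (s + y) e" if "P y e" "s \<in> gen S" for s y e
    unfolding P_def
  proof (intro conjI allI impI)
    fix r
    have sA: "sup_in k A" if "k \<in> gen S" for k using that assms(2) by (rule sup_in_gen)
    obtain k where k: "k \<in> gen S"
      "\<And>x. x \<in> A \<Longrightarrow> app y (app (zmul r t) x) = app (zmul (r + e) t) (app k x)"
      using \<open>P y e\<close> unfolding P_def by blast
    show "\<exists>k\<in>gen S. \<forall>x\<in>A. app (s + y) (app (zmul r t) x) = app (zmul (r + e) t) (app k x)"
    \<comment> \<open>The factor \<open>s\<close> acts only on the translate that \<open>y\<close>
      carries onto \<open>A\<close> itself, where it is absorbed into \<open>k\<close>; all other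
      translates land outside \<open>A\<close>, where \<open>s\<close> is trivial.\<close>
    proof (cases "r + e = 0")
      case True
      then show ?thesis using k that by (intro bexI[of _ "s + k"]) (auto intro: genD)
    next
      case False
      have "app s (app (zmul (r + e) t) (app k x)) = app (zmul (r + e) t) (app k x)" if "x \<in> A" for x
      proof -
        have "app k x \<in> A" using sA[OF k(1)] that by (simp add: sup_in_app)
        then have "app (zmul (r + e) t) (app k x) \<notin> A"
          using assms(1) False unfolding wandering_def by blast
        then show ?thesis using sA[OF \<open>s \<in> gen S\<close>] unfolding sup_in_def by blast
      qed
      then show ?thesis using k by (intro bexI[of _ k]) auto
    qed
  next
    fix x assume x: "\<forall>r. x \<notin> app (zmul r t) ` A"
    then have "app y x = app (zmul e t) x" using that by (simp add: P_def)
    moreover have "app (zmul e t) x \<notin> A"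
      using x[rule_format, of "- e"] by (simp add: mem_app_image zmul_uminus)
    moreover have "sup_in s A" using that(2) assms(2) by (rule sup_in_gen)
    ultimately show "app (s + y) x = app (zmul e t) x" by (simp add: sup_in_def)
  qed
  from assms(3) have "\<exists>e. P y e"
  proof induction
    case gen_zero
    have "P 0 0" unfolding P_def by (auto intro!: bexI[of _ 0] gen.gen_zero)
    then show ?case ..
  next
    case (gen_add s x)
    then show ?case using shift[of x _ 1] base[of x _ s] by (auto intro: gen_base)
  next
    case (gen_minus s x)
    moreover have "- s \<in> gen S" if "s \<in> S" using that by (intro genD gen_base)
    ultimately show ?case using shift[of x _ "- 1"] base[of x _ "- s"] by auto
  qed
  then show thesis using that unfolding P_def by blast
qed

text \<open>The base group of the wreath product satisfies every commutator law of \<open>\<langle>S\<rangle>\<close>, since a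
  law can be checked on each translate separately.\<close>

lemma wreath_law:
  assumes t: "wandering t A" and S: "\<And>s. s \<in> S \<Longrightarrow> sup_in s A"
    and law: "icoms n (gen S) \<subseteq> {0}"
  shows "icoms (Suc n) (gen (insert t S)) \<subseteq> {0}"
proof -
  \<comment> \<open>Membership in the base group with coordinates in \<open>K\<close>: every
    translate is preserved, and the coordinate may vary with \<open>r\<close>.\<close>
  define P where "P K y \<longleftrightarrow>
    (\<forall>r. \<exists>k\<in>K. sup_in k A \<and> (\<forall>x\<in>A. app y (app (zmul r t) x) = app (zmul r t) (app k x))) \<and>
    (\<forall>x. (\<forall>r. x \<notin> app (zmul r t) ` A) \<longrightarrow> app y x = x)" for K y
  have minus: "app (- y) (app (zmul r t) x) = app (zmul r t) (app (- k) x)"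
    if "sup_in k A" "\<forall>x\<in>A. app y (app (zmul r t) x) = app (zmul r t) (app k x)" "x \<in> A"
    for y r k x
    using that sup_in_app[of "- k" A x] by (simp add: app_minus_eq_iff)
  have com: "P (coms K) (com y z)" if "P K y" "P K z" for K y z
    unfolding P_def
  proof (intro conjI allI impI)
    fix r
    obtain k where k: "k \<in> K" "sup_in k A" "\<forall>x\<in>A. app y (app (zmul r t) x) = app (zmul r t) (app k x)"
      using \<open>P K y\<close> unfolding P_def by blast
    obtain l where l: "l \<in> K" "sup_in l A" "\<forall>x\<in>A. app z (app (zmul r t) x) = app (zmul r t) (app l x)"
      using \<open>P K z\<close> unfolding P_def by blast
    note * = sup_in_app[OF k(2)] sup_in_app[OF l(2)] sup_in_app[OF iffD2[OF sup_in_minus k(2)]]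
      sup_in_app[OF iffD2[OF sup_in_minus l(2)]]
    have "app (com y z) (app (zmul r t) x) = app (zmul r t) (app (com k l) x)" if "x \<in> A" for x
      using that k(3) l(3) minus[OF k(2,3)] minus[OF l(2,3)] by (simp add: com_def *)
    moreover have "sup_in (com k l) A"
      using k l unfolding com_def by (intro sup_in_diff sup_in_add)
    ultimately show "\<exists>k\<in>coms K. sup_in k A \<and>
        (\<forall>x\<in>A. app (com y z) (app (zmul r t) x) = app (zmul r t) (app k x))"
      using k l by (intro bexI[of _ "com k l"]) (auto intro: comsI)
  next
    fix x assume "\<forall>r. x \<notin> app (zmul r t) ` A"
    then have "app y x = x" "app z x = x" using that unfolding P_def by auto
    then have "app (- y) x = x" "app (- z) x = x" by (auto simp: app_minus_eq_iff)
    then show "app (com y z) x = x" using \<open>app y x = x\<close> \<open>app z x = x\<close> by (simp add: com_def)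
  qed
  have icom: "P (icoms m K) y" if "y \<in> icoms m M" "\<And>z. z \<in> M \<Longrightarrow> P K z" for m K M y
    using that
  proof (induction m arbitrary: y K M)
    case (Suc m)
    show ?case unfolding icoms.simps
    proof (rule Suc.IH)
      show "y \<in> icoms m (coms M)" using Suc.prems by simp
      show "P (coms K) z" if "z \<in> coms M" for z
        using that Suc.prems(2) com by (auto simp: coms_def)
    qed
  qed simp
  have kernel: "P (gen S) (com y z)" if yz: "y \<in> gen (insert t S)" "z \<in> gen (insert t S)" for y z
  proof -
    have c: "com y z \<in> gen (insert t S)" using yz by (rule genD)
    obtain d where d:
      "\<And>r. \<exists>k\<in>gen S. \<forall>x\<in>A. app y (app (zmul r t) x) = app (zmul (r + d) t) (app k x)"
      "\<And>x. (\<And>r. x \<notin> app (zmul r t) ` A) \<Longrightarrow> app y x = app (zmul d t) x"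
      using wreath_form[OF t S yz(1)] by metis
    obtain e where e:
      "\<And>r. \<exists>k\<in>gen S. \<forall>x\<in>A. app z (app (zmul r t) x) = app (zmul (r + e) t) (app k x)"
      "\<And>x. (\<And>r. x \<notin> app (zmul r t) ` A) \<Longrightarrow> app z x = app (zmul e t) x"
      using wreath_form[OF t S yz(2)] by metis
    obtain c where c:
      "\<And>r. \<exists>k\<in>gen S. \<forall>x\<in>A. app (com y z) (app (zmul r t) x) = app (zmul (r + c) t) (app k x)"
      "\<And>x. (\<And>r. x \<notin> app (zmul r t) ` A) \<Longrightarrow> app (com y z) x = app (zmul c t) x"
      using wreath_form[OF t S c] by metis
    have sA: "sup_in k A" if "k \<in> gen S" for k using that S by (rule sup_in_gen)
    show ?thesis
    \<comment> \<open>An empty \<open>A\<close> leaves no translates to follow, but then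
      \<open>y\<close> and \<open>z\<close> are powers of \<open>t\<close> and commute.\<close>
    proof (cases "A = {}")
      case True
      then have yt: "app y x = app (zmul d t) x" "app z x = app (zmul e t) x" for x
        using d e by auto
      have "y = zmul d t" "z = zmul e t" by (rule perm_eqI, rule yt)+
      then have "y + z = z + y" by (simp add: zmul_add[symmetric] add.commute)
      then have "com y z = 0" by (simp add: com_eq_0)
      then show ?thesis using True unfolding P_def by (auto intro!: bexI[of _ 0] gen_zero)
    next
      case False
      have "c = 0"
      proof -
        obtain a where a: "a \<in> A" using False by auto
        \<comment> \<open>\<open>wreath_form\<close> yields exponents without saying that they add
          up. Their additivity is recovered from the way \<open>y\<close> and \<open>z\<close> shift
          the indices of the translates.\<close>
        define T where "T r = app (zmul r t) ` A" for r
        have img: "app w ` T r = T (r + i)" if ex: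
          "\<exists>k\<in>gen S. \<forall>x\<in>A. app w (app (zmul r t) x) = app (zmul (r + i) t) (app k x)" for w i r
        proof -
          obtain k where k: "k \<in> gen S" "\<And>x. x \<in> A \<Longrightarrow> app w (app (zmul r t) x) = app (zmul (r + i) t) (app k x)"
            using ex by blast
          have "app w ` T r = app (zmul (r + i) t) ` app k ` A"
            unfolding T_def image_image using k(2) by (auto simp: image_iff)
          then show ?thesis using sup_in_image[OF sA[OF k(1)]] by (simp add: T_def)
        qed
        have iy: "app y ` T r = T (r + d)" and iz: "app z ` T r = T (r + e)"
          and ic: "app (com y z) ` T r = T (r + c)" for r
          using d(1) e(1) c(1) by (auto intro!: img)
        have iy': "app (- y) ` T r = T (r - d)" and iz': "app (- z) ` T r = T (r - e)" for r
          using iy[of "r - d"] iz[of "r - e"] by (simp_all add: app_image_minus)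
        have "com y z = y + (z + (- y + - z))" by (simp only: com_def grp)
        then have "app (com y z) ` T 0 = T 0"
          by (simp only: app_image_add iy iz iy' iz') simp
        then have "T c = T 0" using ic[of 0] by simp
        then have "app (zmul c t) a \<in> A" using a by (auto simp: T_def)
        then show ?thesis using t a unfolding wandering_def by blast
      qed
      then show ?thesis using c sA unfolding P_def by simp
    qed
  qed
  have "y = 0" if y: "y \<in> icoms n (coms (gen (insert t S)))" for y
  proof (rule perm_eqI)
    fix x
    have "P (icoms n (gen S)) y"
      using y by (rule icom) (auto simp: coms_def kernel)
    then have P: "P {0} y" using law unfolding P_def by blast
    show "app y x = app 0 x"
    proof (cases "\<exists>r. x \<in> app (zmul r t) ` A")
      case True
      then show ?thesis using P unfolding P_def by auto
    next
      case False
      then show ?thesis using P unfolding P_def by auto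
    qed
  qed
  then show ?thesis by auto
qed

section \<open>Towers of supports\<close>

text \<open>The Brin--Navas group \<open>\<langle>f, g\<rangle>\<close>, optionally with an additional generator \<open>h\<close> that commutes
  with \<open>f\<close> and lives below all the levels \<open>app (zmul i f) ` J\<close>.\<close>

locale tower =
  fixes f g h :: "'a perm" and J V :: "'a set"
  assumes J_nonempty: "J \<noteq> {}" and J_sub: "J \<subseteq> app f ` J"
    and g_sup: "sup_in g (app f ` J)" and g_wandering: "wandering g J"
    and V_sub: "V \<subseteq> J" and h_sup: "sup_in h V" and f_fix: "x \<in> V \<Longrightarrow> app f x = x"
begin

definition level :: "int \<Rightarrow> 'a set" where
  "level i = app (zmul i f) ` J"

definition bump :: "int \<Rightarrow> 'a perm" where
  "bump i = zmul i f + g - zmul i f"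

text \<open>The window is half-open so that its elements are supported in \<open>level b\<close>,
  which \<open>bump b\<close> moves off itself: raising \<open>b\<close> by one forms one wreath
  product.\<close>

definition KK :: "int \<Rightarrow> int \<Rightarrow> 'a perm set" where
  "KK a b = gen (bump ` {a..<b})"

definition NN :: "int \<Rightarrow> int \<Rightarrow> 'a perm set" where
  "NN a b = gen (insert h (bump ` {a..<b}))"

definition NI :: "'a perm set" where
  "NI = gen (insert h (range bump))"

definition GG :: "'a perm set" where
  "GG = gen {f, g, h}"

lemma sgs: "sg (KK a b)" "sg (NN a b)" "sg NI" "sg GG"
  by (simp_all add: KK_def NN_def NI_def GG_def sg_gen)

lemma level_shift: "app (zmul k f) ` level j = level (k + j)"
  by (simp add: level_def zmul_add image_image)

lemma level_step: "level i \<subseteq> level (i + 1)"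
proof -
  have "app (zmul i f) ` J \<subseteq> app (zmul i f) ` app f ` J" using J_sub by auto
  then show ?thesis by (simp add: level_def zmul_add image_image)
qed

lemma level_mono: "i \<le> j \<Longrightarrow> level i \<subseteq> level j"
proof (induction j rule: int_ge_induct)
  case (step j) then show ?case using level_step[of j] by auto
qed simp

lemma level_nonempty: "level i \<noteq> {}"
  using J_nonempty by (simp add: level_def)

lemma bump_sup: "sup_in (bump i) (level (i + 1))"
  using sup_in_conj[OF g_sup, of "zmul i f"] by (simp add: bump_def level_def zmul_add image_image)

lemma bump_wandering: "wandering (bump i) (level i)"
  using wandering_conj[OF g_wandering] by (simp add: bump_def level_def)

lemma bump_moves: "r \<noteq> 0 \<Longrightarrow> app (zmul r (bump i)) ` level i \<inter> level i = {}"
  using bump_wandering unfolding wandering_def by blast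

lemma bump_shift: "zmul k f + bump i - zmul k f = bump (k + i)"
proof -
  have "bump (k + i) = (zmul k f + zmul i f) + g - (zmul k f + zmul i f)"
    by (simp add: bump_def zmul_add)
  then show ?thesis unfolding bump_def by (simp only: grp)
qed

lemma bump_0: "bump 0 = g"
  by (simp add: bump_def)

lemma f_fix_zmul: "x \<in> V \<Longrightarrow> app (zmul k f) x = x"
proof (induction k rule: int_induct[where k = 0])
  case (step1 i) then show ?case using f_fix by (simp add: zmul_succ)
next
  case (step2 i) then show ?case
    using f_fix by (simp add: zmul_pred app_minus_eq_iff del: add_uminus_conv_diff)
qed simp

lemma V_level: "V \<subseteq> level i"
proof
  fix x assume "x \<in> V"
  then have "app (zmul i f) x = x" "x \<in> J" using V_sub f_fix_zmul by auto
  then show "x \<in> level i" unfolding level_def by (metis imageI)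
qed

lemma h_level: "sup_in h (level i)"
  using sup_in_mono[OF h_sup V_level] .

lemma h_conj: "zmul k f + h - zmul k f = h"
proof (rule perm_eqI)
  fix x
  let ?t = "zmul k f"
  have V: "app (- ?t) x = x" if "x \<in> V" for x
    using f_fix_zmul[OF that] by (simp add: app_minus_eq_iff)
  show "app (?t + h - ?t) x = app h x"
  proof (cases "x \<in> V")
    case True
    then have "app h x \<in> V" using sup_in_app[OF h_sup] by simp
    then show ?thesis using V[OF True] f_fix_zmul by simp
  next
    case False
    have "app (- ?t) x \<notin> V"
    proof
      assume *: "app (- ?t) x \<in> V"
      have "x = app (- ?t) x" by (rule trans[OF _ f_fix_zmul[OF *, of k]]) simp
      then show False using * False by metis
    qed
    then show ?thesis using False h_sup by (simp add: sup_in_def)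
  qed
qed

lemma f_h_commute: "f + h = h + f"
  using h_conj[of 1] by (simp add: diff_eq_eq)

lemma KK_NN: "KK a b \<subseteq> NN a b"
  unfolding KK_def NN_def by (rule gen_mono) auto

lemma NN_mono: "a' \<le> a \<Longrightarrow> b \<le> b' \<Longrightarrow> NN a b \<subseteq> NN a' b'"
  unfolding NN_def by (intro gen_mono insert_mono image_mono) auto

lemma KK_mono: "a' \<le> a \<Longrightarrow> b \<le> b' \<Longrightarrow> KK a b \<subseteq> KK a' b'"
  unfolding KK_def by (intro gen_mono image_mono) auto

lemma NN_NI: "NN a b \<subseteq> NI"
  unfolding NN_def NI_def by (rule gen_mono) auto

lemma bump_KK: "a \<le> i \<Longrightarrow> i < b \<Longrightarrow> bump i \<in> KK a b"
  unfolding KK_def by (rule gen_base) auto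

lemma bump_gen_level: "i \<in> {a..<b} \<Longrightarrow> sup_in (bump i) (level b)"
  using sup_in_mono[OF bump_sup level_mono[of "i + 1" b]] by auto

lemma NN_sup: "x \<in> NN a b \<Longrightarrow> sup_in x (level b)"
  unfolding NN_def by (erule sup_in_gen) (auto simp: h_level bump_gen_level)

lemma KK_sup: "x \<in> KK a b \<Longrightarrow> sup_in x (level b)"
  using KK_NN NN_sup by blast

lemma NN_step: "a \<le> b \<Longrightarrow> NN a (b + 1) = gen (insert (bump b) (insert h (bump ` {a..<b})))"
proof -
  assume "a \<le> b"
  then have "{a..<b + 1} = insert b {a..<b}" by auto
  then show ?thesis by (simp add: NN_def insert_commute)
qed

lemma KK_step: "a \<le> b \<Longrightarrow> KK a (b + 1) = gen (insert (bump b) (bump ` {a..<b}))"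
proof -
  assume "a \<le> b"
  then have "{a..<b + 1} = insert b {a..<b}" by auto
  then show ?thesis by (simp add: KK_def)
qed

text \<open>The bounds \<open>c\<close> and \<open>d\<close> force the window to be as wide as a
  later argument requires.\<close>

lemma NN_finite: 
  assumes "finite A" "A \<subseteq> NI"
  shows "\<exists>a b. a \<le> c \<and> d \<le> b \<and> A \<subseteq> NN a b"
  using assms
proof (induction A rule: finite_induct)
  case empty
  then show ?case by auto
next
  case (insert x A)
  then obtain a b where ab: "a \<le> c" "d \<le> b" "A \<subseteq> NN a b" by auto
  obtain B where B: "finite B" "B \<subseteq> insert h (range bump)" "x \<in> gen B"
    using gen_finite_support[of x] insert.prems unfolding NI_def by blast
  then obtain I where I: "finite I" "B - {h} = bump ` I"
    using finite_subset_image[of "B - {h}" bump UNIV] by auto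
  \<comment> \<open>Inserting 0 keeps the maximum defined if no bump occurs; the added 1 accounts
    for the open right end of the window.\<close>
  define m where "m = Max (insert 0 ((\<lambda>i. \<bar>i\<bar> + 1) ` I))"
  have m: "\<bar>i\<bar> + 1 \<le> m" if "i \<in> I" for i
    unfolding m_def using I that by (intro Max_ge) auto
  have "B \<subseteq> insert h (bump ` I)" using I(2) by auto
  also have "\<dots> \<subseteq> insert h (bump ` {min a (- m)..<max b m})"
    by (intro insert_mono image_mono subsetI) (use m in force)
  finally have "gen B \<subseteq> NN (min a (- m)) (max b m)" unfolding NN_def by (rule gen_mono)
  moreover have "NN a b \<subseteq> NN (min a (- m)) (max b m)" by (rule NN_mono) auto
  ultimately show ?case using ab B(3)
    by (intro exI[of _ "min a (- m)"] exI[of _ "max b m"]) auto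
qed

lemma NI_NN: assumes "x \<in> NI" obtains a b where "a \<le> c" "d \<le> b" "x \<in> NN a b"
  using NN_finite[of "{x}" c d] assms by auto

lemma NN_form:
  assumes "a \<le> b" "y \<in> NN a (b + 1)"
  obtains e where
    "\<And>r. \<exists>k\<in>NN a b. \<forall>x\<in>level b.
       app y (app (zmul r (bump b)) x) = app (zmul (r + e) (bump b)) (app k x)"
proof -
  have "sup_in s (level b)" if "s \<in> insert h (bump ` {a..<b})" for s
    using that h_level bump_gen_level by auto
  then show thesis
    using wreath_form[OF bump_wandering, of "insert h (bump ` {a..<b})" b y] assms that
    unfolding NN_step[OF assms(1)] NN_def[symmetric] by metis
qed

text \<open>By induction on the right end of a window containing \<open>y\<close>: on
  \<open>level b\<close>, \<open>y\<close> acts as some \<open>k\<close> from the shorter window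
  followed by a power of \<open>bump b\<close>. A nonzero power moves \<open>level b\<close>, hence
  \<open>level j\<close>, off itself; otherwise \<open>y\<close> acts there as \<open>k\<close>. In
  the base case the support lies inside \<open>level j\<close>.\<close>

lemma laminar:
  assumes "y \<in> NI"
  shows "app y ` level j = level j \<or> app y ` level j \<inter> level j = {}"
proof -
  have "app y ` level j = level j \<or> app y ` level j \<inter> level j = {}"
    if "a \<le> j" "j \<le> b" "y \<in> NN a b" for a b y
    using that(2,3)
  proof (induction b arbitrary: y rule: int_ge_induct)
    case base
    then show ?case using NN_sup sup_in_image by blast
  next
    case (step b)
    have ab: "a \<le> b" using \<open>a \<le> j\<close> \<open>j \<le> b\<close> by simp
    obtain e where e: "\<And>r. \<exists>k\<in>NN a b. \<forall>x\<in>level b.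
       app y (app (zmul r (bump b)) x) = app (zmul (r + e) (bump b)) (app k x)"
      using NN_form[OF ab step.prems] by metis
    obtain k where k: "k \<in> NN a b" "\<And>x. x \<in> level b \<Longrightarrow> app y x = app (zmul e (bump b)) (app k x)"
      using e[of 0] by auto
    have jb: "level j \<subseteq> level b" using level_mono step by simp
    show ?case
    proof (cases "e = 0")
      case True
      then have "app y ` level j = app k ` level j" using k(2) jb by (intro image_cong) auto
      then show ?thesis using step.IH k(1) by auto
    next
      case False
      have "app y x \<notin> level j" if "x \<in> level j" for x
      proof -
        have "app k x \<in> level b" using that jb sup_in_app[OF NN_sup[OF k(1)]] by auto
        then have "app y x \<notin> level b"
          using k(2) that jb bump_moves[OF False, of b] by force
        then show ?thesis using jb by auto
      qed
      then show ?thesis by auto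
    qed
  qed
  moreover obtain a b where "a \<le> j" "j \<le> b" "y \<in> NN a b" using NI_NN[OF assms] by metis
  ultimately show ?thesis by blast
qed

lemma NN_law: "\<exists>n. icoms n (NN a b) \<subseteq> {0}"
proof -
  \<comment> \<open>The cyclic group generated by \<open>h\<close> accounts for one step, so m bumps
    give derived length at most m + 1.\<close>
  have "icoms (Suc m) (NN a (a + int m)) \<subseteq> {0}" for m
  proof (induction m)
    case 0
    have multiples: "\<exists>k. y = zmul k h" if "y \<in> gen {h}" for y
      using that
    proof induction
      case gen_zero show ?case by (rule exI[of _ 0]) simp
    next
      case (gen_add s x)
      then obtain k where "x = zmul k h" by auto
      then have "s + x = zmul (k + 1) h" using gen_add(1) by (simp add: zmul_succ)
      then show ?case ..
    next
      case (gen_minus s x)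
      then obtain k where "x = zmul k h" by auto
      then have "- s + x = zmul (k - 1) h"
        using gen_minus(1) by (simp add: zmul_pred del: add_uminus_conv_diff)
      then show ?case ..
    qed
    have "com x y = 0" if xy: "x \<in> gen {h}" "y \<in> gen {h}" for x y
    proof -
      obtain k l where "x = zmul k h" "y = zmul l h" using multiples xy by blast
      then show ?thesis by (simp add: com_eq_0 zmul_add[symmetric] add.commute)
    qed
    then show ?case by (auto simp: NN_def coms_def)
  next
    case (Suc m)
    have "icoms (Suc (Suc m)) (gen (insert (bump (a + int m)) (insert h (bump ` {a..<a + int m})))) \<subseteq> {0}"
    proof (rule wreath_law[where A = "level (a + int m)"])
      show "sup_in s (level (a + int m))" if "s \<in> insert h (bump ` {a..<a + int m})" for s
        using that h_level bump_gen_level by auto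
    qed (use Suc bump_wandering in \<open>unfold NN_def\<close>)
    then show ?case using NN_step[of a "a + int m"] by (simp add: algebra_simps)
  qed
  \<comment> \<open>For \<open>b \<le> a\<close>, \<open>nat\<close> truncates to 0 and the window
    on the left is empty as well.\<close>
  moreover have "NN a b \<subseteq> NN a (a + int (nat (b - a)))" by (intro NN_mono) auto
  ultimately show ?thesis using icoms_mono by (meson subset_trans)
qed

lemma NI_local_law:
  assumes "finite A" "A \<subseteq> NI"
  shows "\<exists>n. icoms n (gen A) \<subseteq> {0}"
proof -
  obtain a b where "A \<subseteq> NN a b" using NN_finite[OF assms] by blast
  then have "gen A \<subseteq> NN a b" using sgs by (intro gen_least) auto
  then show ?thesis using NN_law[of a b] icoms_mono by (meson subset_trans)
qed

text \<open>Along the wreath structure, either the exponent of \<open>y\<close> is nonzero and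
  \<open>level b\<close> moves off itself, or some coordinate is a nontrivial element of the shorter
  window and the translate found there is carried along. \<open>h\<close> is excluded because it
  maps every level to itself.\<close>

lemma KK_faithful:
  assumes "a \<le> b" "y \<in> KK a b" "y \<noteq> 0"
  shows "\<exists>l\<in>KK a b. app y ` app l ` level a \<inter> app l ` level a = {}"
  using assms
proof (induction b arbitrary: y rule: int_ge_induct)
  case base
  then show ?case by (simp add: KK_def gen_empty)
next
  case (step b)
  let ?t = "bump b" and ?S = "bump ` {a..<b}"
  have S: "\<And>s. s \<in> ?S \<Longrightarrow> sup_in s (level b)" using bump_gen_level by auto
  have y: "y \<in> gen (insert ?t ?S)" using step.prems(1) KK_step[OF step.hyps] by simp
  obtain e where e:
    "\<And>r. \<exists>k\<in>KK a b. \<forall>x\<in>level b. app y (app (zmul r ?t) x) = app (zmul (r + e) ?t) (app k x)"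
    "\<And>x. (\<And>r. x \<notin> app (zmul r ?t) ` level b) \<Longrightarrow> app y x = app (zmul e ?t) x"
    using wreath_form[OF bump_wandering S y] unfolding KK_def by metis
  have ab: "level a \<subseteq> level b" using level_mono step by simp
  show ?case
  proof (cases "e = 0")
    case True
    \<comment> \<open>With exponent zero, \<open>y\<close> fixes every point outside the translates
      of \<open>level b\<close>. A moved point thus lies in a translate, and the coordinate of
      \<open>y\<close> there is nontrivial.\<close>
    obtain x where x: "app y x \<noteq> x" using step.prems(2) perm_eqI[of y 0] by auto
    then obtain r u where u: "u \<in> level b" "x = app (zmul r ?t) u"
      using e(2)[of x] True by auto
    obtain k where k: "k \<in> KK a b"
      "\<And>x. x \<in> level b \<Longrightarrow> app y (app (zmul r ?t) x) = app (zmul r ?t) (app k x)"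
      using e(1)[of r] True by auto
    have "k \<noteq> 0" using x u k(2)[of u] by auto
    then obtain l where l: "l \<in> KK a b" "app k ` app l ` level a \<inter> app l ` level a = {}"
      using step.IH k(1) by blast
    have lb: "app l ` level a \<subseteq> level b"
      using sup_in_app[OF KK_sup[OF l(1)]] ab by auto
    have "zmul r ?t + l \<in> KK a (b + 1)"
      using l(1) KK_mono[of a a b "b + 1"] step.hyps
      by (intro sgD[OF sgs(1)] zmul_in[OF sgs(1)] bump_KK) auto
    moreover have "app y ` app (zmul r ?t + l) ` level a = app (zmul r ?t) ` app k ` app l ` level a"
    proof -
      have "app y (app (zmul r ?t + l) x) = app (zmul r ?t) (app k (app l x))" if "x \<in> level a" for x
        using lb k(2)[of "app l x"] that by auto
      then show ?thesis unfolding image_image by (rule image_cong[OF refl])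
    qed
    then have "app y ` app (zmul r ?t + l) ` level a \<inter> app (zmul r ?t + l) ` level a = {}"
      by (simp only: app_image_add app_image_Int l(2) image_empty)
    ultimately show ?thesis by blast
  next
    case False
    obtain k where k: "k \<in> KK a b" "\<And>x. x \<in> level b \<Longrightarrow> app y x = app (zmul e ?t) (app k x)"
      using e(1)[of 0] by auto
    have "app y x \<notin> level a" if "x \<in> level a" for x
    proof -
      have "app k x \<in> level b" using that ab sup_in_app[OF KK_sup[OF k(1)]] by auto
      then have "app y x \<notin> level b"
        using k(2) that ab bump_moves[OF False, of b] by force
      then show ?thesis using ab by auto
    qed
    then show ?thesis by (intro bexI[of _ 0]) (auto simp: sgD[OF sgs(1)])
  qed
qed

lemma level_strict: "level i \<noteq> level (i + 1)"
proof
  assume "level i = level (i + 1)"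
  then have "app (bump i) ` level i = level i" using sup_in_image[OF bump_sup] by metis
  then show False using bump_moves[of 1 i] level_nonempty[of i] by simp
qed

lemma level_inj: "level i = level j \<longleftrightarrow> i = j"
proof -
  have *: "i = j" if "i \<le> j" "level i = level j" for i j
  proof (rule ccontr)
    assume "i \<noteq> j"
    then have "level (i + 1) \<subseteq> level j" "level i \<subseteq> level (i + 1)"
      using that level_mono[of "i + 1" j] level_mono[of i "i + 1"] by auto
    then show False using that level_strict[of i] by auto
  qed
  show ?thesis using *[of i j] *[of j i] linear[of i j] by auto
qed

section \<open>The degree homomorphism to the integers\<close>

lemma NI_conj: "x \<in> NI \<Longrightarrow> zmul k f + x - zmul k f \<in> NI"
  unfolding NI_def
proof (induction rule: gen.induct)
  case gen_zero then show ?case by (simp add: gen.gen_zero)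
next
  case (gen_add s x)
  have "zmul k f + s - zmul k f \<in> insert h (range bump)"
    using gen_add(1) by (auto simp: h_conj bump_shift)
  moreover have "zmul k f + (s + x) - zmul k f = (zmul k f + s - zmul k f) + (zmul k f + x - zmul k f)"
    by (simp only: grp)
  ultimately show ?case using gen_add by (simp only: gen.gen_add)
next
  case (gen_minus s x)
  have "zmul k f + s - zmul k f \<in> insert h (range bump)"
    using gen_minus(1) by (auto simp: h_conj bump_shift)
  moreover have "zmul k f + (- s + x) - zmul k f = - (zmul k f + s - zmul k f) + (zmul k f + x - zmul k f)"
    by (simp only: grp)
  ultimately show ?case using gen_minus by (simp only: gen.gen_minus)
qed

lemma generators: "f \<in> GG" "g \<in> GG" "h \<in> GG" "bump i \<in> GG" "h \<in> NI" "bump i \<in> NI" "g \<in> NI"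
proof -
  show 1: "f \<in> GG" "g \<in> GG" "h \<in> GG" unfolding GG_def by (auto intro: gen_base)
  show "bump i \<in> GG" unfolding bump_def by (intro sgD[OF sgs(4)] zmul_in[OF sgs(4)] 1)
  show "h \<in> NI" and b: "bump i \<in> NI" for i unfolding NI_def by (auto intro: gen_base)
  show "g \<in> NI" using b[of 0] by (simp add: bump_0)
qed

lemma NI_GG: "NI \<subseteq> GG"
  using generators unfolding NI_def by (intro gen_least sgs) auto

lemma GG_form: "x \<in> GG \<Longrightarrow> \<exists>k. \<exists>n\<in>NI. x = zmul k f + n"
  unfolding GG_def
proof (induction rule: gen.induct)
  case gen_zero
  show ?case by (rule exI[of _ 0], rule bexI[of _ 0]) (auto simp: sgD[OF sgs(3)])
next
  case (gen_add s x)
  then obtain k n where n: "n \<in> NI" "x = zmul k f + n" by auto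
  consider "s = f" | "s \<in> NI" using gen_add generators by auto
  then show ?case
  proof cases
    case 1
    then have "s + x = zmul (k + 1) f + n" using n by (simp add: zmul_succ add.assoc)
    then show ?thesis using n by blast
  next
    case 2
    then have "s + x = zmul k f + ((zmul (- k) f + s - zmul (- k) f) + n)"
      unfolding n zmul_uminus by (simp only: grp)
    then show ?thesis using n NI_conj[OF 2] sgD(2)[OF sgs(3)] by blast
  qed
next
  case (gen_minus s x)
  then obtain k n where n: "n \<in> NI" "x = zmul k f + n" by auto
  consider "s = f" | "- s \<in> NI" using gen_minus generators sgD(3)[OF sgs(3)] by auto
  then show ?case
  proof cases
    case 1
    then have "- s + x = zmul (k - 1) f + n" using n by (simp add: zmul_pred add.assoc del: add_uminus_conv_diff)
    then show ?thesis using n by blast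
  next
    case 2
    then have "- s + x = zmul k f + ((zmul (- k) f + (- s) - zmul (- k) f) + n)"
      unfolding n zmul_uminus by (simp only: grp)
    then show ?thesis using n NI_conj[OF 2] sgD(2)[OF sgs(3)] by blast
  qed
qed

text \<open>An element of \<open>NI\<close> lies in some window and therefore stabilizes a high
  level, whereas \<open>zmul k f\<close> shifts all levels by \<open>k\<close>.\<close>

lemma zmul_f_NI: "zmul k f \<in> NI \<Longrightarrow> k = 0"
proof -
  assume "zmul k f \<in> NI"
  then obtain a b where "zmul k f \<in> NN a b" using NI_NN by metis
  then have "app (zmul k f) ` level b = level b" using NN_sup sup_in_image by blast
  then show "k = 0" by (simp add: level_shift level_inj)
qed

definition deg :: "'a perm \<Rightarrow> int" where
  "deg x = (THE k. \<exists>n\<in>NI. x = zmul k f + n)"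

lemma deg_eq: assumes "n \<in> NI" shows "deg (zmul k f + n) = k"
  unfolding deg_def
proof (rule the_equality)
  show "\<exists>n'\<in>NI. zmul k f + n = zmul k f + n'" using assms by auto
  fix l assume "\<exists>n'\<in>NI. zmul k f + n = zmul l f + n'"
  then obtain n' where n': "n' \<in> NI" "zmul k f + n = zmul l f + n'" by auto
  have "zmul (- l + k) f = - zmul l f + (zmul k f + n) - n"
    by (simp only: zmul_add zmul_uminus grp)
  also have "\<dots> = n' - n" unfolding n' by (simp only: grp)
  finally have "zmul (- l + k) f \<in> NI" using n' assms sgD(4)[OF sgs(3)] by simp
  then show "l = k" using zmul_f_NI by fastforce
qed

lemma deg_add: assumes "x \<in> GG" "y \<in> GG" shows "deg (x + y) = deg x + deg y"
proof -
  obtain k n l m where *: "n \<in> NI" "x = zmul k f + n" "m \<in> NI" "y = zmul l f + m"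
    using GG_form assms by metis
  have "x + y = zmul (k + l) f + ((zmul (- l) f + n - zmul (- l) f) + m)"
    unfolding * zmul_add zmul_uminus by (simp only: grp)
  then have "deg (x + y) = k + l"
    using * NI_conj sgD(2)[OF sgs(3)] by (simp add: deg_eq)
  then show ?thesis using * by (simp add: deg_eq)
qed

lemma deg_hom: "add_hom_on GG deg"
  by (simp add: add_hom_on_def deg_add)

lemmas degD = add_hom_onD[OF deg_hom sgs(4)]

lemma deg_com [simp]: "x \<in> GG \<Longrightarrow> y \<in> GG \<Longrightarrow> deg (com x y) = 0"
  by (simp add: degD com_def sgD[OF sgs(4)])

lemma deg_0_iff: "x \<in> GG \<Longrightarrow> deg x = 0 \<longleftrightarrow> x \<in> NI"
  using deg_eq[of x 0] GG_form[of x] by (auto simp: deg_eq)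

text \<open>The levels of the translates that \<open>q\<close> displaces form a nonempty set of integers which is
  bounded above; conjugation by an element of degree \<open>k\<close> shifts it by \<open>k\<close>.\<close>

lemma centralizer_trivial:
  assumes h: "h = 0" and p: "p \<in> GG" "deg p \<noteq> 0" and q: "q \<in> NI" and pq: "p + q = q + p"
  shows "q = 0"
proof (rule ccontr)
  assume "q \<noteq> 0"
  define D where "D = {j. \<exists>y\<in>NI. app q ` app y ` level j \<inter> app y ` level j = {}}"
  obtain a b where ab: "a \<le> 0" "0 \<le> b" "q \<in> NN a b" using NI_NN[OF q] by metis
  \<comment> \<open>Since \<open>h = 0\<close>, the two kinds of window agree and
    \<open>KK_faithful\<close> puts \<open>a\<close> into \<open>D\<close>.\<close>
  have "NN a b = KK a b" unfolding NN_def KK_def by (subst h) (rule gen_insert_zero)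
  then obtain l where l: "l \<in> NN a b" "app q ` app l ` level a \<inter> app l ` level a = {}"
    using KK_faithful[of a b q] ab \<open>q \<noteq> 0\<close> by auto
  have "a \<in> D"
    unfolding D_def mem_Collect_eq using l(2) subsetD[OF NN_NI l(1)] by (rule bexI)
  \<comment> \<open>Once \<open>level j\<close> contains the support of \<open>q\<close>, laminarity
    leaves two cases: the translate is \<open>level j\<close> itself, which \<open>q\<close>
    preserves, or it is disjoint from it, and \<open>q\<close> fixes it pointwise.\<close>
  have bounded: "j < b" if "j \<in> D" for j
  proof (rule ccontr)
    assume "\<not> j < b"
    then have bj: "level b \<subseteq> level j" by (intro level_mono) auto
    from that obtain y where y: "y \<in> NI" "app q ` app y ` level j \<inter> app y ` level j = {}"
      unfolding D_def by auto
    have "app q ` app y ` level j = app y ` level j"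
      using laminar[OF y(1), of j]
    proof
      assume "app y ` level j = level j"
      then show ?thesis using sup_in_image_superset[OF NN_sup[OF ab(3)] bj] by simp
    next
      assume "app y ` level j \<inter> level j = {}"
      then show ?thesis using bj by (intro sup_in_image_disjoint[OF NN_sup[OF ab(3)]]) auto
    qed
    then show False using y(2) level_nonempty[of j] by simp
  qed
  have shift: "j + deg p \<in> D" if "p \<in> GG" "p + q = q + p" "j \<in> D" for p j
  proof -
    obtain k n where n: "n \<in> NI" "p = zmul k f + n" using GG_form \<open>p \<in> GG\<close> by metis
    obtain y where y: "y \<in> NI" "app q ` app y ` level j \<inter> app y ` level j = {}"
      using \<open>j \<in> D\<close> unfolding D_def by auto
    define z where "z = zmul k f + (n + y) - zmul k f"
    have z: "z \<in> NI" unfolding z_def using n y by (intro NI_conj sgD(2)[OF sgs(3)])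
    have "p + y = z + zmul k f" unfolding z_def n by (simp only: grp)
    then have py: "app p ` app y ` level j = app z ` level (k + j)"
      by (metis app_image_add level_shift)
    have "app q ` app p ` app y ` level j = app p ` app q ` app y ` level j"
      by (metis app_image_add \<open>p + q = q + p\<close>)
    then have "app q ` app z ` level (k + j) \<inter> app z ` level (k + j) = {}"
      using y(2) app_image_Int[of p] unfolding py[symmetric] by simp
    moreover have "deg p = k" using n deg_eq by simp
    ultimately show ?thesis using z unfolding D_def by (auto simp: add.commute)
  qed
  \<comment> \<open>\<open>D\<close> is bounded above but may extend downwards without bound, so the
    maximum is taken over its finite part from \<open>a\<close> on.\<close>
  define M where "M = Max (D \<inter> {a..b})"
  have fin: "finite (D \<inter> {a..b})" by simp
  have aD: "a \<in> D \<inter> {a..b}" using \<open>a \<in> D\<close> ab by auto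
  then have "M \<in> D \<inter> {a..b}" unfolding M_def using fin by (intro Max_in) auto
  then have M: "M \<in> D" "a \<le> M" by auto
  have Mmax: "j \<le> M" if "j \<in> D" for j
  proof (cases "a \<le> j")
    case True
    then show ?thesis using that bounded[OF that] fin unfolding M_def by (intro Max_ge) auto
  qed (use M in auto)
  \<comment> \<open>\<open>D\<close> is invariant under shifts by the degrees of both
    \<open>p\<close> and \<open>- p\<close>; one of them is positive and leads beyond the
    maximum.\<close>
  have "- p + q = q + (- p)"
  proof -
    have "- p + q = - p + (q + p) - p" by (simp only: grp)
    also have "\<dots> = q + (- p)" unfolding pq[symmetric] by (simp only: grp)
    finally show ?thesis .
  qed
  moreover have "- p \<in> GG" using p sgD(3)[OF sgs(4)] by simp
  ultimately have "M + deg p \<in> D" "M - deg p \<in> D"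
    using shift[OF p(1) pq M(1)] shift[of "- p" M] M(1) p degD(3)[OF p(1)] by auto
  then show False using Mmax p(2) by force
qed

end

section \<open>Lower bounds for the elementary amenable hierarchy\<close>

text \<open>\<open>K\<close> is a quotient of a subgroup of \<open>G\<close>. Embeddings would not
  survive the induction: in the normal subgroup case one only obtains a group whose restriction to a
  level is the smaller wreath product.\<close>

definition covers :: "('m, 'c) monoid_scheme \<Rightarrow> 'p::group_add set \<Rightarrow> bool" where
  "covers G K \<longleftrightarrow> (\<exists>S \<phi>. subgroup S G \<and>
     (\<forall>x\<in>S. \<forall>y\<in>S. \<phi> (x \<otimes>\<^bsub>G\<^esub> y) = \<phi> x + \<phi> y) \<and> \<phi> ` S = K)"

lemma additive_props:
  assumes "group G" "subgroup S G" "\<And>x y. x \<in> S \<Longrightarrow> y \<in> S \<Longrightarrow> \<phi> (x \<otimes>\<^bsub>G\<^esub> y) = \<phi> x + (\<phi> y :: 'p::group_add)"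
  shows "\<phi> \<one>\<^bsub>G\<^esub> = 0" "x \<in> S \<Longrightarrow> \<phi> (inv\<^bsub>G\<^esub> x) = - \<phi> x"
proof -
  interpret G: group G by fact
  have one: "\<one>\<^bsub>G\<^esub> \<in> S" using assms(2) by (rule subgroup.one_closed)
  have "\<phi> \<one>\<^bsub>G\<^esub> + 0 = \<phi> \<one>\<^bsub>G\<^esub> + \<phi> \<one>\<^bsub>G\<^esub>"
    using assms(3)[OF one one] by simp
  then show z: "\<phi> \<one>\<^bsub>G\<^esub> = 0" unfolding add_left_cancel by simp
  assume x: "x \<in> S"
  then have "\<phi> (inv\<^bsub>G\<^esub> x) + \<phi> x = 0"
    using assms(3)[of "inv\<^bsub>G\<^esub> x" x] subgroup.m_inv_closed[OF assms(2)] subgroup.mem_carrier[OF assms(2)] z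
    by simp
  then show "\<phi> (inv\<^bsub>G\<^esub> x) = - \<phi> x" by (simp add: eq_neg_iff_add_eq_0)
qed

lemma additive_image_sg:
  assumes "group G" "subgroup S G" "\<And>x y. x \<in> S \<Longrightarrow> y \<in> S \<Longrightarrow> \<phi> (x \<otimes>\<^bsub>G\<^esub> y) = \<phi> x + (\<phi> y :: 'p::group_add)"
  shows "sg (\<phi> ` S)"
proof -
  have "\<exists>z\<in>S. 0 = \<phi> z"
    using additive_props(1)[OF assms] subgroup.one_closed[OF assms(2)] by metis
  moreover have "\<exists>z\<in>S. \<phi> x + \<phi> y = \<phi> z" if "x \<in> S" "y \<in> S" for x y
    using assms(3)[OF that] subgroup.m_closed[OF assms(2) that] by metis
  moreover have "\<exists>z\<in>S. - \<phi> x = \<phi> z" if "x \<in> S" for x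
    using additive_props(2)[OF assms that] subgroup.m_inv_closed[OF assms(2) that] by metis
  ultimately show ?thesis unfolding sg_def by (auto simp: image_iff)
qed

text \<open>\<open>\<Gamma>\<close> is the graph of the homomorphism. Closure under the group
  operations reduces single-valuedness to the fibre over the identity, so representatives and
  restrictions can be handled as relations.\<close>

lemma coversI:
  assumes "group G" "\<And>x a. \<Gamma> x a \<Longrightarrow> x \<in> carrier G"
    and mult: "\<And>x y a b. \<Gamma> x a \<Longrightarrow> \<Gamma> y b \<Longrightarrow> \<Gamma> (x \<otimes>\<^bsub>G\<^esub> y) (a + b)"
    and minv: "\<And>x a. \<Gamma> x a \<Longrightarrow> \<Gamma> (inv\<^bsub>G\<^esub> x) (- a)"
    and single: "\<And>a. \<Gamma> \<one>\<^bsub>G\<^esub> a \<Longrightarrow> a = 0"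
    and range: "\<And>a. a \<in> K \<longleftrightarrow> (\<exists>x. \<Gamma> x a)" and "K \<noteq> {}"
  shows "covers G K"
proof -
  interpret G: group G by fact
  define S where "S = {x. \<exists>a. \<Gamma> x a}"
  define \<phi> where "\<phi> x = (THE a. \<Gamma> x a)" for x
  have phi: "\<phi> x = a" if a: "\<Gamma> x a" for x a
    unfolding \<phi>_def
  proof (rule the_equality[where P = "\<Gamma> x", OF a])
    fix b assume "\<Gamma> x b"
    then have "\<Gamma> (x \<otimes>\<^bsub>G\<^esub> inv\<^bsub>G\<^esub> x) (b + - a)" using a by (intro mult minv)
    then have "\<Gamma> \<one>\<^bsub>G\<^esub> (b - a)" using assms(2)[OF a] by simp
    then have "b - a = 0" by (rule single)
    then show "b = a" by simp
  qed
  have SD: "\<Gamma> x (\<phi> x)" if "x \<in> S" for x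
    using that phi unfolding S_def by auto
  have SI: "x \<in> S" if "\<Gamma> x a" for x a
    using that unfolding S_def by auto
  have "subgroup S G"
  proof (rule G.subgroupI)
    show "S \<subseteq> carrier G" using SD assms(2) by blast
    show "S \<noteq> {}" using range \<open>K \<noteq> {}\<close> SI by blast
  qed (rule SI, erule minv[OF SD] mult[OF SD SD], assumption?)+
  moreover have "\<phi> (x \<otimes>\<^bsub>G\<^esub> y) = \<phi> x + \<phi> y" if "x \<in> S" "y \<in> S" for x y
    using mult[OF SD[OF that(1)] SD[OF that(2)]] by (rule phi)
  moreover have "\<phi> ` S = K" 
  proof (intro equalityI subsetI)
    fix a assume "a \<in> \<phi> ` S"
    then show "a \<in> K" using SD range by auto
  next
    fix a assume "a \<in> K"
    then obtain x where x: "\<Gamma> x a" using range by auto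
    then show "a \<in> \<phi> ` S" using phi[OF x] SI[OF x] by auto
  qed
  ultimately show ?thesis unfolding covers_def by blast
qed

lemma covers_mono:
  assumes "covers G K" "group G" "sg K'" "K' \<subseteq> K"
  shows "covers G K'"
proof -
  obtain S \<phi> where S: "subgroup S G" "\<And>x y. x \<in> S \<Longrightarrow> y \<in> S \<Longrightarrow> \<phi> (x \<otimes>\<^bsub>G\<^esub> y) = \<phi> x + \<phi> y" "\<phi> ` S = K"
    using assms(1) unfolding covers_def by blast
  show ?thesis
  proof (rule coversI[where \<Gamma> = "\<lambda>x a. x \<in> S \<and> \<phi> x = a \<and> a \<in> K'"])
    show "a \<in> K' \<longleftrightarrow> (\<exists>x. x \<in> S \<and> \<phi> x = a \<and> a \<in> K')" for a
      using S(3) assms(4) by auto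
  qed (use assms S sgD[OF assms(3)] additive_props[OF assms(2) S(1,2)] in
      \<open>auto simp: subgroup.m_closed subgroup.m_inv_closed subgroup.mem_carrier\<close>)
qed

lemma directed_finite:
  assumes "finite A" "A \<subseteq> \<Union>\<S>" "\<S> \<noteq> {}" "\<forall>A\<in>\<S>. \<forall>B\<in>\<S>. \<exists>D\<in>\<S>. A \<union> B \<subseteq> D"
  shows "\<exists>D\<in>\<S>. A \<subseteq> D"
  using assms(1,2)
proof (induction A rule: finite_induct)
  case empty
  then show ?case using assms(3) by auto
next
  case (insert x A)
  then obtain D E where "D \<in> \<S>" "A \<subseteq> D" "E \<in> \<S>" "x \<in> E" by auto
  moreover from this obtain F where "F \<in> \<S>" "D \<union> E \<subseteq> F" using assms(4) by blast
  ultimately show ?case by (intro bexI[of _ F]) auto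
qed

lemma EG_stepE [consumes 1, case_names extension union]:
  assumes "EG_step C G"
  obtains N Q where "N \<lhd> G" "C (G\<lparr>carrier := N\<rparr>)" "C Q" "Q \<cong> G Mod N"
  | \<S> where "\<S> \<noteq> {}" "\<forall>H\<in>\<S>. subgroup H G \<and> C (G\<lparr>carrier := H\<rparr>)"
      "\<forall>A\<in>\<S>. \<forall>B\<in>\<S>. \<exists>D\<in>\<S>. A \<union> B \<subseteq> D" "\<Union>\<S> = carrier G"
  using assms unfolding EG_step_def by (elim conjE disjE exE) metis+

lemma EG_fin_group: "EG_fin n G \<Longrightarrow> group G"
  by (cases n) (auto simp: EG_base_def EG_step_def)

context tower
begin

lemma KK_shift:
  "y \<in> KK (i + a) (i + b) \<longleftrightarrow> (\<exists>x\<in>KK a b. y = zmul i f + x - zmul i f)"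
proof -
  define c where "c x = zmul i f + x - zmul i f" for x
  have hom: "add_hom_on UNIV c"
    unfolding add_hom_on_def c_def by (intro ballI) (simp only: grp)
  have "{i + a..<i + b} = (+) i ` {a..<b}"
    by (simp add: add.commute)
  moreover have "c ` bump ` A = bump ` (+) i ` A" for A
    unfolding image_image c_def bump_shift ..
  ultimately have "KK (i + a) (i + b) = gen (c ` bump ` {a..<b})"
    unfolding KK_def by metis
  also have "\<dots> = c ` KK a b"
    unfolding KK_def by (rule hom_gen[symmetric, OF hom]) (auto simp: sg_def)
  finally show ?thesis unfolding c_def by auto
qed

text \<open>If the image of \<open>N\<close> contains an element that moves \<open>level m\<close> off itself, commutators with this
  element restrict to all of \<open>KK 0 m\<close> on \<open>level m\<close>. Otherwise \<open>KK m (2 * m)\<close>, a conjugate of \<open>KK 0 m\<close>,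
  meets the image of \<open>N\<close> trivially by \<open>KK_faithful\<close>.\<close>

lemma covers_normal_or_quotient:
  assumes G: "group G" and S: "subgroup S G"
    and add: "\<And>x y. x \<in> S \<Longrightarrow> y \<in> S \<Longrightarrow> \<phi> (x \<otimes>\<^bsub>G\<^esub> y) = \<phi> x + \<phi> y"
    and onto: "\<phi> ` S = KK 0 (2 * m)" and m: "0 \<le> m"
    and N: "N \<lhd> G" and Q: "group Q" "Q \<cong> G Mod N"
  shows "covers (G\<lparr>carrier := N\<rparr>) (KK 0 m) \<or> covers Q (KK 0 m)"
proof (cases "\<exists>s\<in>S \<inter> N. app (\<phi> s) ` level m \<inter> level m = {}")
  case True
  interpret G: group G by fact
  interpret S: subgroup S G by fact
  interpret N: normal N G by fact
  from True obtain s0 where s0: "s0 \<in> S" "s0 \<in> N" "app (\<phi> s0) ` level m \<inter> level m = {}" by auto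
  \<comment> \<open>Only the action of \<open>\<phi> s\<close> on \<open>level m\<close> is
    recorded; it may be nontrivial elsewhere.\<close>
  define \<Gamma> where "\<Gamma> s k \<longleftrightarrow> s \<in> S \<and> s \<in> N \<and> k \<in> KK 0 m \<and> (\<forall>x\<in>level m. app (\<phi> s) x = app k x)" for s k
  have pos: "app k x \<in> level m \<longleftrightarrow> x \<in> level m" if "k \<in> KK 0 m" for k x
    using KK_sup[OF that] by (rule sup_in_app)
  have minv: "inv\<^bsub>G\<lparr>carrier := N\<rparr>\<^esub> x = inv\<^bsub>G\<^esub> x" if "x \<in> N" for x
    using G.m_inv_consistent[OF N.subgroup_axioms that] by simp
  have "covers (G\<lparr>carrier := N\<rparr>) (KK 0 m)"
  proof (rule coversI[where \<Gamma> = \<Gamma>])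
    show "group (G\<lparr>carrier := N\<rparr>)" by (rule G.subgroup_imp_group) (rule N.subgroup_axioms)
    show "\<Gamma> (x \<otimes>\<^bsub>G\<lparr>carrier := N\<rparr>\<^esub> y) (a + b)" if "\<Gamma> x a" "\<Gamma> y b" for x y a b
      using that sgD(2)[OF sgs(1)] by (simp add: \<Gamma>_def add pos)
    show "\<Gamma> (inv\<^bsub>G\<lparr>carrier := N\<rparr>\<^esub> x) (- a)" if xa: "\<Gamma> x a" for x a
    proof -
      have "app (- \<phi> x) y = app (- a) y" if y: "y \<in> level m" for y
      proof -
        have *: "app (- a) y \<in> level m"
          using pos[of "- a" y] sgD(3)[OF sgs(1)] xa y unfolding \<Gamma>_def by blast
        show ?thesis using xa * unfolding app_minus_eq_iff \<Gamma>_def by auto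
      qed
      then show ?thesis using xa sgD(3)[OF sgs(1)] additive_props(2)[OF G S add]
        by (simp add: \<Gamma>_def minv)
    qed
    show "a = 0" if a: "\<Gamma> \<one>\<^bsub>G\<lparr>carrier := N\<rparr>\<^esub> a" for a
    proof (rule perm_eqI)
      fix x
      show "app a x = app 0 x"
        using a KK_sup[of a 0 m] additive_props(1)[OF G S add] unfolding \<Gamma>_def sup_in_def
        by (cases "x \<in> level m") force+
    qed
    show "a \<in> KK 0 m \<longleftrightarrow> (\<exists>x. \<Gamma> x a)" for a
    proof
      assume a: "a \<in> KK 0 m"
      then have "a \<in> \<phi> ` S" using onto KK_mono[of 0 0 m "2 * m"] m by auto
      then obtain s where s: "s \<in> S" "\<phi> s = a" by auto
      have sN: "s \<otimes>\<^bsub>G\<^esub> s0 \<otimes>\<^bsub>G\<^esub> inv\<^bsub>G\<^esub> s \<in> N"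
        using N.inv_op_closed2 s0 s by auto
      \<comment> \<open>This commutator lies in \<open>N\<close>. On \<open>level m\<close> it acts
        as \<open>a\<close>: the inverse of \<open>\<phi> s0\<close> takes a point out of
        \<open>level m\<close>, where \<open>- a\<close> is trivial, \<open>\<phi> s0\<close> brings
        it back, and only the outer \<open>a\<close> remains.\<close>
      define w where "w = s \<otimes>\<^bsub>G\<^esub> s0 \<otimes>\<^bsub>G\<^esub> inv\<^bsub>G\<^esub> s \<otimes>\<^bsub>G\<^esub> inv\<^bsub>G\<^esub> s0"
      have w: "w \<in> S" "w \<in> N" unfolding w_def using sN s0 s by auto
      have phi: "\<phi> w = a + \<phi> s0 + - a + - \<phi> s0"
        unfolding w_def using s s0 by (simp add: add additive_props(2)[OF G S add])
      have "app (\<phi> w) x = app a x" if x: "x \<in> level m" for x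
      proof -
        have "app (- \<phi> s0) x \<notin> level m"
        proof
          assume *: "app (- \<phi> s0) x \<in> level m"
          then have "x \<in> app (\<phi> s0) ` level m" by (simp add: mem_app_image)
          then show False using s0(3) x by auto
        qed
        then have "app (- a) (app (- \<phi> s0) x) = app (- \<phi> s0) x"
          using KK_sup[OF a] iffD2[OF sup_in_minus] unfolding sup_in_def by blast
        then show ?thesis unfolding phi by simp
      qed
      then show "\<exists>x. \<Gamma> x a" using a w unfolding \<Gamma>_def by blast
    qed (auto simp: \<Gamma>_def)
    show "KK 0 m \<noteq> {}" using sgD(1)[OF sgs(1)] by auto
  qed (auto simp: \<Gamma>_def)
  then show ?thesis ..
next
  case False
  interpret G: group G by fact
  interpret S: subgroup S G by fact
  interpret N: normal N G by fact
  interpret Q: group Q by fact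
  \<comment> \<open>If \<open>r\<close> displaced a translate of \<open>level m\<close> by
    \<open>l\<close>, conjugating with a preimage of \<open>l\<close> would give an element of
    \<open>S \<inter> N\<close> displacing \<open>level m\<close> itself, against the case
    assumption.\<close>
  have disj: "r = 0" if s: "s \<in> S" "s \<in> N" "\<phi> s = r" and r: "r \<in> KK m (2 * m)" for s r
  proof (rule ccontr)
    assume "r \<noteq> 0"
    then obtain l where l: "l \<in> KK m (2 * m)" "app r ` app l ` level m \<inter> app l ` level m = {}"
      using KK_faithful[OF _ r] m by auto
    then have "l \<in> \<phi> ` S" using onto KK_mono[of 0 m "2 * m" "2 * m"] m by auto
    then obtain t where t: "t \<in> S" "\<phi> t = l" by auto
    define w where "w = inv\<^bsub>G\<^esub> t \<otimes>\<^bsub>G\<^esub> s \<otimes>\<^bsub>G\<^esub> t"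
    have w: "w \<in> S \<inter> N" unfolding w_def using N.inv_op_closed1 s t by auto
    have phi: "\<phi> w = - l + r + l"
      unfolding w_def using s t by (simp add: add additive_props(2)[OF G S add] del: add_uminus_conv_diff)
    have "app l ` (app (\<phi> w) ` level m \<inter> level m) = app r ` app l ` level m \<inter> app l ` level m"
      unfolding app_image_Int[symmetric] phi by (simp add: image_image)
    then have "app (\<phi> w) ` level m \<inter> level m = {}" unfolding l(2) by simp
    then show False using False w by blast
  qed
  obtain \<psi> where psi: "\<psi> \<in> iso Q (G Mod N)" using Q(2) unfolding is_iso_def by auto
  then have hom: "\<psi> \<in> hom Q (G Mod N)" and bij: "bij_betw \<psi> (carrier Q) (carrier (G Mod N))"
    unfolding iso_def by auto
  have grpM: "group (G Mod N)" by (rule N.factorgroup_is_group)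
  interpret psi: group_hom Q "G Mod N" \<psi>
    unfolding group_hom_def group_hom_axioms_def using hom grpM Q(1) by (intro conjI)
  \<comment> \<open>A coset is matched with \<open>k\<close> through a representative that maps to
    the conjugate of \<open>k\<close> in the upper window; \<open>disj\<close> makes this
    single-valued.\<close>
  define \<Gamma> where "\<Gamma> q k \<longleftrightarrow> q \<in> carrier Q \<and>
    (\<exists>s\<in>S. \<psi> q = N #>\<^bsub>G\<^esub> s \<and> \<phi> s = zmul m f + k - zmul m f) \<and> k \<in> KK 0 m" for q k
  have "covers Q (KK 0 m)"
  proof (rule coversI[where \<Gamma> = \<Gamma>])
    show "\<Gamma> (x \<otimes>\<^bsub>Q\<^esub> y) (a + b)" if xy: "\<Gamma> x a" "\<Gamma> y b" for x y a b
    proof -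
      obtain s t where st: "s \<in> S" "\<psi> x = N #>\<^bsub>G\<^esub> s" "\<phi> s = zmul m f + a - zmul m f"
        "t \<in> S" "\<psi> y = N #>\<^bsub>G\<^esub> t" "\<phi> t = zmul m f + b - zmul m f"
        using xy unfolding \<Gamma>_def by auto
      have "\<psi> (x \<otimes>\<^bsub>Q\<^esub> y) = N #>\<^bsub>G\<^esub> (s \<otimes>\<^bsub>G\<^esub> t)"
        using xy st N.rcos_sum[of s t] unfolding \<Gamma>_def by simp
      moreover have "\<phi> (s \<otimes>\<^bsub>G\<^esub> t) = zmul m f + (a + b) - zmul m f"
        unfolding add[OF st(1,4)] st by (simp only: grp)
      ultimately show ?thesis using xy st sgD(2)[OF sgs(1)] unfolding \<Gamma>_def by blast
    qed
    show "\<Gamma> (inv\<^bsub>Q\<^esub> x) (- a)" if xa: "\<Gamma> x a" for x a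
    proof -
      obtain s where st: "s \<in> S" "\<psi> x = N #>\<^bsub>G\<^esub> s" "\<phi> s = zmul m f + a - zmul m f"
        using xa unfolding \<Gamma>_def by auto
      have "\<psi> (inv\<^bsub>Q\<^esub> x) = inv\<^bsub>G Mod N\<^esub> (N #>\<^bsub>G\<^esub> s)"
        using xa st unfolding \<Gamma>_def by (simp add: psi.hom_inv)
      also have "\<dots> = N #>\<^bsub>G\<^esub> (inv\<^bsub>G\<^esub> s)"
      proof -
        have "N #>\<^bsub>G\<^esub> s \<in> carrier (G Mod N)"
          unfolding FactGroup_def RCOSETS_def using S.mem_carrier[OF st(1)] by auto
        then show ?thesis using N.inv_FactGroup N.rcos_inv[OF S.mem_carrier[OF st(1)]] by simp
      qed
      finally have "\<psi> (inv\<^bsub>Q\<^esub> x) = N #>\<^bsub>G\<^esub> (inv\<^bsub>G\<^esub> s)" .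
      moreover have "\<phi> (inv\<^bsub>G\<^esub> s) = zmul m f + (- a) - zmul m f"
      proof -
        have "\<phi> (inv\<^bsub>G\<^esub> s) = - \<phi> s" using additive_props(2)[OF G S add] st(1) by blast
        then show ?thesis unfolding st by (simp only: grp)
      qed
      ultimately show ?thesis
        using xa st sgD(3)[OF sgs(1)] unfolding \<Gamma>_def by blast
    qed
    show "a = 0" if a: "\<Gamma> \<one>\<^bsub>Q\<^esub> a" for a
    proof -
      obtain s where s: "s \<in> S" "N = N #>\<^bsub>G\<^esub> s" "\<phi> s = zmul m f + a - zmul m f" "a \<in> KK 0 m"
        using a psi.hom_one unfolding \<Gamma>_def by auto
      have "s \<in> N" using G.coset_join1[OF s(2)[symmetric] _ N.subgroup_axioms] s(1) by simp
      moreover have "\<phi> s \<in> KK m (2 * m)" unfolding s using KK_shift[of "\<phi> s" m 0 m] s by auto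
      ultimately have "\<phi> s = 0" using disj s(1) by blast
      then have "zmul m f + a = zmul m f + 0" unfolding s(3) by (simp add: diff_eq_eq)
      then have "a = 0" by (simp only: add_left_cancel)
      then show ?thesis by simp
    qed
    show "a \<in> KK 0 m \<longleftrightarrow> (\<exists>x. \<Gamma> x a)" for a
    proof
      assume a: "a \<in> KK 0 m"
      have "zmul m f + a - zmul m f \<in> KK m (2 * m)"
        using KK_shift[of "zmul m f + a - zmul m f" m 0 m] a by auto
      then have "zmul m f + a - zmul m f \<in> \<phi> ` S" using onto KK_mono[of 0 m "2 * m" "2 * m"] m by auto
      then obtain s where s: "s \<in> S" "\<phi> s = zmul m f + a - zmul m f" by auto
      then have "N #>\<^bsub>G\<^esub> s \<in> carrier (G Mod N)" by (auto simp: FactGroup_def RCOSETS_def)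
      then obtain q where "q \<in> carrier Q" "\<psi> q = N #>\<^bsub>G\<^esub> s"
        using bij unfolding bij_betw_def by (metis imageE)
      then show "\<exists>x. \<Gamma> x a" using s a unfolding \<Gamma>_def by blast
    qed (auto simp: \<Gamma>_def)
    show "KK 0 m \<noteq> {}" using sgD(1)[OF sgs(1)] by auto
  qed (auto simp: \<Gamma>_def Q)
  then show ?thesis ..
qed

text \<open>\<open>KK a b\<close> is finitely generated, so preimages of its generators already lie
  in one member of the family.\<close>

lemma covers_directed:
  assumes G: "group G" and cov: "covers G (KK a b)"
    and ne: "\<S> \<noteq> {}" and sub: "\<forall>H\<in>\<S>. subgroup H G"
    and dir: "\<forall>A\<in>\<S>. \<forall>B\<in>\<S>. \<exists>D\<in>\<S>. A \<union> B \<subseteq> D" and un: "\<Union>\<S> = carrier G"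
  shows "\<exists>D\<in>\<S>. covers (G\<lparr>carrier := D\<rparr>) (KK a b)"
proof -
  interpret G: group G by fact
  obtain S \<phi> where S: "subgroup S G"
    and add: "\<And>x y. x \<in> S \<Longrightarrow> y \<in> S \<Longrightarrow> \<phi> (x \<otimes>\<^bsub>G\<^esub> y) = \<phi> x + \<phi> y" and onto: "\<phi> ` S = KK a b"
    using cov unfolding covers_def by blast
  have "\<forall>i\<in>{a..<b}. \<exists>s\<in>S. \<phi> s = bump i"
    using onto bump_KK by (force simp: image_iff)
  then obtain s where s: "\<And>i. i \<in> {a..<b} \<Longrightarrow> s i \<in> S \<and> \<phi> (s i) = bump i" by metis
  have "s ` {a..<b} \<subseteq> \<Union>\<S>" unfolding un using s subgroup.mem_carrier[OF S] by auto
  then obtain D where D: "D \<in> \<S>" "s ` {a..<b} \<subseteq> D"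
    using directed_finite[OF _ _ ne dir] by (metis finite_atLeastLessThan_int finite_imageI)
  have subD: "subgroup D G" using D sub by auto
  have SD: "subgroup (S \<inter> D) G" using S subD by (rule G.subgroups_Inter_pair)
  have "sg (\<phi> ` (S \<inter> D))" using additive_image_sg[OF G SD] add by auto
  moreover have "bump ` {a..<b} \<subseteq> \<phi> ` (S \<inter> D)"
  proof (rule image_subsetI)
    fix i assume i: "i \<in> {a..<b}"
    then have "s i \<in> S \<inter> D" "bump i = \<phi> (s i)" using s[OF i] D(2) by auto
    then show "bump i \<in> \<phi> ` (S \<inter> D)" by (rule image_eqI[rotated])
  qed
  ultimately have "KK a b \<subseteq> \<phi> ` (S \<inter> D)" unfolding KK_def by (rule gen_least)
  then have "\<phi> ` (S \<inter> D) = KK a b" using onto by auto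
  moreover have "subgroup (S \<inter> D) (G\<lparr>carrier := D\<rparr>)"
    using G.subgroup_incl[OF SD subD] by auto
  ultimately have "covers (G\<lparr>carrier := D\<rparr>) (KK a b)"
    unfolding covers_def using add by (intro exI[of _ "S \<inter> D"] exI[of _ \<phi>]) auto
  then show ?thesis using D(1) by blast
qed

lemma bump_noncommute: "bump 0 + bump 1 \<noteq> bump 1 + bump 0"
proof
  assume eq: "bump 0 + bump 1 = bump 1 + bump 0"
  obtain x where x: "x \<in> level 0" using level_nonempty[of 0] by auto
  have x1: "x \<in> level 1" using x level_mono[of 0 1] by auto
  have "app (bump 1) x \<notin> level 1" using bump_moves[of 1 1] x1 by auto
  then have "app (bump 0) (app (bump 1) x) = app (bump 1) x"
    using bump_sup[of 0] by (simp add: sup_in_def)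
  then have "app (bump 1 + bump 0) x = app (bump 1) x" unfolding eq[symmetric] by simp
  then have "app (bump 0) x = x" by simp
  then show False using bump_moves[of 1 0] x by force
qed

text \<open>Two bumps suffice: the powers of one are pairwise distinct, and \<open>bump 0\<close>
  and \<open>bump 1\<close> do not commute.\<close>

lemma EG_base_not_covers: "EG_base G \<Longrightarrow> \<not> covers G (KK 0 2)"
proof
  assume EG: "EG_base G" and "covers G (KK 0 2)"
  then obtain S \<phi> where S: "subgroup S G"
    and add: "\<And>x y. x \<in> S \<Longrightarrow> y \<in> S \<Longrightarrow> \<phi> (x \<otimes>\<^bsub>G\<^esub> y) = \<phi> x + \<phi> y" and onto: "\<phi> ` S = KK 0 2"
    unfolding covers_def by blast
  have b: "bump 0 \<in> KK 0 2" "bump 1 \<in> KK 0 2" by (auto intro: bump_KK)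
  have SG: "S \<subseteq> carrier G" using S by (rule subgroup.subset)
  consider "finite (carrier G)" | "comm_group G" using EG unfolding EG_base_def by auto
  then show False
  proof cases
    case 1
    then have fin: "finite (KK 0 2)" using onto SG finite_subset by (metis finite_imageI)
    have "inj (\<lambda>r. zmul r (bump 0))"
    proof (rule injI)
      fix r s assume "zmul r (bump 0) = zmul s (bump 0)"
      moreover obtain x where "x \<in> level 0" using level_nonempty[of 0] by auto
      ultimately show "r = s" using wandering_eq[OF bump_wandering] by metis
    qed
    moreover have "range (\<lambda>r. zmul r (bump 0)) \<subseteq> KK 0 2" using zmul_in[OF sgs(1) b(1)] by auto
    ultimately have "finite (UNIV :: int set)" using fin finite_subset finite_imageD by blast
    then show False by (simp add: infinite_UNIV_int)
  next
    case 2
    then interpret comm_group G .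
    obtain s t where st: "s \<in> S" "\<phi> s = bump 0" "t \<in> S" "\<phi> t = bump 1"
      using b onto by (metis imageE)
    then have "s \<otimes>\<^bsub>G\<^esub> t = t \<otimes>\<^bsub>G\<^esub> s" using SG by (auto intro: m_comm)
    then show False using add[of s t] add[of t s] st bump_noncommute by simp
  qed
qed

text \<open>The length starts at the 2 of the base case and doubles with each class, because the
  extension case halves the window. In the union case the window is merely shrunk to fit the
  induction hypothesis.\<close>

lemma EG_fin_not_covers: "EG_fin n G \<Longrightarrow> \<not> covers G (KK 0 (2 ^ Suc n))"
proof (induction n arbitrary: G)
  case 0
  then show ?case using EG_base_not_covers by simp
next
  case (Suc n)
  let ?m = "2 ^ Suc n :: int"
  have step: "EG_step (EG_fin n) G" and G: "group G"
    using Suc.prems EG_fin_group[OF Suc.prems] by auto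
  show ?case
  proof
    assume cov: "covers G (KK 0 (2 ^ Suc (Suc n)))"
    from step show False
    proof (cases rule: EG_stepE)
      case 1: (extension N Q)
      obtain S \<phi> where S: "subgroup S G" "\<And>x y. x \<in> S \<Longrightarrow> y \<in> S \<Longrightarrow> \<phi> (x \<otimes>\<^bsub>G\<^esub> y) = \<phi> x + \<phi> y"
        "\<phi> ` S = KK 0 (2 * ?m)"
        using cov unfolding covers_def power_Suc[of 2 "Suc n"] by metis
      show False
        using covers_normal_or_quotient[OF G S _ 1(1) EG_fin_group[OF 1(3)] 1(4)]
          Suc.IH[OF 1(2)] Suc.IH[OF 1(3)] by auto
    next
      case 2: (union \<S>)
      have "KK 0 ?m \<subseteq> KK 0 (2 ^ Suc (Suc n))" by (rule KK_mono) auto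
      then have "covers G (KK 0 ?m)" by (rule covers_mono[OF cov G sgs(1)])
      moreover have "\<forall>H\<in>\<S>. subgroup H G" using 2(2) by auto
      ultimately obtain D where "D \<in> \<S>" "covers (G\<lparr>carrier := D\<rparr>) (KK 0 ?m)"
        using covers_directed[OF G _ 2(1) _ 2(3,4)] by metis
      then show False using 2(2) Suc.IH by metis
    qed
  qed
qed

end

section \<open>Upper bounds for the elementary amenable hierarchy\<close>

text \<open>A group is the directed union of the family whose only member is itself; this makes the
  hierarchy cumulative.\<close>

lemma EG_step_refl:
  assumes "group G" "C G"
  shows "EG_step C (G :: 'a monoid)"
proof -
  have "subgroup (carrier G) G" using assms(1) by (rule group.subgroup_self)
  then show ?thesis using assms unfolding EG_step_def
    by (intro conjI disjI2 exI[of _ "{carrier G}"]) auto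
qed

lemma EG_fin_Suc: "EG_fin n G \<Longrightarrow> EG_fin (Suc n) G"
  using EG_step_refl[OF EG_fin_group] by simp

lemma EG_fin_le: "m \<le> n \<Longrightarrow> EG_fin m G \<Longrightarrow> EG_fin n G"
  by (induction n rule: dec_induct) (auto intro: EG_fin_Suc simp del: EG_fin.simps)

lemma EG_omega_plus_1_eq: "EG_omega_plus 1 = EG_step (\<lambda>G. \<exists>n. EG_fin n G)"
  and EG_omega_plus_2_eq: "EG_omega_plus 2 = EG_step (EG_omega_plus 1)"
  by (simp_all add: numeral_2_eq_2)

text \<open>Kernel and quotient of one extension lie in a common finite class. In a directed union,
  a finite generating set lies in one member, which is then the whole group.\<close>

lemma EG_omega_plus_1_finitely_generated:
  assumes EG: "EG_omega_plus 1 G" and A: "finite A" "A \<subseteq> carrier G" "generate G A = carrier G"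
  shows "\<exists>n. EG_fin n G"
proof -
  from EG have step: "EG_step (\<lambda>G. \<exists>n. EG_fin n G) G" and G: "group G"
    by (simp_all add: EG_omega_plus_1_eq EG_step_def)
  interpret group G by fact
  from step show ?thesis
  proof (cases rule: EG_stepE)
    case (extension N Q)
    then obtain m n where "EG_fin m (G\<lparr>carrier := N\<rparr>)" "EG_fin n Q" by auto
    then have "EG_fin (max m n) (G\<lparr>carrier := N\<rparr>)" "EG_fin (max m n) Q"
      by (auto intro: EG_fin_le[rotated])
    then have "EG_step (EG_fin (max m n)) G" using extension G unfolding EG_step_def by metis
    then have "EG_fin (Suc (max m n)) G" by simp
    then show ?thesis ..
  next
    case (union \<S>)
    then obtain D where D: "D \<in> \<S>" "A \<subseteq> D" using directed_finite[of A \<S>] A by auto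
    then have "subgroup D G" using union by auto
    then have "D = carrier G"
      using generate_subgroup_incl[OF D(2)] A(3) subgroup.subset[of D G] by auto
    moreover have "G\<lparr>carrier := carrier G\<rparr> = G" by simp
    ultimately show ?thesis using union(2) D(1) by metis
  qed
qed

text \<open>\<open>EG_step\<close> wants the quotient on the element type of the group, while the
  elements of a factor group are cosets.\<close>

lemma comm_group_transport:
  fixes G :: "('b, 'c) monoid_scheme" and j :: "'b \<Rightarrow> 'a"
  assumes "comm_group G" "inj_on j (carrier G)"
  shows "\<exists>Q::'a monoid. comm_group Q \<and> Q \<cong> G"
proof -
  interpret comm_group G by fact
  define k where "k = inv_into (carrier G) j"
  have kj: "k (j x) = x" if "x \<in> carrier G" for x
    unfolding k_def using assms(2) that by (rule inv_into_f_f)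
  define Q :: "'a monoid" where
    "Q = \<lparr>carrier = j ` carrier G, mult = (\<lambda>x y. j (k x \<otimes>\<^bsub>G\<^esub> k y)), one = j \<one>\<^bsub>G\<^esub>\<rparr>"
  have Q: "comm_group Q"
  proof (rule comm_groupI)
    show "\<exists>y\<in>carrier Q. y \<otimes>\<^bsub>Q\<^esub> x = \<one>\<^bsub>Q\<^esub>" if "x \<in> carrier Q" for x
      using that unfolding Q_def by (auto simp: kj intro!: bexI[of _ "inv\<^bsub>G\<^esub> _"])
  qed (auto simp: Q_def kj m_ac)
  have "j \<in> iso G Q"
    using assms(2) unfolding iso_def hom_def Q_def bij_betw_def by (auto simp: kj)
  then have "G \<cong> Q" by (rule is_isoI)
  then have "Q \<cong> G" by (rule iso_sym)
  then show ?thesis using Q by blast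
qed

section \<open>Permutation groups as group records of functions\<close>

text \<open>The carrier consists of functions, not of elements of \<open>perm\<close>, so that
  restrictions of \<open>thompsonF\<close> are literally of this form.\<close>

definition fgrp :: "'x perm set \<Rightarrow> ('x \<Rightarrow> 'x) monoid" where
  "fgrp H = \<lparr>carrier = app ` H, mult = (\<circ>), one = id\<rparr>"

lemma fgrp_simps [simp]:
  "carrier (fgrp H) = app ` H" "x \<otimes>\<^bsub>fgrp H\<^esub> y = x \<circ> y" "\<one>\<^bsub>fgrp H\<^esub> = id"
  "fgrp H\<lparr>carrier := app ` N\<rparr> = fgrp N"
  by (simp_all add: fgrp_def)

lemma group_fgrp:
  assumes "sg H"
  shows "group (fgrp H)"
proof (rule groupI)
  show "\<exists>y\<in>carrier (fgrp H). y \<otimes>\<^bsub>fgrp H\<^esub> x = \<one>\<^bsub>fgrp H\<^esub>" if x: "x \<in> carrier (fgrp H)" for x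
  proof -
    obtain p where p: "p \<in> H" "x = app p" using x by auto
    have "app (- p) \<circ> app p = id" by (auto simp: fun_eq_iff)
    then show ?thesis using p sgD(3)[OF assms] by (intro bexI[of _ "app (- p)"]) auto
  qed
  show "x \<otimes>\<^bsub>fgrp H\<^esub> y \<in> carrier (fgrp H)" if "x \<in> carrier (fgrp H)" "y \<in> carrier (fgrp H)" for x y
    using that sgD(2)[OF assms] by (auto simp: app_add[symmetric])
  show "\<one>\<^bsub>fgrp H\<^esub> \<in> carrier (fgrp H)"
    using sgD(1)[OF assms] by (auto simp: app_0[symmetric])
qed (auto simp: comp_assoc)

lemma inv_fgrp:
  assumes "sg H" "p \<in> H"
  shows "inv\<^bsub>fgrp H\<^esub> (app p) = app (- p)"
proof (rule group.inv_equality[OF group_fgrp[OF assms(1)]])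
  show "app (- p) \<otimes>\<^bsub>fgrp H\<^esub> app p = \<one>\<^bsub>fgrp H\<^esub>" by (auto simp: fun_eq_iff)
qed (use assms sgD(3) in auto)

lemma subgroup_fgrp:
  assumes "sg H" "sg N" "N \<subseteq> H"
  shows "subgroup (app ` N) (fgrp H)"
proof (rule group.subgroupI[OF group_fgrp[OF assms(1)]])
  show "app ` N \<noteq> {}" using sgD(1)[OF assms(2)] by auto
  show "inv\<^bsub>fgrp H\<^esub> a \<in> app ` N" if "a \<in> app ` N" for a
    using that assms sgD(3)[OF assms(2)] by (auto simp: inv_fgrp subset_iff)
  show "a \<otimes>\<^bsub>fgrp H\<^esub> b \<in> app ` N" if "a \<in> app ` N" "b \<in> app ` N" for a b
    using that sgD(2)[OF assms(2)] by (auto simp: app_add[symmetric])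
qed (use assms in auto)

text \<open>The hypotheses concern only product, unit and the inverses of generators, so that
  \<open>fgrp\<close> and \<open>thompsonF\<close> are both instances.\<close>

lemma generate_app:
  assumes "mult M = (\<circ>)" "one M = id" "\<And>s. s \<in> S \<Longrightarrow> inv\<^bsub>M\<^esub> (app s) = app (- s)"
  shows "generate M (app ` S) = app ` gen S"
proof (intro equalityI subsetI)
  fix x assume "x \<in> generate M (app ` S)"
  then show "x \<in> app ` gen S"
  proof induction
    case one
    show ?case unfolding assms(2) app_0[symmetric] by (rule imageI[OF gen_zero])
  next
    case (incl h)
    then show ?case by (auto intro: gen_base)
  next
    case (inv h)
    then obtain q where q: "q \<in> S" "h = app q" by auto
    show ?case unfolding q(2) assms(3)[OF q(1)] by (intro imageI genD(3) gen_base q(1))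
  next
    case (eng h1 h2)
    then obtain p q where pq: "p \<in> gen S" "q \<in> gen S" "h1 = app p" "h2 = app q" by auto
    show ?case unfolding pq(3,4) assms(1) app_add[symmetric] by (intro imageI genD(2) pq(1,2))
  qed
next
  fix x assume "x \<in> app ` gen S"
  then obtain p where p: "p \<in> gen S" "x = app p" by auto
  from p(1) have "app p \<in> generate M (app ` S)"
  proof induction
    case gen_zero
    show ?case using generate.one[of M "app ` S"] unfolding assms(2) app_0 .
  next
    case (gen_add s x)
    have "app s \<otimes>\<^bsub>M\<^esub> app x \<in> generate M (app ` S)"
      by (rule generate.eng[OF generate.incl[OF imageI[OF gen_add(1)]] gen_add(3)])
    then show ?case unfolding assms(1) app_add .
  next
    case (gen_minus s x)
    have "inv\<^bsub>M\<^esub> (app s) \<otimes>\<^bsub>M\<^esub> app x \<in> generate M (app ` S)"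
      by (rule generate.eng[OF generate.inv[OF imageI[OF gen_minus(1)]] gen_minus(3)])
    then show ?case unfolding assms(1) assms(3)[OF gen_minus(1)] app_add .
  qed
  then show "x \<in> generate M (app ` S)" using p(2) by simp
qed

text \<open>A subgroup containing all commutators is normal with abelian quotient. With
  \<open>C\<close> left open, this serves both the derived series of a solvable group and the final
  step to \<open>\<omega> + 2\<close>.\<close>

lemma EG_step_abelian_extension:
  fixes H N :: "'x perm set"
  assumes H: "sg H" and N: "sg N" "N \<subseteq> H" "coms H \<subseteq> N"
    and C: "C (fgrp N)" "\<And>Q. EG_base Q \<Longrightarrow> C Q"
  shows "EG_step C (fgrp H)"
proof -
  interpret G: group "fgrp H" using H by (rule group_fgrp)
  have sub: "subgroup (app ` N) (fgrp H)" using H N by (intro subgroup_fgrp)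
  have conj: "g + n - g \<in> N" if "g \<in> H" "n \<in> N" for g n
  proof -
    have "com g n \<in> N" using N that comsI[of g H n] by auto
    then have "com g n + n \<in> N" using that sgD(2)[OF N(1)] by blast
    moreover have "com g n + n = g + n - g" by (simp only: com_def grp)
    ultimately show ?thesis by simp
  qed
  have normal: "app ` N \<lhd> fgrp H"
    unfolding G.normal_inv_iff using sub conj
    by (auto simp: inv_fgrp[OF H] app_add[symmetric] app_eq_iff)
  interpret N: normal "app ` N" "fgrp H" by (rule normal)
  have comm: "a \<otimes>\<^bsub>fgrp H Mod app ` N\<^esub> b = b \<otimes>\<^bsub>fgrp H Mod app ` N\<^esub> a"
    if ab: "a \<in> carrier (fgrp H Mod app ` N)" "b \<in> carrier (fgrp H Mod app ` N)" for a b
  proof -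
    obtain p q where pq: "p \<in> H" "q \<in> H" "a = app ` N #>\<^bsub>fgrp H\<^esub> app p" "b = app ` N #>\<^bsub>fgrp H\<^esub> app q"
      using ab unfolding FactGroup_def RCOSETS_def by auto
    have car: "app p \<in> carrier (fgrp H)" "app q \<in> carrier (fgrp H)" using pq by auto
    have "com p q \<in> N" using pq N comsI[of p H q] by auto
    have "app ` N #>\<^bsub>fgrp H\<^esub> app (p + q) = app ` N #>\<^bsub>fgrp H\<^esub> app (q + p)"
    proof (rule G.coset_mult_inv1)
      have "inv\<^bsub>fgrp H\<^esub> (app (q + p)) = app (- (q + p))"
        using pq sgD(2)[OF H] by (intro inv_fgrp H) auto
      moreover have "p + q + - (q + p) = com p q" by (simp only: com_def grp)
      ultimately have "app (p + q) \<otimes>\<^bsub>fgrp H\<^esub> inv\<^bsub>fgrp H\<^esub> (app (q + p)) = app (com p q)"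
        by (simp only: fgrp_simps app_add[symmetric])
      then show "app ` N #>\<^bsub>fgrp H\<^esub> (app (p + q) \<otimes>\<^bsub>fgrp H\<^esub> inv\<^bsub>fgrp H\<^esub> (app (q + p))) = app ` N"
        using \<open>com p q \<in> N\<close> N(2) by (simp del: fgrp_simps(2)) (intro G.coset_join2 sub; auto)
    qed (use pq N sgD(2)[OF H] in auto)
    then show ?thesis
      using N.rcos_sum[OF car] N.rcos_sum[OF car(2,1)] unfolding pq by (simp add: app_add)
  qed
  have "comm_group (fgrp H Mod app ` N)"
    using N.factorgroup_is_group comm by (intro group.group_comm_groupI)
  \<comment> \<open>A coset is determined by any of its elements, so choosing representatives embeds
    the quotient into the function type.\<close>
  moreover have "inj_on (\<lambda>a. SOME x. x \<in> a) (carrier (fgrp H Mod app ` N))"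
  proof (rule inj_onI)
    fix a b assume ab: "a \<in> carrier (fgrp H Mod app ` N)" "b \<in> carrier (fgrp H Mod app ` N)"
      and eq: "(SOME x. x \<in> a) = (SOME x. x \<in> b)"
    have "(SOME x. x \<in> a) \<in> a \<and> (SOME x. x \<in> a) \<in> carrier (fgrp H) \<and>
        a = app ` N #>\<^bsub>fgrp H\<^esub> (SOME x. x \<in> a)" if a: "a \<in> carrier (fgrp H Mod app ` N)" for a
    proof -
      obtain u where u: "u \<in> carrier (fgrp H)" "a = app ` N #>\<^bsub>fgrp H\<^esub> u"
        using a unfolding FactGroup_def RCOSETS_def by auto
      then have "u \<in> a" using G.rcos_self sub by auto
      then have "(SOME x. x \<in> a) \<in> a" by (rule someI[of "\<lambda>x. x \<in> a"])
      then show ?thesis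
        using u G.repr_independence[OF _ u(1) sub] G.r_coset_subset_G[OF subgroup.subset[OF sub] u(1)]
        by auto
    qed
    then show "a = b" using ab eq by metis
  qed
  ultimately obtain Q :: "('x \<Rightarrow> 'x) monoid" where Q: "comm_group Q" "Q \<cong> fgrp H Mod app ` N"
    using comm_group_transport by blast
  have "EG_base Q" using Q(1) by (simp add: EG_base_def comm_group.axioms(2))
  then show ?thesis
    unfolding EG_step_def using G.is_group normal Q(2) C by (auto intro!: exI[of _ "app ` N"])
qed

lemma EG_base_EG_fin: "EG_base G \<Longrightarrow> EG_fin n G"
  by (rule EG_fin_le[of 0]) auto

text \<open>By \<open>icoms_gen\<close>, the derived subgroup satisfies the law of depth one less,
  and \<open>H\<close> is an abelian extension of it. Depth 0 means the trivial group.\<close>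

lemma EG_fin_law:
  assumes "sg H" "icoms n H \<subseteq> {0}"
  shows "EG_fin n (fgrp H)"
  using assms
proof (induction n arbitrary: H)
  case 0
  then have "carrier (fgrp H) = {id}" using sgD(1) by (force simp: app_0)
  then show ?case using group_fgrp[OF 0(1)] by (simp add: EG_base_def)
next
  case (Suc n)
  have c: "coms H \<subseteq> H" using Suc.prems(1) by (rule coms_sg) simp
  have "icoms n (gen (coms H)) \<subseteq> gen (icoms n (coms H))"
  proof (rule icoms_gen[OF Suc.prems(1) c])
    show "g + x - g \<in> coms H" if "g \<in> H" "x \<in> coms H" for g x
    proof -
      obtain a b where ab: "a \<in> H" "b \<in> H" "x = com a b" using \<open>x \<in> coms H\<close> by (auto simp: coms_def)
      then show ?thesis unfolding ab com_conj
        using \<open>g \<in> H\<close> sgD(2,4)[OF Suc.prems(1)] by (intro comsI) auto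
    qed
  qed
  also have "\<dots> \<subseteq> gen {0}" using Suc.prems(2) by (intro gen_mono) simp
  also have "\<dots> = {0}" using gen_insert_zero[of "{}"] by (simp add: gen_empty)
  finally have "EG_fin n (fgrp (gen (coms H)))" by (intro Suc.IH sg_gen)
  then have "EG_step (EG_fin n) (fgrp H)"
    using gen_least[OF Suc.prems(1) c]
    by (intro EG_step_abelian_extension[OF Suc.prems(1) sg_gen[of "coms H"]])
      (auto intro: gen_base EG_base_EG_fin)
  then show ?case by simp
qed

lemma EG_omega_plus_2_local_law:
  assumes H: "sg H" and N: "sg N" "N \<subseteq> H" "coms H \<subseteq> N"
    and law: "\<And>A. finite A \<Longrightarrow> A \<subseteq> N \<Longrightarrow> \<exists>n. icoms n (gen A) \<subseteq> {0}"
  shows "EG_omega_plus 2 (fgrp H)"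
  unfolding EG_omega_plus_2_eq
proof (rule EG_step_abelian_extension[OF H N])
  \<comment> \<open>The subgroups generated by finite subsets are directed, since two of them lie in
    the one generated by the union of the subsets.\<close>
  let ?S = "(\<lambda>A. app ` gen A) ` {A. finite A \<and> A \<subseteq> N}"
  show "EG_omega_plus 1 (fgrp N)"
    unfolding EG_omega_plus_1_eq EG_step_def
  proof (intro conjI disjI2 exI[of _ ?S] ballI)
    show "group (fgrp N)" using N(1) by (rule group_fgrp)
    show "?S \<noteq> {}" by auto
    fix D assume "D \<in> ?S"
    then obtain A where A: "finite A" "A \<subseteq> N" "D = app ` gen A" by auto
    have AN: "gen A \<subseteq> N" using A N by (intro gen_least)
    then show "subgroup D (fgrp N)" unfolding A using N by (intro subgroup_fgrp sg_gen)
    show "\<exists>n. EG_fin n (fgrp N\<lparr>carrier := D\<rparr>)"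
      unfolding A fgrp_simps using law[OF A(1,2)] EG_fin_law[OF sg_gen] by blast
    fix E assume "E \<in> ?S"
    then obtain B where B: "finite B" "B \<subseteq> N" "E = app ` gen B" by auto
    have "D \<union> E \<subseteq> app ` gen (A \<union> B)"
      unfolding A B using gen_mono[of A "A \<union> B"] gen_mono[of B "A \<union> B"] by auto
    moreover have "app ` gen (A \<union> B) \<in> ?S" using A B by auto
    ultimately show "\<exists>F\<in>?S. D \<union> E \<subseteq> F" by blast
  next
    have "app p \<in> \<Union> ?S" if "p \<in> N" for p
      using that by (auto intro!: exI[of _ "{p}"] gen_base)
    moreover have "app ` gen A \<subseteq> app ` N" if "A \<subseteq> N" for A
      using that N by (intro image_mono gen_least)
    ultimately show "\<Union> ?S = carrier (fgrp N)" by auto blast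
  qed
  fix Q :: "('a \<Rightarrow> 'a) monoid" assume "EG_base Q"
  then have "EG_fin 0 Q" "group Q" by (simp_all add: EG_base_def)
  then show "EG_omega_plus 1 Q"
    unfolding EG_omega_plus_1_eq by (intro EG_step_refl) (auto simp del: EG_fin.simps)
qed

lemma EA_class_omega_plus_2I:
  assumes "finite A" and H: "H = gen A" and "\<And>n. \<not> EG_fin n (fgrp H)" and "EG_omega_plus 2 (fgrp H)"
  shows "EA_class_omega_plus_2 (fgrp H)"
proof -
  have sg: "sg H" unfolding H by (rule sg_gen)
  have AH: "A \<subseteq> H" unfolding H by (auto intro: gen_base)
  have "generate (fgrp H) (app ` A) = carrier (fgrp H)"
    unfolding fgrp_simps(1) H using AH inv_fgrp[OF sg] unfolding H
    by (intro generate_app) (auto simp: fgrp_def)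
  then have "\<not> EG_omega_plus 1 (fgrp H)"
    using EG_omega_plus_1_finitely_generated[of "fgrp H" "app ` A"] assms(1,3) image_mono[OF AH, of app] by auto
  then show ?thesis using assms unfolding EA_class_omega_plus_2_def by simp
qed

lemma (in tower) not_EG_fin:
  assumes "sg H" "range bump \<subseteq> H"
  shows "\<not> EG_fin n (fgrp H)"
proof -
  have sub: "KK a b \<subseteq> H" for a b unfolding KK_def using assms by (intro gen_least) auto
  have inv: "Perm (app p) = p" for p :: "'a perm" by (rule app_inverse)
  have "covers (fgrp H) (KK a b)" for a b
    unfolding covers_def
  proof (intro exI[of _ "app ` KK a b"] exI[of _ Perm] conjI ballI)
    show "subgroup (app ` KK a b) (fgrp H)" using assms sub sgs by (intro subgroup_fgrp)
    show "Perm (x \<otimes>\<^bsub>fgrp H\<^esub> y) = Perm x + Perm y" if "x \<in> app ` KK a b" "y \<in> app ` KK a b" for x y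
      using that by (auto simp: inv app_add[symmetric])
    show "Perm ` app ` KK a b = KK a b" by (simp add: image_image inv)
  qed
  then show ?thesis using EG_fin_not_covers by blast
qed

lemma embeds_fgrp:
  assumes "embeds (fgrp H) (fgrp H')"
  obtains \<theta> where "add_hom_on H \<theta>" "inj_on \<theta> H" "\<theta> ` H \<subseteq> H'"
proof -
  obtain u where u: "u \<in> hom (fgrp H) (fgrp H')" "inj_on u (carrier (fgrp H))"
    using assms unfolding embeds_def by auto
  have inv: "Perm (app p) = p" for p :: "'x perm" by (rule app_inverse)
  have uH: "\<exists>q\<in>H'. u (app p) = app q" if "p \<in> H" for p
    using u(1) that unfolding hom_def by auto
  define \<theta> where "\<theta> p = Perm (u (app p))" for p
  have \<theta>: "app (\<theta> p) = u (app p)" "\<theta> p \<in> H'" if "p \<in> H" for p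
    using uH[OF that] by (auto simp: \<theta>_def app_inverse)
  have "\<theta> (p + q) = \<theta> p + \<theta> q" if "p \<in> H" "q \<in> H" for p q
  proof -
    have "u (app p \<circ> app q) = u (app p) \<circ> u (app q)" using u(1) that unfolding hom_def by auto
    also have "\<dots> = app (\<theta> p + \<theta> q)" using \<theta> that by (simp add: app_add)
    finally have "\<theta> (p + q) = Perm (app (\<theta> p + \<theta> q))" by (simp add: \<theta>_def app_add)
    then show ?thesis by (simp add: app_inverse)
  qed
  moreover have "inj_on \<theta> H"
  proof (rule inj_onI)
    fix p q assume pq: "p \<in> H" "q \<in> H" "\<theta> p = \<theta> q"
    then have "u (app p) = u (app q)" using \<theta> by metis
    then have "app p = app q" using u(2) pq by (auto dest: inj_onD)
    then show "p = q" by (simp add: app_inject)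
  qed
  ultimately show thesis using that \<theta>(2) unfolding add_hom_on_def by blast
qed

section \<open>Obstructions to embeddings\<close>

text \<open>Restricted to the support of \<open>x\<close>, iterated commutators realise \<open>x\<close>, since \<open>y (Suc m)\<close>
  moves that support off itself.\<close>

lemma icoms_realize:
  fixes A :: "nat \<Rightarrow> 'a set"
  assumes y: "\<And>i. y i \<in> S" "\<And>i. sup_in (y i) (A i)" "\<And>i. A i \<subseteq> A (Suc i)"
    "\<And>i. app (y (Suc i)) ` A i \<inter> A i = {}"
    and x: "x \<in> S" "sup_in x (A m)"
  shows "\<exists>w\<in>icoms n S. \<forall>p\<in>A m. app w p = app x p"
  using x
proof (induction n arbitrary: x m)
  case 0
  then show ?case by auto
next
  case (Suc n)
  define z where "z = y (Suc m)"
  have z: "sup_in z (A (Suc m))" unfolding z_def by (rule y)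
  obtain v where v: "v \<in> icoms n S" "\<And>p. p \<in> A (Suc m) \<Longrightarrow> app v p = app z p"
    using Suc.IH[OF y(1) y(2), of "Suc m"] unfolding z_def by auto
  obtain u where u: "u \<in> icoms n S" "\<And>p. p \<in> A (Suc m) \<Longrightarrow> app u p = app x p"
    using Suc.IH[OF Suc.prems(1) sup_in_mono[OF Suc.prems(2) y(3)]] by auto
  \<comment> \<open>The inverse of \<open>v\<close> takes \<open>p\<close> to a point outside
    \<open>A m\<close> but still inside \<open>A (Suc m)\<close>, where \<open>u\<close> is known to
    act as \<open>x\<close>, that is, trivially. Then \<open>v\<close> returns to \<open>p\<close>
    and \<open>u\<close> applies \<open>x\<close>.\<close>
  have "app (com u v) p = app x p" if p: "p \<in> A m" for p
  proof -
    define q where "q = app (- z) p"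
    have "p \<in> A (Suc m)" using p y(3) by auto
    then have q: "q \<in> A (Suc m)" unfolding q_def using sup_in_app[of "- z" "A (Suc m)"] z by simp
    have zq: "app z q = p" unfolding q_def by simp
    have "q \<notin> A m" using y(4)[of m] p zq unfolding z_def by auto
    then have xq: "app x q = q" using Suc.prems(2) by (simp add: sup_in_def)
    have "app (- v) p = q" using v(2)[OF q] zq by (simp add: app_minus_eq_iff)
    moreover have "app (- u) q = q" using u(2)[OF q] xq by (simp add: app_minus_eq_iff)
    moreover have "com u v = u + (v + (- u + - v))" by (simp only: com_def grp)
    ultimately have "app (com u v) p = app u (app v q)" by (simp only: app_add')
    also have "\<dots> = app x p" using v(2)[OF q] u(2)[of p] zq \<open>p \<in> A (Suc m)\<close> by simp
    finally show ?thesis .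
  qed
  moreover have "com u v \<in> icoms (Suc n) S" unfolding icoms_Suc using u(1) v(1) by (rule comsI)
  ultimately show ?case by blast
qed

context tower
begin

lemma com_f_g: "com f g = bump 1 - bump 0"
  using bump_shift[of 1 0] by (simp add: com_def bump_0)

lemma bump_diff_moves: "app (bump (i + 1) - bump i) ` level (i + 1) \<inter> level (i + 1) = {}"
proof -
  have "app (- bump i) ` level (i + 1) = level (i + 1)"
    by (rule sup_in_image) (simp add: bump_sup)
  moreover have "bump (i + 1) - bump i = bump (i + 1) + - bump i" by simp
  ultimately have "app (bump (i + 1) - bump i) ` level (i + 1) = app (bump (i + 1)) ` level (i + 1)"
    by (simp only: app_image_add)
  then show ?thesis using bump_moves[of 1 "i + 1"] by simp
qed

text \<open>Conjugates of \<open>com f g\<close> by powers of \<open>f\<close> are differences of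
  neighbouring bumps. Spaced far enough apart they satisfy \<open>icoms_realize\<close>, so at every
  depth some iterated commutator acts on \<open>level 2\<close> like \<open>com f g\<close>, which
  moves the support of \<open>z\<close> off \<open>level 1\<close>.\<close>

lemma noncommuting_icoms:
  assumes "t \<noteq> 0" and S: "\<And>i. zmul (t * i) f + com f g - zmul (t * i) f \<in> S"
    and z: "sup_in z (level 1)" "z \<noteq> 0"
  shows "\<exists>w\<in>icoms n S. w + z \<noteq> z + w"
proof -
  \<comment> \<open>The absolute value lets the levels rise for either sign of \<open>t\<close>; for
    negative \<open>t\<close> the hypothesis is used at negative indices.\<close>
  define e where "e i = \<bar>t\<bar> * int i" for i
  have e_Suc: "e i + 1 \<le> e (Suc i)" for i unfolding e_def using \<open>t \<noteq> 0\<close> by (simp add: algebra_simps)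
  define y where "y i = bump (e i + 1) - bump (e i)" for i
  have conj: "zmul k f + com f g - zmul k f = bump (k + 1) - bump k" for k
  proof -
    have "zmul k f + com f g - zmul k f = (zmul k f + bump 1 - zmul k f) - (zmul k f + bump 0 - zmul k f)"
      unfolding com_f_g by (simp only: grp)
    then show ?thesis by (simp add: bump_shift)
  qed
  have y0: "y 0 = com f g" by (simp add: y_def e_def com_f_g)
  have "\<exists>w\<in>icoms n S. \<forall>p\<in>level (e 0 + 2). app w p = app (y 0) p"
  proof (rule icoms_realize[where y = y and A = "\<lambda>i. level (e i + 2)"])
    show yS: "y i \<in> S" for i
      using S[of "int i"] S[of "- int i"] unfolding conj y_def e_def by (cases "t > 0") auto
    show "y 0 \<in> S" by (rule yS)
    have sup: "sup_in (y i) (level (e i + 2))" for i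
      unfolding y_def using bump_sup[of "e i + 1"] sup_in_mono[OF bump_sup[of "e i"] level_mono[of "e i + 1" "e i + 2"]]
      by (intro sup_in_diff) (simp_all add: add.assoc)
    then show "sup_in (y i) (level (e i + 2))" for i .
    show "sup_in (y 0) (level (e 0 + 2))" by (rule sup)
    show "level (e i + 2) \<subseteq> level (e (Suc i) + 2)" for i using e_Suc[of i] by (intro level_mono) simp
    show "app (y (Suc i)) ` level (e i + 2) \<inter> level (e i + 2) = {}" for i
    proof -
      have "level (e i + 2) \<subseteq> level (e (Suc i) + 1)" using e_Suc[of i] by (intro level_mono) simp
      then show ?thesis using bump_diff_moves[of "e (Suc i)"] unfolding y_def by blast
    qed
  qed
  then obtain w where w: "w \<in> icoms n S" "\<And>p. p \<in> level 2 \<Longrightarrow> app w p = app (com f g) p"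
    unfolding y0 by (auto simp: e_def)
  obtain p where p: "app z p \<noteq> p" using z(2) perm_eqI[of z 0] by auto
  then have p1: "p \<in> level 1" "app z p \<in> level 1" using z(1) sup_in_app[OF z(1)] by (auto simp: sup_in_def)
  then have p2: "p \<in> level 2" "app z p \<in> level 2" using level_mono[of 1 2] by auto
  \<comment> \<open>After \<open>w\<close>, the point is out of reach of \<open>z\<close>.
    Commutation would therefore give \<open>w\<close> equal values at \<open>p\<close> and
    \<open>app z p\<close>, which are distinct.\<close>
  have "app (com f g) p \<notin> level 1"
    using bump_diff_moves[of 0] p1(1) unfolding com_f_g by auto
  then have "app (z + w) p = app (com f g) p" using w(2) p2 z(1) by (simp add: sup_in_def)
  moreover have "app (w + z) p = app (com f g) (app z p)" using w(2) p2 by simp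
  ultimately have "w + z \<noteq> z + w" using p app_eq_iff by metis
  then show ?thesis using w(1) by blast
qed

lemma g_nonzero: "g \<noteq> 0"
proof
  assume "g = 0"
  then have "bump 0 = 0" by (metis bump_0)
  then have "app (zmul 1 (bump 0)) ` level 0 = level 0" by simp
  then show False using bump_moves[of 1 0] level_nonempty[of 0] by simp
qed

text \<open>The element \<open>g\<close> is a nontrivial test element supported in
  \<open>level 1\<close>, and whatever fails to commute with it is nonzero.\<close>

lemma icoms_nonzero:
  assumes "t \<noteq> 0" and "\<And>i. zmul (t * i) f + com f g - zmul (t * i) f \<in> S"
  shows "\<exists>w\<in>icoms n S. w \<noteq> 0"
proof -
  have "sup_in g (level 1)" using bump_sup[of 0] by (simp add: bump_0)
  then obtain w where "w \<in> icoms n S" "w + g \<noteq> g + w"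
    using noncommuting_icoms[OF assms, of g] g_nonzero by blast
  then show ?thesis by (intro bexI[of _ w]) auto
qed

lemma coms_GG: "coms GG \<subseteq> NI"
proof -
  have "com x y \<in> NI" if "x \<in> GG" "y \<in> GG" for x y
    using deg_0_iff[OF sgD(5)[OF sgs(4) that]] deg_com[OF that] by simp
  then show ?thesis by (auto simp: coms_def)
qed

lemma EA_class_GG: "EA_class_omega_plus_2 (fgrp GG)"
proof (rule EA_class_omega_plus_2I)
  show "GG = gen {f, g, h}" by (rule GG_def)
  show "\<not> EG_fin n (fgrp GG)" for n using generators by (intro not_EG_fin sgs) auto
  show "EG_omega_plus 2 (fgrp GG)"
    by (rule EG_omega_plus_2_local_law[OF sgs(4,3) NI_GG coms_GG NI_local_law])
qed simp

lemma com_h_g: "com h g = h - (g + h - g)"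
  by (simp only: com_def grp)

text \<open>Since \<open>g\<close> moves \<open>V\<close> off itself, \<open>h\<close> and its
  conjugate by \<open>g\<close> have disjoint supports and commute. Thus \<open>com h g\<close>
  commutes with \<open>h\<close>, as the centralizer argument wants, and qualifies as test element
  in \<open>noncommuting_icoms\<close>.\<close>

lemma com_h_g_props:
  assumes "h \<noteq> 0"
  shows "com h g \<in> GG" "sup_in (com h g) (level 1)" "com h g \<noteq> 0" "com h g + h = h + com h g"
proof -
  define k where "k = g + h - g"
  have k: "sup_in k (app g ` V)" unfolding k_def using h_sup by (rule sup_in_conj)
  have g0: "app g ` level 0 \<inter> level 0 = {}" using bump_moves[of 1 0] by (simp add: bump_0)
  have disj: "V \<inter> app g ` V = {}" using g0 V_level[of 0] by blast
  have comm: "h + k = k + h" by (rule disjoint_sup_commute[OF h_sup k disj])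
  show "com h g \<in> GG" unfolding com_h_g using generators by (intro sgD[OF sgs(4)])
  have "app g ` level 1 = level 1"
    using sup_in_image[OF bump_sup, of 0] by (simp add: bump_0)
  then have "app g ` V \<subseteq> level 1" using V_level[of 1] by blast
  then show "sup_in (com h g) (level 1)"
    unfolding com_h_g k_def[symmetric] by (intro sup_in_diff h_level sup_in_mono[OF k])
  show "com h g + h = h + com h g"
  proof -
    have "com h g + h = h + (- k + h)" unfolding com_h_g k_def[symmetric] by (simp only: grp)
    also have "- k + h = - k + (h + k) - k" by (simp only: grp)
    also have "\<dots> = h - k" unfolding comm by (simp only: grp)
    finally show ?thesis by (simp add: com_h_g k_def)
  qed
  show "com h g \<noteq> 0"
  proof
    assume "com h g = 0"
    then have "h - k = 0" unfolding com_h_g k_def .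
    then have "h = k" by (simp only: right_minus_eq)
    have "h = 0"
    proof (rule perm_eqI)
      fix x
      show "app h x = app 0 x"
        using h_sup k disj unfolding \<open>h = k\<close>[symmetric] sup_in_def by (cases "x \<in> V") auto
    qed
    then show False using assms by simp
  qed
qed

lemma hom_law:
  assumes \<theta>: "add_hom_on H \<theta>" "sg H" and A: "finite A" "A \<subseteq> H" "\<theta> ` A \<subseteq> NI"
  shows "\<exists>n. \<forall>w\<in>icoms n (gen A). \<theta> w = 0"
proof -
  obtain n where n: "icoms n (gen (\<theta> ` A)) \<subseteq> {0}"
    using NI_local_law[OF finite_imageI[OF A(1)] A(3)] by auto
  have "gen A \<subseteq> H" using \<theta>(2) A(2) by (rule gen_least)
  then have "\<theta> ` icoms n (gen A) = icoms n (gen (\<theta> ` A))"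
    unfolding hom_gen[OF \<theta> A(2), symmetric] by (rule hom_icoms[OF \<theta>])
  then have "\<forall>w\<in>icoms n (gen A). \<theta> w = 0" using n by blast
  then show ?thesis ..
qed

end

text \<open>The two alternatives come from \<open>deg (\<psi> f) \<noteq> 0\<close>, where \<open>centralizer_trivial\<close> applies to \<open>\<psi> f\<close>
  or to \<open>\<psi> h\<close>, and \<open>deg (\<psi> f) = 0\<close>, where \<open>\<psi>\<close> maps \<open>\<langle>f, [f, g]\<rangle>\<close> into a locally solvable group.\<close>

lemma tower_hom_dichotomy:
  assumes T: "tower f g h J V" and T': "tower f' g' 0 J' V'" and h: "h \<noteq> 0"
    and \<psi>: "add_hom_on (tower.GG f g h) \<psi>" "\<psi> ` tower.GG f g h \<subseteq> tower.GG f' g' 0"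
  shows "\<psi> (com h g) = 0 \<or> (\<exists>n. \<forall>w\<in>icoms n (gen {f, com f g}). \<psi> w = 0)"
proof -
  interpret tower f g h J V by fact
  interpret T': tower f' g' 0 J' V' by fact
  note hom = add_hom_onD[OF \<psi>(1) sgs(4)]
  have in_GG: "\<psi> x \<in> T'.GG" if "x \<in> GG" for x using \<psi>(2) that by auto
  have central: "q = 0" if "p \<in> T'.GG" "T'.deg p \<noteq> 0" "q \<in> T'.GG" "T'.deg q = 0" "p + q = q + p" for p q
    using T'.centralizer_trivial[OF refl that(1,2) _ that(5)] that T'.deg_0_iff by blast
  have fgh: "f \<in> GG" "g \<in> GG" "h \<in> GG" by (rule generators)+
  have ghg: "g + h - g \<in> GG" using fgh by (intro sgD[OF sgs(4)])
  have c: "com f g \<in> GG" using fgh by (intro sgD[OF sgs(4)])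
  show ?thesis
  proof (cases "T'.deg (\<psi> f) = 0")
    case True
    have "T'.deg (\<psi> (com f g)) = 0" using fgh by (simp add: hom in_GG)
    then have "\<psi> ` {f, com f g} \<subseteq> T'.NI" using True fgh c in_GG T'.deg_0_iff by auto
    then show ?thesis using T'.hom_law[OF \<psi>(1) sgs(4), of "{f, com f g}"] fgh c by auto
  next
    case False
    show ?thesis
    proof (cases "T'.deg (\<psi> h) = 0")
      case True
      have "\<psi> f + \<psi> h = \<psi> h + \<psi> f" using f_h_commute fgh by (simp add: hom(1)[symmetric])
      then have "\<psi> h = 0" using central[of "\<psi> f" "\<psi> h"] False True fgh in_GG by blast
      then have "\<psi> (com h g) = 0" unfolding com_h_g using fgh ghg sgD[OF sgs(4)] by (simp add: hom)
      then show ?thesis ..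
    next
      \<comment> \<open>Conjugates have equal degree, so \<open>\<psi> (com h g)\<close> has degree
        zero. It commutes with \<open>\<psi> h\<close>, whose degree is nonzero, and must
        vanish.\<close>
      case False
      have "T'.deg (\<psi> (g + h - g)) = T'.deg (\<psi> h)"
        using fgh sgD[OF sgs(4)] sgD[OF T'.sgs(4)] by (simp add: hom in_GG T'.degD)
      then have "T'.deg (\<psi> (com h g)) = 0" unfolding com_h_g using fgh ghg in_GG by (simp add: hom T'.degD)
      moreover have "\<psi> h + \<psi> (com h g) = \<psi> (com h g) + \<psi> h"
        using com_h_g_props[OF h] fgh by (simp add: hom(1)[symmetric])
      ultimately have "\<psi> (com h g) = 0" using central[of "\<psi> h" "\<psi> (com h g)"] False fgh com_h_g_props[OF h] in_GG by blast
      then show ?thesis ..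
    qed
  qed
qed

section \<open>The direct product of two towers\<close>

text \<open>The direct product is realized inside a single permutation group: disjoint supports make
  the two factors commute and meet trivially.\<close>

locale tower_pair =
  T1: tower f1 g1 0 J1 "{}" + T2: tower f2 g2 0 J2 "{}"
  for f1 g1 :: "'a perm" and J1 and f2 g2 :: "'a perm" and J2 +
  fixes U1 U2 :: "'a set"
  assumes sup1: "sup_in f1 U1" "sup_in g1 U1" and sup2: "sup_in f2 U2" "sup_in g2 U2"
    and disjoint: "U1 \<inter> U2 = {}"
begin

definition PP :: "'a perm set" where
  "PP = gen {f1, g1, f2, g2}"

lemma sg_PP: "sg PP"
  by (simp add: PP_def sg_gen)

lemma sup_GG: "x \<in> T1.GG \<Longrightarrow> sup_in x U1" "y \<in> T2.GG \<Longrightarrow> sup_in y U2"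
  unfolding T1.GG_def T2.GG_def using sup1 sup2 by (auto elim!: sup_in_gen)

lemma commute: "x \<in> T1.GG \<Longrightarrow> y \<in> T2.GG \<Longrightarrow> x + y = y + x"
  using disjoint_sup_commute[OF sup_GG disjoint] .

lemma GG_PP: "T1.GG \<subseteq> PP" "T2.GG \<subseteq> PP"
  unfolding T1.GG_def T2.GG_def PP_def
  by (intro gen_least sg_gen; auto intro: gen_base gen_zero)+

lemma add_add:
  assumes "a \<in> T1.GG" "b \<in> T2.GG" "a' \<in> T1.GG" "b' \<in> T2.GG"
  shows "(a + b) + (a' + b') = (a + a') + (b + b')"
proof -
  have "(a + b) + (a' + b') = a + (b + a') + b'" by (simp only: add.assoc)
  also have "b + a' = a' + b" by (rule commute[OF assms(3,2), symmetric])
  finally show ?thesis by (simp only: add.assoc)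
qed

lemma PP_form: "x \<in> PP \<longleftrightarrow> (\<exists>a\<in>T1.GG. \<exists>b\<in>T2.GG. x = a + b)"
proof
  define D where "D = {x. \<exists>a\<in>T1.GG. \<exists>b\<in>T2.GG. x = a + b}"
  have DI: "x \<in> D" if "a \<in> T1.GG" "b \<in> T2.GG" "x = a + b" for a b x
    using that unfolding D_def by auto
  have "sg D"
    unfolding sg_def
  proof (intro conjI ballI)
    show "0 \<in> D" by (rule DI[OF sgD(1)[OF T1.sgs(4)] sgD(1)[OF T2.sgs(4)]]) simp
    fix x assume "x \<in> D"
    then obtain a b where ab: "a \<in> T1.GG" "b \<in> T2.GG" "x = a + b" unfolding D_def by auto
    have "- x = - a + - b" unfolding ab(3) commute[OF ab(1,2)] by (simp only: minus_add)
    then show "- x \<in> D" by (rule DI[OF sgD(3)[OF T1.sgs(4) ab(1)] sgD(3)[OF T2.sgs(4) ab(2)]])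
    fix y assume "y \<in> D"
    then obtain c d where cd: "c \<in> T1.GG" "d \<in> T2.GG" "y = c + d" unfolding D_def by auto
    show "x + y \<in> D"
      using add_add[OF ab(1,2) cd(1,2)] unfolding ab(3) cd(3)
      by (rule DI[OF sgD(2)[OF T1.sgs(4) ab(1) cd(1)] sgD(2)[OF T2.sgs(4) ab(2) cd(2)]])
  qed
  moreover have "s \<in> D" if "s \<in> T1.GG" for s
    by (rule DI[OF that sgD(1)[OF T2.sgs(4)]]) simp
  moreover have "s \<in> D" if "s \<in> T2.GG" for s
    by (rule DI[OF sgD(1)[OF T1.sgs(4)] that]) simp
  ultimately have "PP \<subseteq> D"
    unfolding PP_def using T1.generators(1,2) T2.generators(1,2) by (intro gen_least) auto
  moreover assume "x \<in> PP"
  ultimately show "\<exists>a\<in>T1.GG. \<exists>b\<in>T2.GG. x = a + b" unfolding D_def by auto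
next
  assume "\<exists>a\<in>T1.GG. \<exists>b\<in>T2.GG. x = a + b"
  then obtain a b where "a \<in> PP" "b \<in> PP" "x = a + b" using GG_PP by auto
  then show "x \<in> PP" using sgD(2)[OF sg_PP] by simp
qed

lemma unique_sum:
  assumes "a \<in> T1.GG" "b \<in> T2.GG" "a' \<in> T1.GG" "b' \<in> T2.GG" "a + b = a' + b'"
  shows "a = a'" "b = b'"
proof -
  have "app a x = app a' x" for x
  proof (cases "x \<in> U1")
    case True
    then have "x \<notin> U2" using disjoint by auto
    then have "app b x = x" "app b' x = x"
      using sup_GG(2)[OF assms(2)] sup_GG(2)[OF assms(4)] by (auto simp: sup_in_def)
    then show ?thesis using arg_cong[OF assms(5), of "\<lambda>p. app p x"] by simp
  next
    case False
    then show ?thesis using sup_GG(1) assms by (simp add: sup_in_def)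
  qed
  then show "a = a'" by (rule perm_eqI)
  then show "b = b'" using assms(5) by simp
qed

definition p1 :: "'a perm \<Rightarrow> 'a perm" where
  "p1 x = (SOME a. a \<in> T1.GG \<and> (\<exists>b\<in>T2.GG. x = a + b))"

definition p2 :: "'a perm \<Rightarrow> 'a perm" where
  "p2 x = - p1 x + x"

lemma proj:
  assumes "x \<in> PP"
  shows "p1 x \<in> T1.GG" "p2 x \<in> T2.GG" "x = p1 x + p2 x"
proof -
  have "\<exists>a. a \<in> T1.GG \<and> (\<exists>b\<in>T2.GG. x = a + b)" using assms unfolding PP_form by auto
  then have "p1 x \<in> T1.GG \<and> (\<exists>b\<in>T2.GG. x = p1 x + b)" unfolding p1_def by (rule someI_ex)
  then obtain b where b: "p1 x \<in> T1.GG" "b \<in> T2.GG" "x = p1 x + b" by auto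
  have "p2 x = - p1 x + (p1 x + b)" unfolding p2_def b(3)[symmetric] ..
  then have "p2 x = b" by (simp only: minus_add_cancel)
  then show "p1 x \<in> T1.GG" "p2 x \<in> T2.GG" "x = p1 x + p2 x" using b by simp_all
qed

lemma proj_eq:
  assumes "a \<in> T1.GG" "b \<in> T2.GG"
  shows "p1 (a + b) = a" "p2 (a + b) = b"
proof -
  have ab: "a + b \<in> PP" using assms unfolding PP_form by auto
  show "p1 (a + b) = a" "p2 (a + b) = b"
    using unique_sum[OF proj(1,2)[OF ab] assms proj(3)[OF ab, symmetric]] by auto
qed

lemma proj_hom: "add_hom_on PP p1" "add_hom_on PP p2"
proof -
  have "p1 (x + y) = p1 x + p1 y \<and> p2 (x + y) = p2 x + p2 y" if xy: "x \<in> PP" "y \<in> PP" for x y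
  proof -
    note px = proj(1,2)[OF xy(1)] and py = proj(1,2)[OF xy(2)]
    have "x + y = (p1 x + p1 y) + (p2 x + p2 y)"
      using add_add[OF px py] unfolding proj(3)[OF xy(1), symmetric] proj(3)[OF xy(2), symmetric] .
    then show ?thesis
      using proj_eq[OF sgD(2)[OF T1.sgs(4) px(1) py(1)] sgD(2)[OF T2.sgs(4) px(2) py(2)]] by simp
  qed
  then show "add_hom_on PP p1" "add_hom_on PP p2" unfolding add_hom_on_def by auto
qed

lemmas p1D = add_hom_onD[OF proj_hom(1) sg_PP]
lemmas p2D = add_hom_onD[OF proj_hom(2) sg_PP]

lemma EA_class_PP: "EA_class_omega_plus_2 (fgrp PP)"
proof (rule EA_class_omega_plus_2I)
  show "PP = gen {f1, g1, f2, g2}" by (rule PP_def)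
  show "\<not> EG_fin n (fgrp PP)" for n
    using T1.generators GG_PP by (intro T1.not_EG_fin sg_PP) blast
  \<comment> \<open>The common kernel of the two degrees; the quotient embeds into the square of the
    integers and is abelian.\<close>
  define N where "N = {x \<in> PP. p1 x \<in> T1.NI \<and> p2 x \<in> T2.NI}"
  show "EG_omega_plus 2 (fgrp PP)"
  proof (rule EG_omega_plus_2_local_law[OF sg_PP])
    show "sg N"
      unfolding sg_def
    proof (intro conjI ballI)
      show "0 \<in> N"
        unfolding N_def using sgD(1)[OF sg_PP] sgD(1)[OF T1.sgs(3)] sgD(1)[OF T2.sgs(3)]
        by (simp add: p1D(2) p2D(2))
      show "- x \<in> N" if "x \<in> N" for x
        using that sgD(3)[OF sg_PP] sgD(3)[OF T1.sgs(3)] sgD(3)[OF T2.sgs(3)]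
        unfolding N_def by (simp add: p1D(3) p2D(3))
      show "x + y \<in> N" if "x \<in> N" "y \<in> N" for x y
        using that sgD(2)[OF sg_PP] sgD(2)[OF T1.sgs(3)] sgD(2)[OF T2.sgs(3)]
        unfolding N_def by (simp add: p1D(1) p2D(1))
    qed
    show "N \<subseteq> PP" unfolding N_def by auto
    have "com x y \<in> N" if xy: "x \<in> PP" "y \<in> PP" for x y
      using subsetD[OF T1.coms_GG comsI[OF proj(1)[OF xy(1)] proj(1)[OF xy(2)]]]
        subsetD[OF T2.coms_GG comsI[OF proj(2)[OF xy(1)] proj(2)[OF xy(2)]]]
        sgD(5)[OF sg_PP xy] unfolding N_def by (simp add: p1D(5)[OF xy] p2D(5)[OF xy])
    then show "coms PP \<subseteq> N" by (auto simp: coms_def)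
    fix A :: "'a perm set" assume A: "finite A" "A \<subseteq> N"
    then have A': "A \<subseteq> PP" "p1 ` A \<subseteq> T1.NI" "p2 ` A \<subseteq> T2.NI" unfolding N_def by auto
    obtain n1 where n1: "\<forall>w\<in>icoms n1 (gen A). p1 w = 0"
      using T1.hom_law[OF proj_hom(1) sg_PP A(1) A'(1,2)] by blast
    obtain n2 where n2: "\<forall>w\<in>icoms n2 (gen A). p2 w = 0"
      using T2.hom_law[OF proj_hom(2) sg_PP A(1) A'(1,3)] by blast
    have "w = 0" if w: "w \<in> icoms (max n1 n2) (gen A)" for w
    proof -
      have "w \<in> icoms n1 (gen A)" "w \<in> icoms n2 (gen A)"
        using subsetD[OF icoms_antimono[OF sg_gen max.cobounded1] w]
          subsetD[OF icoms_antimono[OF sg_gen max.cobounded2] w] by auto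
      moreover have "w \<in> PP"
        using w icoms_sg[OF sg_gen, of "max n1 n2" A] gen_least[OF sg_PP A'(1)] by auto
      ultimately show ?thesis using n1 n2 proj(3)[of w] by simp
    qed
    then show "\<exists>n. icoms n (gen A) \<subseteq> {0}" by blast
  qed
qed simp

lemma tower_not_embeds_pair:
  assumes T: "tower f g h J V" and h: "h \<noteq> 0"
  shows "\<not> embeds (fgrp (tower.GG f g h)) (fgrp PP)"
proof
  interpret tower f g h J V by fact
  assume "embeds (fgrp GG) (fgrp PP)"
  then obtain \<theta> where \<theta>: "add_hom_on GG \<theta>" "inj_on \<theta> GG" "\<theta> ` GG \<subseteq> PP"
    by (rule embeds_fgrp)
  have "\<theta> x \<in> PP" if "x \<in> GG" for x using \<theta>(3) that by auto
  then have hom: "add_hom_on GG (\<lambda>x. p1 (\<theta> x))" "add_hom_on GG (\<lambda>x. p2 (\<theta> x))"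
    using \<theta>(1) unfolding add_hom_on_def by (simp_all add: p1D(1) p2D(1))
  have into: "(\<lambda>x. p1 (\<theta> x)) ` GG \<subseteq> T1.GG" "(\<lambda>x. p2 (\<theta> x)) ` GG \<subseteq> T2.GG"
    using \<theta>(3) proj by auto
  let ?S = "gen {f, com f g}"
  have c: "com f g \<in> GG" using generators sgD(5)[OF sgs(4)] by blast
  have SG: "?S \<subseteq> GG" using generators c by (intro gen_least sgs) auto
  obtain n1 where n1: "p1 (\<theta> (com h g)) = 0 \<or> (\<forall>w\<in>icoms n1 ?S. p1 (\<theta> w) = 0)"
    using tower_hom_dichotomy[OF T T1.tower_axioms h hom(1) into(1)] by blast
  obtain n2 where n2: "p2 (\<theta> (com h g)) = 0 \<or> (\<forall>w\<in>icoms n2 ?S. p2 (\<theta> w) = 0)"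
    using tower_hom_dichotomy[OF T T2.tower_axioms h hom(2) into(2)] by blast
  \<comment> \<open>Here the spacing is 1, as \<open>f\<close> itself is a generator. The depth
    \<open>max n1 n2\<close> serves both factors because \<open>icoms\<close> shrinks with depth on
    a subgroup.\<close>
  have "zmul (1 * i) f + com f g - zmul (1 * i) f \<in> ?S" for i
    by (intro sgD(2,4)[OF sg_gen] zmul_in[OF sg_gen]) (auto intro: gen_base)
  then obtain w where w: "w \<in> icoms (max n1 n2) ?S" "w + com h g \<noteq> com h g + w"
    using noncommuting_icoms[of 1 ?S "com h g"] com_h_g_props[OF h] by fastforce
  have wn: "w \<in> icoms n1 ?S" "w \<in> icoms n2 ?S"
    using subsetD[OF icoms_antimono[OF sg_gen max.cobounded1] w(1)]
      subsetD[OF icoms_antimono[OF sg_gen max.cobounded2] w(1)] by auto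
  have wG: "w \<in> GG" using w(1) icoms_sg[OF sg_gen] SG by blast
  have cG: "com w (com h g) \<in> GG" using wG com_h_g_props(1)[OF h] by (rule sgD(5)[OF sgs(4)])
  have com0: "com 0 x = 0" "com x 0 = 0" for x :: "'a perm" by (simp_all add: com_def)
  have "p1 (\<theta> (com w (com h g))) = com (p1 (\<theta> w)) (p1 (\<theta> (com h g)))" "p2 (\<theta> (com w (com h g))) = com (p2 (\<theta> w)) (p2 (\<theta> (com h g)))"
    using add_hom_onD(5)[OF hom(1) sgs(4)] add_hom_onD(5)[OF hom(2) sgs(4)] wG com_h_g_props(1)[OF h] by auto
  then have "p1 (\<theta> (com w (com h g))) = 0" "p2 (\<theta> (com w (com h g))) = 0" using n1 n2 wn by (auto simp: com0)
  then have "\<theta> (com w (com h g)) = 0" using proj(3)[of "\<theta> (com w (com h g))"] cG \<theta>(3) by auto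
  also have "0 = \<theta> 0" using add_hom_onD(2)[OF \<theta>(1) sgs(4)] by simp
  finally have "com w (com h g) = 0" using \<theta>(2) cG sgD(1)[OF sgs(4)] by (auto dest: inj_onD)
  then show False using w(2) by (simp add: com_eq_0)
qed

text \<open>The homomorphism to the integers is \<open>deg\<close> after \<open>\<theta>\<close>.
  Some nontrivial combination of \<open>f1\<close> and \<open>f2\<close> has degree zero; as
  \<open>f2\<close> commutes with the first factor, such a combination involving \<open>f1\<close>
  still shifts the bumps there and generates, with \<open>com f1 g1\<close>, a group that is not
  solvable.\<close>

lemma pair_not_embeds_tower:
  assumes T: "tower f g h J V"
  shows "\<not> embeds (fgrp PP) (fgrp (tower.GG f g h))"
proof
  interpret tower f g h J V by fact
  assume "embeds (fgrp PP) (fgrp GG)"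
  then obtain \<theta> where \<theta>: "add_hom_on PP \<theta>" "inj_on \<theta> PP" "\<theta> ` PP \<subseteq> GG"
    by (rule embeds_fgrp)
  note hom = add_hom_onD[OF \<theta>(1) sg_PP]
  have in_GG: "\<theta> x \<in> GG" if "x \<in> PP" for x using that \<theta>(3) by auto
  have d_hom: "add_hom_on PP (\<lambda>x. deg (\<theta> x))"
    using hom(1) in_GG unfolding add_hom_on_def by (simp add: degD)
  note d = add_hom_onD[OF d_hom sg_PP]
  have zmul_int: "zmul k x = k * x" for k x :: int
    by (induction k rule: int_induct[where k = 0]) (simp_all add: zmul_succ zmul_pred algebra_simps)
  have fg: "f1 \<in> PP" "g1 \<in> PP" "f2 \<in> PP" "g2 \<in> PP" unfolding PP_def by (auto intro: gen_base)
  have key: False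
    if x: "x \<in> PP" "deg (\<theta> x) = 0" and y: "y \<in> PP" "deg (\<theta> y) = 0"
      and nz: "\<And>n. \<exists>w\<in>icoms n (gen {x, y}). w \<noteq> 0" for x y
  proof -
    have "\<theta> ` {x, y} \<subseteq> NI" using x y in_GG deg_0_iff by auto
    then obtain n where n: "\<forall>w\<in>icoms n (gen {x, y}). \<theta> w = 0"
      using hom_law[OF \<theta>(1) sg_PP, of "{x, y}"] x y by auto
    obtain w where w: "w \<in> icoms n (gen {x, y})" "w \<noteq> 0" using nz by blast
    have "gen {x, y} \<subseteq> PP" using x y by (intro gen_least sg_PP) auto
    then have "w \<in> PP" using icoms_sg[OF sg_gen] w(1) by blast
    moreover have "\<theta> w = \<theta> 0" using n w(1) hom(2) by simp
    ultimately show False using \<theta>(2) w(2) sgD(1)[OF sg_PP] by (auto dest: inj_onD)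
  qed
  have dc: "deg (\<theta> (com f1 g1)) = 0" "deg (\<theta> (com f2 g2)) = 0"
    using fg in_GG by (simp_all add: hom)
  have cP: "com f1 g1 \<in> PP" "com f2 g2 \<in> PP" using fg sgD(5)[OF sg_PP] by blast+
  define s where "s = deg (\<theta> f1)"
  define t where "t = deg (\<theta> f2)"
  show False
  proof (cases "t = 0")
    case True
    have "zmul (1 * i) f2 + com f2 g2 - zmul (1 * i) f2 \<in> gen {f2, com f2 g2}" for i
      by (intro sgD(2,4)[OF sg_gen] zmul_in[OF sg_gen]) (auto intro: gen_base)
    then have "\<exists>w\<in>icoms n (gen {f2, com f2 g2}). w \<noteq> 0" for n
      by (intro T2.icoms_nonzero[of 1]) auto
    then show False using key[of f2 "com f2 g2"] True fg cP dc unfolding t_def by blast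
  next
    case False
    \<comment> \<open>The exponents \<open>t\<close> and \<open>s\<close> cancel the degrees.
      Conjugation by \<open>x\<close> acts on the first factor as conjugation by
      \<open>zmul t f1\<close>, which spaces the bumps by \<open>t\<close>.\<close>
    define x where "x = zmul t f1 - zmul s f2"
    have xP: "x \<in> PP" unfolding x_def using fg by (intro sgD(4)[OF sg_PP] zmul_in[OF sg_PP])
    have "deg (\<theta> x) = 0"
      unfolding x_def using fg zmul_in[OF sg_PP] by (simp add: d zmul_int s_def t_def)
    define Y where "Y i = zmul (t * i) f1 + com f1 g1 - zmul (t * i) f1" for i
    let ?S = "gen {x, com f1 g1}"
    have Y_step: "x + Y i - x = Y (i + 1)" for i
    proof -
      have "Y i \<in> T1.GG" unfolding Y_def using T1.generators
        by (intro sgD(2,4,5)[OF T1.sgs(4)] zmul_in[OF T1.sgs(4)])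
      moreover have b: "zmul s f2 \<in> T2.GG" using T2.generators by (intro zmul_in[OF T2.sgs(4)])
      ultimately have "Y i + zmul s f2 = zmul s f2 + Y i" by (rule commute)
      moreover have "x + Y i - x = zmul t f1 + (- zmul s f2 + (Y i + zmul s f2)) - zmul t f1"
        unfolding x_def by (simp only: grp)
      ultimately have "x + Y i - x = zmul t f1 + Y i - zmul t f1" by (simp only: minus_add_cancel)
      also have "\<dots> = (zmul t f1 + zmul (t * i) f1) + com f1 g1 - (zmul t f1 + zmul (t * i) f1)"
        unfolding Y_def by (simp only: grp)
      also have "zmul t f1 + zmul (t * i) f1 = zmul (t * (i + 1)) f1"
        by (simp add: zmul_add[symmetric] algebra_simps)
      finally show ?thesis by (simp only: Y_def)
    qed
    have xS: "x \<in> ?S" by (auto intro: gen_base)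
    have Y_in: "Y i \<in> ?S" for i
    proof (induction i rule: int_induct[where k = 0])
      case base
      show ?case by (auto simp: Y_def intro: gen_base)
    next
      case (step1 i)
      then show ?case unfolding Y_step[symmetric] using xS by (intro sgD(2,4)[OF sg_gen])
    next
      case (step2 i)
      have "Y i = x + Y (i - 1) - x" using Y_step[of "i - 1"] by simp
      then have "Y (i - 1) = - x + Y i + x" by (simp only: grp)
      then show ?case using step2 xS sgD(2)[OF sg_gen] sgD(3)[OF sg_gen] by metis
    qed
    have "\<exists>w\<in>icoms n ?S. w \<noteq> 0" for n
      using T1.icoms_nonzero[OF False] Y_in unfolding Y_def by blast
    then show False using key[OF xP \<open>deg (\<theta> x) = 0\<close> cP(1) dc(1)] by blast
  qed
qed

end

section \<open>Piecewise linear homeomorphisms\<close>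

lemma dyadic_of_int: "dyadic (of_int m)"
  unfolding dyadic_def by (rule exI[of _ m], rule exI[of _ 0]) simp

lemma dyadic_add: "dyadic x \<Longrightarrow> dyadic y \<Longrightarrow> dyadic (x + y)"
  unfolding dyadic_def
proof (elim exE)
  fix m n :: int and k l :: nat
  assume "x = of_int m / 2 ^ k" "y = of_int n / 2 ^ l"
  then have "x + y = of_int (m * 2 ^ l + n * 2 ^ k) / 2 ^ (k + l)"
    by (simp add: add_frac_eq power_add)
  then show "\<exists>m k. x + y = of_int m / 2 ^ k" by blast
qed

lemma dyadic_mult: "dyadic x \<Longrightarrow> dyadic y \<Longrightarrow> dyadic (x * y)"
  unfolding dyadic_def
proof (elim exE)
  fix m n :: int and k l :: nat
  assume "x = of_int m / 2 ^ k" "y = of_int n / 2 ^ l"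
  then have "x * y = of_int (m * n) / 2 ^ (k + l)"
    by (simp add: power_add)
  then show "\<exists>m k. x * y = of_int m / 2 ^ k" by blast
qed

lemma dyadic_minus: "dyadic x \<Longrightarrow> dyadic (- x)"
  using dyadic_mult[of "of_int (- 1)" x] dyadic_of_int[of "- 1"] by simp

lemma dyadic_diff: "dyadic x \<Longrightarrow> dyadic y \<Longrightarrow> dyadic (x - y)"
  using dyadic_add[of x "- y"] dyadic_minus[of y] by simp

lemma dyadic_powr: "dyadic (2 powr real_of_int k)"
proof (cases "0 \<le> k")
  case True
  then have "2 powr real_of_int k = of_int (2 ^ nat k)"
    by (simp add: powr_realpow[symmetric])
  then show ?thesis using dyadic_of_int by metis
next
  case False
  then have "2 powr real_of_int k = of_int 1 / 2 ^ nat (- k)"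
    by (simp add: powr_realpow[symmetric] powr_minus_divide[symmetric])
  then show ?thesis unfolding dyadic_def by blast
qed

definition increasing :: "real perm \<Rightarrow> bool" where
  "increasing p \<longleftrightarrow> strict_mono (app p)"

lemma increasing_less: "increasing p \<Longrightarrow> app p x < app p y \<longleftrightarrow> x < y"
  unfolding increasing_def by (rule strict_mono_less)

lemma increasing_le: "increasing p \<Longrightarrow> app p x \<le> app p y \<longleftrightarrow> x \<le> y"
  unfolding increasing_def by (rule strict_mono_less_eq)

lemma sg_increasing: "sg {p. increasing p}"
proof -
  have "increasing (- p)" if "increasing p" for p
    unfolding increasing_def
  proof (rule strict_monoI)
    fix x y :: real assume "x < y"
    then show "app (- p) x < app (- p) y"
      using increasing_less[OF that, of "app (- p) x" "app (- p) y"] by simp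
  qed
  then show ?thesis by (auto simp: sg_def increasing_def strict_mono_def)
qed

lemmas increasing_intros = sgD[OF sg_increasing, simplified]

lemma increasing_image:
  assumes "increasing p"
  shows "app p ` {a<..<b} = {app p a<..<app p b}"
proof (intro equalityI subsetI)
  fix y assume y: "y \<in> {app p a<..<app p b}"
  then have "a < app (- p) y" "app (- p) y < b"
    using increasing_less[OF assms, of a "app (- p) y"] increasing_less[OF assms, of "app (- p) y" b] by auto
  then show "y \<in> app p ` {a<..<b}" by (simp add: mem_app_image)
qed (auto simp: increasing_less[OF assms])

text \<open>The intervals may be degenerate, so \<open>linear_off D p\<close> also says that \<open>p\<close> maps every point to
  its image by a dyadic affine map of slope a power of two.\<close>

definition linear_off :: "real set \<Rightarrow> real perm \<Rightarrow> bool" where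
  "linear_off D p \<longleftrightarrow> (\<forall>a b. 0 \<le> a \<longrightarrow> a \<le> b \<longrightarrow> b \<le> 1 \<longrightarrow> D \<inter> {a<..<b} = {} \<longrightarrow>
     (\<exists>k c. dyadic c \<and> (\<forall>x\<in>{a..b}. app p x = 2 powr real_of_int k * x + c)))"

text \<open>Breakpoints are encoded as a finite exceptional set in place of a partition, so that
  composites are handled by uniting such sets.\<close>

definition PL :: "real perm set" where
  "PL = {p. increasing p \<and> sup_in p {0<..<1} \<and> (\<exists>D. finite D \<and> (\<forall>d\<in>D. dyadic d) \<and> linear_off D p)}"

text \<open>The degenerate interval from \<open>x\<close> to \<open>x\<close> meets no exceptional
  point, so an affine formula holds at every single point of the unit interval.\<close>

lemma linear_off_dyadic:
  assumes "linear_off D p" "0 \<le> x" "x \<le> 1"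
  shows "dyadic (app p x) \<longleftrightarrow> dyadic x"
proof -
  obtain k c where *: "dyadic c" "app p x = 2 powr real_of_int k * x + c"
    using assms unfolding linear_off_def by (metis atLeastAtMost_singleton greaterThanLessThan_empty inf_bot_right order_refl singletonI)
  have "x = 2 powr real_of_int (- k) * (app p x - c)"
    unfolding *(2) by (simp add: powr_minus field_simps)
  then show ?thesis
    using dyadic_mult[OF dyadic_powr[of "- k"] dyadic_diff[of "app p x" c]]
      dyadic_add[OF dyadic_mult[OF dyadic_powr[of k], of x] *(1)] *
    by metis
qed

lemma sup_in_01:
  assumes "sup_in p {0<..<1::real}"
  shows "app p x \<in> {0..1} \<longleftrightarrow> x \<in> {0..1}"
  by (rule sup_in_app) (rule sup_in_mono[OF assms], auto)

lemma PL_add: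
  assumes "p \<in> PL" "q \<in> PL"
  shows "p + q \<in> PL"
proof -
  obtain D where D: "finite D" "\<And>d. d \<in> D \<Longrightarrow> dyadic d" "linear_off D p"
    and p: "increasing p" "sup_in p {0<..<1}" using assms(1) unfolding PL_def by auto
  obtain E where E: "finite E" "\<And>d. d \<in> E \<Longrightarrow> dyadic d" "linear_off E q"
    and q: "increasing q" "sup_in q {0<..<1}" using assms(2) unfolding PL_def by auto
  \<comment> \<open>Breakpoints of the composite are those of \<open>q\<close> and the preimages
    under \<open>q\<close> of those of \<open>p\<close>. Cutting down to the unit interval lets
    \<open>linear_off_dyadic\<close> show that the preimages are dyadic.\<close>
  define F where "F = E \<union> app (- q) ` (D \<inter> {0..1})"
  have q': "sup_in (- q) {0<..<1}" using q by simp
  have "finite F" unfolding F_def using D E by auto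
  moreover have "dyadic d" if "d \<in> F" for d
  proof -
    have "dyadic (app (- q) x)" if "x \<in> D \<inter> {0..1}" for x
      using linear_off_dyadic[OF E(3), of "app (- q) x"] D(2) that sup_in_01[OF q', of x] by auto
    then show ?thesis using that E(2) unfolding F_def by auto
  qed
  moreover have "linear_off F (p + q)"
    unfolding linear_off_def
  proof (intro allI impI)
    fix a b :: real assume ab: "0 \<le> a" "a \<le> b" "b \<le> 1" "F \<inter> {a<..<b} = {}"
    have "E \<inter> {a<..<b} = {}" using ab(4) unfolding F_def by auto
    then obtain k c where kc: "dyadic c" "\<And>x. x \<in> {a..b} \<Longrightarrow> app q x = 2 powr real_of_int k * x + c"
      using E(3) ab unfolding linear_off_def by blast
    have qab: "0 \<le> app q a" "app q a \<le> app q b" "app q b \<le> 1"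
      using sup_in_01[OF q(2), of a] sup_in_01[OF q(2), of b] ab increasing_le[OF q(1)] by auto
    have "D \<inter> {app q a<..<app q b} = {}"
    proof (rule ccontr)
      assume "D \<inter> {app q a<..<app q b} \<noteq> {}"
      then obtain d where d: "d \<in> D" "d \<in> app q ` {a<..<b}" unfolding increasing_image[OF q(1)] by blast
      then have "d \<in> {0..1}" using qab unfolding increasing_image[OF q(1)] by auto
      then have "app (- q) d \<in> F \<inter> {a<..<b}" using d unfolding F_def mem_app_image by auto
      then show False using ab(4) by auto
    qed
    then obtain l e where le: "dyadic e" "\<And>x. x \<in> {app q a..app q b} \<Longrightarrow> app p x = 2 powr real_of_int l * x + e"
      using D(3) qab unfolding linear_off_def by blast
    have "app (p + q) x = 2 powr real_of_int (l + k) * x + (2 powr real_of_int l * c + e)" if "x \<in> {a..b}" for x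
    proof -
      have "app q x \<in> {app q a..app q b}" using that increasing_le[OF q(1)] by auto
      then have "app (p + q) x = 2 powr real_of_int l * (2 powr real_of_int k * x + c) + e"
        using le(2) kc(2)[OF that] by simp
      then show ?thesis by (simp add: powr_add algebra_simps)
    qed
    moreover have "dyadic (2 powr real_of_int l * c + e)"
      using kc le by (intro dyadic_add dyadic_mult dyadic_powr)
    ultimately show "\<exists>k c. dyadic c \<and> (\<forall>x\<in>{a..b}. app (p + q) x = 2 powr real_of_int k * x + c)"
      by blast
  qed
  moreover have "increasing (p + q)" "sup_in (p + q) {0<..<1}"
    using p q by (auto intro: increasing_intros sup_in_add)
  ultimately show ?thesis unfolding PL_def by blast
qed

lemma PL_minus:
  assumes "p \<in> PL"
  shows "- p \<in> PL"
proof -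
  obtain D where D: "finite D" "\<And>d. d \<in> D \<Longrightarrow> dyadic d" "linear_off D p"
    and p: "increasing p" "sup_in p {0<..<1}" using assms unfolding PL_def by auto
  define F where "F = app p ` (D \<inter> {0..1})"
  have "finite F" unfolding F_def using D by auto
  moreover have "dyadic d" if "d \<in> F" for d
    using that linear_off_dyadic[OF D(3)] D(2) unfolding F_def by auto
  moreover have "linear_off F (- p)"
    unfolding linear_off_def
  proof (intro allI impI)
    fix a b :: real assume ab: "0 \<le> a" "a \<le> b" "b \<le> 1" "F \<inter> {a<..<b} = {}"
    have p': "sup_in (- p) {0<..<1}" "increasing (- p)" using p by (auto intro: increasing_intros)
    define u where "u = app (- p) a"
    define v where "v = app (- p) b"
    have uv: "0 \<le> u" "u \<le> v" "v \<le> 1" "app p u = a" "app p v = b"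
      using sup_in_01[OF p'(1), of a] sup_in_01[OF p'(1), of b] ab increasing_le[OF p'(2)]
      unfolding u_def v_def by auto
    have "D \<inter> {u<..<v} = {}"
    proof (rule ccontr)
      assume "D \<inter> {u<..<v} \<noteq> {}"
      then obtain d where d: "d \<in> D" "d \<in> {u<..<v}" by blast
      then have "app p d \<in> F" "app p d \<in> {a<..<b}"
        using uv increasing_less[OF p(1), of u d] increasing_less[OF p(1), of d v] unfolding F_def by auto
      then show False using ab(4) by auto
    qed
    then obtain k c where kc: "dyadic c" "\<And>x. x \<in> {u..v} \<Longrightarrow> app p x = 2 powr real_of_int k * x + c"
      using D(3) uv unfolding linear_off_def by blast
    have "app (- p) x = 2 powr real_of_int (- k) * x + - (2 powr real_of_int (- k) * c)" if "x \<in> {a..b}" for x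
    proof -
      have "app (- p) x \<in> {u..v}" using that increasing_le[OF p'(2)] unfolding u_def v_def by auto
      then have "x = 2 powr real_of_int k * app (- p) x + c" using kc(2)[of "app (- p) x"] by simp
      then have "2 powr real_of_int (- k) * (x - c) = 2 powr real_of_int (- k) * (2 powr real_of_int k * app (- p) x)"
        by (metis add_diff_cancel_right')
      then show ?thesis by (simp add: powr_minus algebra_simps)
    qed
    moreover have "dyadic (- (2 powr real_of_int (- k) * c))"
      using kc by (intro dyadic_minus dyadic_mult dyadic_powr)
    ultimately show "\<exists>k c. dyadic c \<and> (\<forall>x\<in>{a..b}. app (- p) x = 2 powr real_of_int k * x + c)"
      by blast
  qed
  moreover have "increasing (- p)" "sup_in (- p) {0<..<1}"
    using p by (auto intro: increasing_intros)
  ultimately show ?thesis unfolding PL_def by blast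
qed

lemma PL_zero: "0 \<in> PL"
proof -
  have "linear_off {} 0"
    unfolding linear_off_def
  proof (intro allI impI exI conjI)
    show "dyadic 0" using dyadic_of_int[of 0] by simp
    show "\<forall>x\<in>{a..b}. app 0 x = 2 powr real_of_int 0 * x + 0" for a b :: real by simp
  qed
  then show ?thesis unfolding PL_def by (auto intro: increasing_intros)
qed

lemma sg_PL: "sg PL"
  unfolding sg_def using PL_zero PL_add PL_minus by blast

lemma PL_thompsonF:
  assumes "p \<in> PL"
  shows "thompsonF_elem (app p)"
proof -
  obtain D where D: "finite D" "\<And>d. d \<in> D \<Longrightarrow> dyadic d" "linear_off D p"
    and p: "increasing p" "sup_in p {0<..<1}" using assms unfolding PL_def by auto
  have cont: "continuous_on A (app q)" if "increasing q" for q A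
  proof -
    have "app q ` UNIV = UNIV" using bij_app[of q] by (simp add: bij_def)
    then have "continuous_on UNIV (app q)"
      using increasing_le[OF that] by (intro continuous_onI_mono) auto
    then show ?thesis using continuous_on_subset by blast
  qed
  have img: "app q ` {0..1} = {0..1}" if "sup_in q {0<..<1::real}" for q
    by (rule sup_in_image) (rule sup_in_mono[OF that], auto)
  have "homeomorphism {0..1} {0..1} (app p) (app (- p))"
    unfolding homeomorphism_def
    using cont[OF p(1)] cont[OF increasing_intros(3)[OF p(1)]] img[OF p(2)] img[of "- p"] p(2) by auto
  moreover have "strict_mono_on {0..1} (app p)"
    using increasing_less[OF p(1)] by (auto intro: strict_mono_onI)
  moreover have "\<forall>x. x \<notin> {0..1} \<longrightarrow> app p x = x" using p(2) by (auto simp: sup_in_def)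
  moreover have "\<exists>(n::nat) (t::nat \<Rightarrow> real). t 0 = 0 \<and> t n = 1 \<and>
        (\<forall>i<n. t i < t (Suc i)) \<and> (\<forall>i\<le>n. dyadic (t i)) \<and>
        (\<forall>i<n. \<exists>(k::int) (b::real). \<forall>x\<in>{t i..t (Suc i)}. app p x = 2 powr (real_of_int k) * x + b)"
  proof -
    \<comment> \<open>With the endpoints added and outside points dropped, the sorted list of
      \<open>E\<close> is the required partition: consecutive entries enclose no point of
      \<open>D\<close>.\<close>
    define E where "E = {0, 1} \<union> (D \<inter> {0..1})"
    define l where "l = sorted_list_of_set E"
    have fin: "finite E" unfolding E_def using D(1) by simp
    have l: "set l = E" "sorted_wrt (<) l" "sorted l"
      unfolding l_def using fin by (auto simp: strict_sorted_iff)
    have E01: "x \<in> {0..1}" "dyadic x" if "x \<in> E" for x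
      using that D(2) dyadic_of_int[of 0] dyadic_of_int[of 1] unfolding E_def by auto
    have "E \<noteq> {}" unfolding E_def by auto
    then have ne: "length l > 0" using l(1) by auto
    define n where "n = length l - 1"
    then have len: "length l = Suc n" using ne by simp
    have nth: "l ! i \<in> E" if "i \<le> n" for i
      using nth_mem[of i l] that by (simp add: len l(1))
    have step: "l ! i < l ! j" if "i < j" "j \<le> n" for i j
      using sorted_wrt_nth_less[OF l(2), of i j] that by (simp add: len)
    have index: "\<exists>i\<le>n. x = l ! i" if "x \<in> E" for x
    proof -
      have "x \<in> set l" using that l(1) by simp
      then obtain i where "i < length l" "l ! i = x" unfolding in_set_conv_nth by auto
      then show ?thesis unfolding len by (intro exI[of _ i]) auto
    qed
    have mono: "l ! i \<le> l ! j" if "i \<le> j" "j \<le> n" for i j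
      using step[of i j] that by (cases "i = j") auto
    have "l ! 0 = 0"
    proof -
      obtain i where "i \<le> n" "0 = l ! i" using index[of 0] unfolding E_def by auto
      then have "l ! 0 \<le> 0" using mono[of 0 i] by simp
      then show ?thesis using E01[OF nth[of 0]] by simp
    qed
    moreover have "l ! n = 1"
    proof -
      obtain i where "i \<le> n" "1 = l ! i" using index[of 1] unfolding E_def by auto
      then have "l ! n \<ge> 1" using mono[of i n] by simp
      then show ?thesis using E01[OF nth[of n]] by simp
    qed
    moreover have "\<exists>(k::int) (b::real). \<forall>x\<in>{l ! i..l ! Suc i}. app p x = 2 powr (real_of_int k) * x + b"
      if i: "i < n" for i
    proof -
      have bounds: "0 \<le> l ! i" "l ! i \<le> l ! Suc i" "l ! Suc i \<le> 1"
        using E01[OF nth[of i]] E01[OF nth[of "Suc i"]] step[of i "Suc i"] i by auto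
      have "D \<inter> {l ! i<..<l ! Suc i} = {}"
      proof (rule ccontr)
        assume "D \<inter> {l ! i<..<l ! Suc i} \<noteq> {}"
        then obtain d where "d \<in> D" "d \<in> {l ! i<..<l ! Suc i}" by blast
        then have d: "d \<in> D" "l ! i < d" "d < l ! Suc i" by auto
        then have "d \<in> E" using bounds unfolding E_def by auto
        then obtain j where j: "j \<le> n" "d = l ! j" using index by auto
        show False
        proof (cases "j \<le> i")
          case True
          then show ?thesis using mono[of j i] i d j by auto
        next
          case False
          then show ?thesis using mono[of "Suc i" j] d j by auto
        qed
      qed
      then show ?thesis using D(3) bounds unfolding linear_off_def by blast
    qed
    moreover have "\<forall>i<n. l ! i < l ! Suc i" using step by simp
    moreover have "\<forall>i\<le>n. dyadic (l ! i)" using nth E01(2) by blast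
    ultimately show ?thesis by (intro exI[of _ n] exI[of _ "\<lambda>i. l ! i"] conjI) blast+
  qed
  ultimately show ?thesis unfolding thompsonF_elem_def by blast
qed

text \<open>Computed directly from the description of \<open>m_inv\<close>: a left inverse of the
  bijection \<open>app p\<close> is determined at every point.\<close>

lemma inv_thompsonF:
  assumes "p \<in> PL"
  shows "inv\<^bsub>thompsonF\<^esub> (app p) = app (- p)"
  unfolding m_inv_def
proof (rule the_equality)
  have "thompsonF_elem (app (- p))" using PL_thompsonF[OF PL_minus[OF assms]] .
  then show "app (- p) \<in> carrier thompsonF \<and> app p \<otimes>\<^bsub>thompsonF\<^esub> app (- p) = \<one>\<^bsub>thompsonF\<^esub> \<and>
      app (- p) \<otimes>\<^bsub>thompsonF\<^esub> app p = \<one>\<^bsub>thompsonF\<^esub>"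
    by (simp add: thompsonF_def fun_eq_iff)
next
  fix y assume y: "y \<in> carrier thompsonF \<and> app p \<otimes>\<^bsub>thompsonF\<^esub> y = \<one>\<^bsub>thompsonF\<^esub> \<and>
      y \<otimes>\<^bsub>thompsonF\<^esub> app p = \<one>\<^bsub>thompsonF\<^esub>"
  show "y = app (- p)"
  proof
    fix x
    have "(y \<circ> app p) (app (- p) x) = app (- p) x" using y by (simp add: thompsonF_def)
    then show "y x = app (- p) x" by simp
  qed
qed

lemma fin_gen_thompsonF:
  assumes "finite S" "S \<subseteq> PL"
  shows "fin_gen_subgroup thompsonF (app ` gen S)"
proof -
  have gen: "gen S \<subseteq> PL" using sg_PL assms(2) by (rule gen_least)
  have "subgroup (app ` gen S) thompsonF"
  proof (rule subgroup.intro)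
    show "app ` gen S \<subseteq> carrier thompsonF" using gen PL_thompsonF by (auto simp: thompsonF_def)
    show "x \<otimes>\<^bsub>thompsonF\<^esub> y \<in> app ` gen S" if xy: "x \<in> app ` gen S" "y \<in> app ` gen S" for x y
    proof -
      obtain p q where pq: "p \<in> gen S" "q \<in> gen S" "x = app p" "y = app q" using xy by auto
      then have "x \<otimes>\<^bsub>thompsonF\<^esub> y = app (p + q)" by (simp add: thompsonF_def app_add)
      then show ?thesis using genD(2)[OF pq(1,2)] by simp
    qed
    show "\<one>\<^bsub>thompsonF\<^esub> \<in> app ` gen S"
      using imageI[OF gen_zero, of app S] by (simp only: thompsonF_def monoid.simps app_0)
    show "inv\<^bsub>thompsonF\<^esub> x \<in> app ` gen S" if x: "x \<in> app ` gen S" for x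
    proof -
      obtain p where p: "p \<in> gen S" "x = app p" using x by auto
      have "inv\<^bsub>thompsonF\<^esub> x = app (- p)" unfolding p(2) using p(1) gen by (intro inv_thompsonF) auto
      then show ?thesis using genD(3)[OF p(1)] by simp
    qed
  qed
  moreover have "generate thompsonF (app ` S) = app ` gen S"
    using assms(2) inv_thompsonF by (intro generate_app) (auto simp: thompsonF_def)
  ultimately show ?thesis
    unfolding fin_gen_subgroup_def using assms(1)
    by (intro conjI exI[of _ "app ` S"]) (auto intro: gen_base)
qed

text \<open>Thompson's generator \<open>x\<^sub>0\<close>, rescaled to the interval from \<open>a\<close> to \<open>a + w\<close>.\<close>

definition stretch :: "real \<Rightarrow> real \<Rightarrow> real \<Rightarrow> real" where
  "stretch a w x = (if x \<le> a \<or> a + w \<le> x then x else if x \<le> a + w / 4 then a + 2 * (x - a)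
     else if x \<le> a + w / 2 then x + w / 4 else a + w / 2 + (x - a) / 2)"

definition X0 :: "real \<Rightarrow> real \<Rightarrow> real perm" where
  "X0 a w = Perm (stretch a w)"

lemma app_X0:
  assumes "0 < w"
  shows "app (X0 a w) = stretch a w"
  unfolding X0_def
proof (rule app_Perm, rule o_bij)
  \<comment> \<open>The explicit inverse; its inner breakpoints \<open>a + w / 2\<close> and
    \<open>a + 3 * w / 4\<close> are the images of those of \<open>stretch\<close>.\<close>
  define shrink where "shrink y = (if y \<le> a \<or> a + w \<le> y then y else if y \<le> a + w / 2 then a + (y - a) / 2
     else if y \<le> a + 3 * w / 4 then y - w / 4 else 2 * (y - w / 2) - a)" for y
  have "shrink (stretch a w x) = x" for x
  proof -
    consider "x \<le> a \<or> a + w \<le> x" | "a < x" "x \<le> a + w / 4" | "a + w / 4 < x" "x \<le> a + w / 2"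
      | "a + w / 2 < x" "x < a + w" by linarith
    then show ?thesis
      by cases (use assms in \<open>simp_all add: shrink_def stretch_def field_simps\<close>)
  qed
  then show "shrink \<circ> stretch a w = id" by (simp add: fun_eq_iff)
  have "stretch a w (shrink y) = y" for y
  proof -
    consider "y \<le> a \<or> a + w \<le> y" | "a < y" "y \<le> a + w / 2" | "a + w / 2 < y" "y \<le> a + 3 * w / 4"
      | "a + 3 * w / 4 < y" "y < a + w" by linarith
    then show ?thesis
      by cases (use assms in \<open>simp_all add: shrink_def stretch_def field_simps\<close>)
  qed
  then show "stretch a w \<circ> shrink = id" by (simp add: fun_eq_iff)
qed

lemma X0_increasing: "0 < w \<Longrightarrow> increasing (X0 a w)"
  unfolding increasing_def by (rule strict_monoI) (auto simp: app_X0 stretch_def field_simps)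

lemma X0_sup: "0 < w \<Longrightarrow> sup_in (X0 a w) {a<..<a + w}"
  by (auto simp: sup_in_def app_X0 stretch_def)

lemma X0_ge: "0 < w \<Longrightarrow> x \<le> app (X0 a w) x"
  by (auto simp: app_X0 stretch_def field_simps)

lemma X0_PL:
  assumes w: "0 < w" and "0 \<le> a" "a + w \<le> 1" "dyadic a" "dyadic w"
  shows "X0 a w \<in> PL"
proof -
  define D where "D = {a, a + w / 4, a + w / 2, a + w}"
  have frac: "dyadic (w / 4)" "dyadic (w / 2)" "dyadic (a / 2)"
    using dyadic_mult[OF dyadic_powr[of "- 2"], of w] dyadic_mult[OF dyadic_powr[of "- 1"]] assms
    by (simp_all add: powr_minus powr_realpow)
  have "linear_off D (X0 a w)"
    unfolding linear_off_def
  proof (intro allI impI)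
    fix u v assume uv: "0 \<le> u" "u \<le> v" "v \<le> 1" "D \<inter> {u<..<v} = {}"
    have "d \<le> u \<or> v \<le> d" if "d \<in> D" for d using uv(4) that by force
    then consider "v \<le> a" | "a \<le> u" "v \<le> a + w / 4" | "a + w / 4 \<le> u" "v \<le> a + w / 2"
      | "a + w / 2 \<le> u" "v \<le> a + w" | "a + w \<le> u"
      unfolding D_def by (metis insertI1 insertI2)
    then show "\<exists>k c. dyadic c \<and> (\<forall>x\<in>{u..v}. app (X0 a w) x = 2 powr real_of_int k * x + c)"
    proof cases
      case 1
      then show ?thesis using w dyadic_of_int[of 0]
        by (intro exI[of _ 0]) (auto simp: app_X0 stretch_def)
    next
      case 2
      then show ?thesis using w dyadic_minus[OF \<open>dyadic a\<close>]
        by (intro exI[of _ 1] exI[of _ "- a"]) (auto simp: app_X0 stretch_def)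
    next
      case 3
      then show ?thesis using w frac
        by (intro exI[of _ 0] exI[of _ "w / 4"]) (auto simp: app_X0 stretch_def)
    next
      case 4
      then show ?thesis using w dyadic_add[OF frac(3,2)]
        by (intro exI[of _ "- 1"] exI[of _ "a / 2 + w / 2"])
          (auto simp: app_X0 stretch_def powr_minus field_simps)
    next
      case 5
      then show ?thesis using w dyadic_of_int[of 0]
        by (intro exI[of _ 0]) (auto simp: app_X0 stretch_def)
    qed
  qed
  moreover have "\<forall>d\<in>D. dyadic d"
    unfolding D_def using assms frac by (auto intro: dyadic_add)
  moreover have "finite D" unfolding D_def by simp
  moreover have "sup_in (X0 a w) {0<..<1}"
    using X0_sup[OF w, of a] by (rule sup_in_mono) (use assms in auto)
  ultimately show ?thesis unfolding PL_def using X0_increasing[OF w] by blast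
qed

section \<open>Explicit generators in the unit interval\<close>

text \<open>The square of \<open>X0 a w\<close> takes the first quarter point of its interval to the
  third. Its inverse on the left and the square itself on the right enlarge the interval from
  \<open>s + 3/32\<close> to \<open>s + 7/32\<close> by 1/16 at each end; the gap from
  \<open>s + 1/8\<close> to \<open>s + 3/16\<close> stays fixed and leaves room for
  \<open>core\<close>.\<close>

definition shifter :: "real \<Rightarrow> real perm" where
  "shifter s = (X0 (s + 3/16) (1/8) + X0 (s + 3/16) (1/8)) - (X0 s (1/8) + X0 s (1/8))"

text \<open>The interval of this square is the enlarged one, from \<open>s + 1/32\<close> to
  \<open>s + 9/32\<close>; its quarter points are the ends of the original one, so the left end goes
  to the right end.\<close>

definition spreader :: "real \<Rightarrow> real perm" where
  "spreader s = X0 (s + 1/32) (1/4) + X0 (s + 1/32) (1/4)"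

definition core :: "real \<Rightarrow> real perm" where
  "core s = X0 (s + 1/8) (1/16)"

lemma shifter_increasing: "increasing (shifter s)"
  unfolding shifter_def by (intro increasing_intros X0_increasing) auto

lemma shifter_values: "app (shifter s) (s + 3/32) = s + 1/32" "app (shifter s) (s + 7/32) = s + 9/32"
  "s + 1/8 \<le> x \<Longrightarrow> x \<le> s + 3/16 \<Longrightarrow> app (shifter s) x = x"
proof -
  let ?L = "X0 s (1/8) + X0 s (1/8)" and ?R = "X0 (s + 3/16) (1/8) + X0 (s + 3/16) (1/8)"
  have L: "app (- ?L) (s + 3/32) = s + 1/32" "s + 1/8 \<le> x \<Longrightarrow> app (- ?L) x = x" for x
    unfolding app_minus_eq_iff by (simp_all add: app_X0 stretch_def)
  have R: "app ?R (s + 7/32) = s + 9/32" "x \<le> s + 3/16 \<Longrightarrow> app ?R x = x" for x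
    by (simp_all add: app_X0 stretch_def)
  show "app (shifter s) (s + 3/32) = s + 1/32" "app (shifter s) (s + 7/32) = s + 9/32"
    "s + 1/8 \<le> x \<Longrightarrow> x \<le> s + 3/16 \<Longrightarrow> app (shifter s) x = x"
    unfolding shifter_def app_diff by (simp_all add: L R del: app_add')
qed

lemma shifter_image: "app (shifter s) ` {s + 3/32<..<s + 7/32} = {s + 1/32<..<s + 9/32}"
  unfolding increasing_image[OF shifter_increasing] shifter_values ..

text \<open>No point moves to the left and the left end goes to the right end, so every positive
  power pushes the interval past its right end; negative powers follow by exchanging the two
  points.\<close>

lemma spreader_wandering: "wandering (spreader s) {s + 3/32<..<s + 7/32}"
proof -
  let ?J = "{s + 3/32<..<s + 7/32}"
  have inc: "increasing (spreader s)" unfolding spreader_def by (intro increasing_intros X0_increasing) auto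
  have ge: "x \<le> app (spreader s) x" for x
    unfolding spreader_def using X0_ge[of "1/4" x "s + 1/32"] X0_ge[of "1/4" "app (X0 (s + 1/32) (1/4)) x" "s + 1/32"]
    by simp
  have jump: "app (spreader s) (s + 3/32) = s + 7/32"
    by (simp add: spreader_def app_X0 stretch_def)
  have pos: "app (zmul r (spreader s)) x > s + 7/32" if "x > s + 3/32" "1 \<le> r" for r x
    using \<open>1 \<le> r\<close>
  proof (induction r rule: int_ge_induct)
    case base
    then show ?case using increasing_less[OF inc, of "s + 3/32" x] that jump by simp
  next
    case (step i)
    then show ?case using ge[of "app (zmul i (spreader s)) x"] by (simp add: zmul_succ)
  qed
  show ?thesis
    unfolding wandering_def
  proof (intro allI impI notI)
    fix r x assume r: "r \<noteq> 0" and x: "x \<in> ?J" "app (zmul r (spreader s)) x \<in> ?J"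
    show False
    proof (cases "1 \<le> r")
      case True
      then show ?thesis using pos[of x r] x by auto
    next
      case False
      have "app (zmul (- r) (spreader s)) (app (zmul r (spreader s)) x) = x"
        by (simp add: zmul_uminus)
      then show ?thesis using pos[of "app (zmul r (spreader s)) x" "- r"] False r x by auto
    qed
  qed
qed

lemma tower_concrete:
  assumes "sup_in h V" "V \<subseteq> {s + 1/8<..<s + 3/16}"
  shows "tower (shifter s) (spreader s) h {s + 3/32<..<s + 7/32} V"
proof
  show "{s + 3/32<..<s + 7/32} \<noteq> {}" by simp
  show "{s + 3/32<..<s + 7/32} \<subseteq> app (shifter s) ` {s + 3/32<..<s + 7/32}"
    unfolding shifter_image by auto
  show "sup_in (spreader s) (app (shifter s) ` {s + 3/32<..<s + 7/32})"
    unfolding shifter_image spreader_def using X0_sup[of "1/4" "s + 1/32"]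
    by (intro sup_in_add) (simp_all add: add.commute)
  show "wandering (spreader s) {s + 3/32<..<s + 7/32}" by (rule spreader_wandering)
  show "V \<subseteq> {s + 3/32<..<s + 7/32}" using assms(2) by auto
  show "app (shifter s) x = x" if "x \<in> V" for x using that assms(2) by (intro shifter_values(3)) auto
qed (rule assms(1))

lemma concrete_sup: "sup_in (shifter s) {s<..<s + 1/2}" "sup_in (spreader s) {s<..<s + 1/2}"
proof -
  have *: "sup_in (X0 a w) {s<..<s + 1/2}" if "0 < w" "s \<le> a" "a + w \<le> s + 1/2" for a w
    using X0_sup[of w a] that by (auto elim: sup_in_mono)
  show "sup_in (shifter s) {s<..<s + 1/2}" "sup_in (spreader s) {s<..<s + 1/2}"
    unfolding shifter_def spreader_def by (intro sup_in_add sup_in_diff *; simp)+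
qed

lemma dyadic_32: "dyadic (real_of_int m / 32)"
  unfolding dyadic_def by (rule exI[of _ m], rule exI[of _ 5]) simp

lemma X0_32_PL:
  assumes "0 < n" "0 \<le> m" "m + n \<le> 32"
  shows "X0 (real_of_int m / 32) (real_of_int n / 32) \<in> PL"
  using assms by (intro X0_PL dyadic_32) (simp_all add: field_simps flip: of_int_add)

lemma generators_PL:
  shows "{shifter 0, spreader 0, core 0} \<subseteq> PL" "{shifter (1/2), spreader (1/2)} \<subseteq> PL"
proof -
  show "{shifter 0, spreader 0, core 0} \<subseteq> PL"
    \<comment> \<open>Each pair of numbers is the length and the left end of an interval in units of
      1/32.\<close>
    using X0_32_PL[of 4 6] X0_32_PL[of 4 0] X0_32_PL[of 8 1] X0_32_PL[of 2 4]
    unfolding shifter_def spreader_def core_def by (auto intro!: sgD[OF sg_PL])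
  show "{shifter (1/2), spreader (1/2)} \<subseteq> PL"
    using X0_32_PL[of 4 22] X0_32_PL[of 4 16] X0_32_PL[of 8 17]
    unfolding shifter_def spreader_def by (auto intro!: sgD[OF sg_PL])
qed

theorem theorem1p8:
  shows "\<exists>H0 H1.
     fin_gen_subgroup thompsonF H0 \<and> fin_gen_subgroup thompsonF H1 \<and>
     EA_class_omega_plus_2 (thompsonF\<lparr>carrier := H0\<rparr>) \<and>
     EA_class_omega_plus_2 (thompsonF\<lparr>carrier := H1\<rparr>) \<and>
     \<not> embeds (thompsonF\<lparr>carrier := H0\<rparr>) (thompsonF\<lparr>carrier := H1\<rparr>) \<and>
     \<not> embeds (thompsonF\<lparr>carrier := H1\<rparr>) (thompsonF\<lparr>carrier := H0\<rparr>)"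
proof -
  have V: "sup_in (core 0) {1/8<..<3/16}"
    unfolding core_def using X0_sup[of "1/16" "0 + 1/8"] by simp
  have T: "tower (shifter 0) (spreader 0) (core 0) {0 + 3/32<..<0 + 7/32} {1/8<..<3/16}"
    by (rule tower_concrete[OF V]) simp
  interpret T: tower "shifter 0" "spreader 0" "core 0" "{0 + 3/32<..<0 + 7/32}" "{1/8<..<3/16}" by (rule T)
  \<comment> \<open>The two factors act on the two halves of the unit interval, with supports
    \<open>V\<close> empty and \<open>h\<close> replaced by 0.\<close>
  interpret P: tower_pair "shifter 0" "spreader 0" "{0 + 3/32<..<0 + 7/32}" "shifter (1/2)" "spreader (1/2)"
      "{1/2 + 3/32<..<1/2 + 7/32}" "{0<..<0 + 1/2}" "{1/2<..<1/2 + 1/2}"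
    by (intro tower_pair.intro tower_concrete tower_pair_axioms.intro concrete_sup) auto
  have nz: "core 0 \<noteq> 0"
  proof
    assume "core 0 = 0"
    \<comment> \<open>The midpoint of the interval from 1/8 to 3/16 is moved by
      \<open>core 0\<close>.\<close>
    then have "app (core 0) (5/32) = app 0 (5/32)" by simp
    then show False by (simp add: core_def app_X0 stretch_def)
  qed
  \<comment> \<open>An equality of records, as both sides use composition of functions and the
    identity.\<close>
  have restrict: "thompsonF\<lparr>carrier := app ` H\<rparr> = fgrp H" for H
    by (simp add: thompsonF_def fgrp_def)
  have "fin_gen_subgroup thompsonF (app ` T.GG)" "fin_gen_subgroup thompsonF (app ` P.PP)"
    unfolding T.GG_def P.PP_def using generators_PL by (auto intro!: fin_gen_thompsonF)
  moreover have "EA_class_omega_plus_2 (fgrp T.GG)" by (rule T.EA_class_GG)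
  moreover have "EA_class_omega_plus_2 (fgrp P.PP)" by (rule P.EA_class_PP)
  moreover have "\<not> embeds (fgrp T.GG) (fgrp P.PP)" by (rule P.tower_not_embeds_pair[OF T nz])
  moreover have "\<not> embeds (fgrp P.PP) (fgrp T.GG)" by (rule P.pair_not_embeds_tower[OF T])
  ultimately show ?thesis unfolding restrict[symmetric] by blast
qed

end
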